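(* Let $(M_t)_{t\ge1}$, $(G_t)_{t\ge1}$ be as in the context, and for $T\ge1$, $N\ge2$ let $\pi^{(T)}$ and $P_N^{(T)}$ be the target and the i-cSMC kernel with time horizon $T$ and $N$ particles. Assume that $\pi^{(T)}_t\text{-}\mathrm{ess\,sup}_{z_t}G_t(z_t)<\infty$ for all $t$ (and $T\ge t$), and that at least one of the following holds: (A1) there is a constant $\alpha>0$ such that for all $p,k\in\mathbb N$, $\displaystyle\sup_{z\in\mathsf Z}\frac{Q_{p,p+k}(1)(z)}{\eta_pQ_{p,p+k}(1)}\le\alpha$; (A2) there is an integer $m\ge1$ and constants $1\le\beta<\infty$, $\delta<\infty$ such that for all $p\ge1$, $z,z'\in\mathsf Z$ and $B\in\mathcal B(\mathsf Z)$, $\bar M_{p,p+m}(z,B)\le\beta\bar M_{p,p+m}(z',B)$, and $1\le\sup_{z,z'\in\mathsf Z,\,p\ge1}G_p(z)/G_p(z')\le\delta^{1/m}$. Then there are constants $\epsilon_N^{(T)}>0$ ($N\ge 2$, $T\ge1$) such that, for every $T\ge 1$ and $N\ge2$: (i) $P^{(T)}_N(x,B)\ge\epsilon_N^{(T)}\pi^{(T)}(B)$ for all $x\in\mathsf Z^T$, $B\in\mathcal B(\mathsf Z^T)$, with $1-\epsilon_N^{(T)}=O(1/N)$ as $N\to\infty$ for each $T$; (ii) $\|\nu (P^{(T)}_N)^k-\pi^{(T)}\|_{L^2(\pi^{(T)})}\le\|\nu-\pi^{(T)}\|_{L^2(\pi^{(T)})}(1-\epsilon_N^{(T)})^k$ for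 all probabilities $\nu\ll\pi^{(T)}$, $k\ge1$; (iii) $\|\delta_x(P_N^{(T)})^k-\pi^{(T)}\|_{TV}\le(1-\epsilon_N^{(T)})^k$ for all $x$, $k\ge1$; (iv) $\mathrm{var}_{\pi^{(T)}}(f)\le\mathrm{var}(f,P_N^{(T)})\le[2/\epsilon_N^{(T)}-1]\mathrm{var}_{\pi^{(T)}}(f)$ for all $f\in L^2(\pi^{(T)})$; and moreover there exist constants $C,\varepsilon>0$, not depending on $T$ (with $CT$ an integer at least $2$ for all $T\ge1$), such that with $N=C\times T$ one has $\epsilon_N^{(T)}\ge\varepsilon$ for every $T\ge1$.
   Context: Setting. $[N]:=\{1,\dots,N\}$. $(\mathsf Z,\mathcal B(\mathsf Z))$ is a measurable space. $M_1$ is a probability on $\mathsf Z$; $M_t$ ($t\ge2$) are Markov kernels on $\mathsf Z$; $G_t:\mathsf Z\to[0,\infty)$ ($t\ge1$) are measurable. Under $\mathbb P$, $(Z_t)_{t\ge1}$ is the Markov chain with $Z_1\sim M_1$ and transition $M_t(Z_{t-1},\cdot)$ at time $t$. For each $T$, $\gamma_T:=\mathbb E[\prod_{t=1}^TG_t(Z_t)]$, with $0<\gamma_T<\infty$, and $\pi^{(T)}(B):=\gamma_T^{-1}\mathbb E[\mathbb I\{Z_{1:T}\in B\}\prod_{t=1}^TG_t(Z_t)]$, a probability on $\mathsf Z^T$; $\pi^{(T)}_t$ is its $t$-th marginal. For $1\le p\le q$ and $f:\mathsf Z\to\mathbb R$: $Q_{p,q}(f)(z):=\mathbb E[f(Z_q)\prod_{k=p}^{q-1}G_k(Z_k)\mid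 Z_p=z]$, $Q_{0,p}(f):=M_1(Q_{1,p}(f))$, $\eta_p(f):=Q_{0,p}(f)/Q_{0,p}(1)$. $\bar M_{p,p+1}(z,\cdot):=M_{p+1}(z,\cdot)$ and $\bar M_{p,q}(z,\cdot):=\int M_{p+1}(z,dz')\bar M_{p+1,q}(z',\cdot)$. cSMC process with horizon $T$. Given $x=(x_1,\dots,x_T)\in\mathsf Z^T$, $\mathbb P^N_{\mathbf 1,x}$ is the law of $Z_t=(Z_t^1,\dots,Z_t^N)\in\mathsf Z^N$ ($t\in[T]$), $A_t\in[N]^N$ ($t\le T-1$), $A_T\in[N]$, such that: $Z_1^1=x_1$ and $Z_1^2,\dots,Z_1^N$ are i.i.d. $M_1$; for $2\le t\le T$, given the past (depending only on $Z_{t-1}$), $Z_t^1=x_t$, $A_{t-1}^1=1$, and independently for $i=2,\dots,N$, $A_{t-1}^i=k$ with probability $G_{t-1}(Z_{t-1}^k)/\sum_{j=1}^NG_{t-1}(Z_{t-1}^j)$ and then $Z_t^i\sim M_t(Z_{t-1}^{A_{t-1}^i},\cdot)$; finally $A_T=k$ with probability $G_T(Z_T^k)/\sum_{j=1}^NG_T(Z_T^j)$. Convention: if a denominator is zero the index $1$ is selected. i-cSMC kernel. Set $i_T:=A_T$, $i_t:=A_t^{i_{t+1}}$ for $t=T-1,\dots,1$. Then $P_N^{(T)}(x,B):=\mathbb P^N_{\mathbf 1,x}((Z_1^{i_1},\dots,Z_T^{i_T})\in B)$. Notation. $\|\nu\|_{TV}:=\frac12\sup_{f:\to[-1,1]}\nu(f)$;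 for $\nu\ll\pi$, $\|\nu\|^2_{L^2(\pi)}:=\int|d\nu/d\pi|^2d\pi$; $\mathrm{var}_\pi(f):=\pi(f^2)-\pi(f)^2$; $\mathrm{var}(f,\Pi):=\lim_{M\to\infty}\mathrm{var}(M^{-1/2}\sum_{i=1}^M[f(\xi_i)-\pi(f)])$ for the stationary chain $(\xi_i)$ with kernel $\Pi$. *)

theory Defs
  imports "HOL-Probability.Probability" "HOL-Library.Landau_Symbols"
begin

text \<open>A distribution on paths \<open>(w\<^sub>1, \<dots>, w\<^sub>T)\<close> lives on \<open>PiM {1..T} (\<lambda>_. S)\<close>, where \<open>S\<close> carries the
  state space.  Every kernel is a function from points to measures.\<close>

definition paths :: "'a measure \<Rightarrow> nat \<Rightarrow> (nat \<Rightarrow> 'a) measure" where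
  "paths S T = (\<Pi>\<^sub>M t\<in>{1..T}. S)"

text \<open>Law of \<open>(Z\<^sub>p, \<dots>, Z\<^bsub>p+n\<^esub>)\<close> given \<open>Z\<^sub>p = z\<close>; the kernel \<open>K t\<close> leads from time \<open>t - 1\<close> to time \<open>t\<close>.\<close>

primrec chain_from ::
  "'a measure \<Rightarrow> (nat \<Rightarrow> 'a \<Rightarrow> 'a measure) \<Rightarrow> nat \<Rightarrow> 'a \<Rightarrow> nat \<Rightarrow> (nat \<Rightarrow> 'a) measure" where
  "chain_from S K p z 0 = return (\<Pi>\<^sub>M t\<in>{p..p}. S) (\<lambda>t\<in>{p}. z)"
| "chain_from S K p z (Suc n) =
     bind (chain_from S K p z n)
       (\<lambda>w. distr (K (Suc (p + n)) (w (p + n))) (\<Pi>\<^sub>M t\<in>{p..p + Suc n}. S)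
              (\<lambda>y. w(Suc (p + n) := y)))"

text \<open>Law of \<open>(Z\<^sub>1, \<dots>, Z\<^sub>T)\<close> for \<open>T \<ge> 1\<close> with \<open>Z\<^sub>1\<close> distributed as \<open>\<mu>\<close>; \<open>K 0\<close> and \<open>K 1\<close> are never used.\<close>

definition chain_law ::
  "'a measure \<Rightarrow> 'a measure \<Rightarrow> (nat \<Rightarrow> 'a \<Rightarrow> 'a measure) \<Rightarrow> nat \<Rightarrow> (nat \<Rightarrow> 'a) measure" where
  "chain_law S \<mu> K T = bind \<mu> (\<lambda>z. chain_from S K 1 z (T - 1))"

definition gam ::
  "'z measure \<Rightarrow> 'z measure \<Rightarrow> (nat \<Rightarrow> 'z \<Rightarrow> 'z measure) \<Rightarrow> (nat \<Rightarrow> 'z \<Rightarrow> real) \<Rightarrow> nat \<Rightarrow> ennreal" where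
  "gam S M1 M G T = (\<integral>\<^sup>+ w. (\<Prod>t=1..T. ennreal (G t (w t))) \<partial>chain_law S M1 M T)"

definition target ::
  "'z measure \<Rightarrow> 'z measure \<Rightarrow> (nat \<Rightarrow> 'z \<Rightarrow> 'z measure) \<Rightarrow> (nat \<Rightarrow> 'z \<Rightarrow> real) \<Rightarrow> nat
     \<Rightarrow> (nat \<Rightarrow> 'z) measure" where
  "target S M1 M G T =
     density (chain_law S M1 M T) (\<lambda>w. (\<Prod>t=1..T. ennreal (G t (w t))) / gam S M1 M G T)"

definition target_marginal ::
  "'z measure \<Rightarrow> 'z measure \<Rightarrow> (nat \<Rightarrow> 'z \<Rightarrow> 'z measure) \<Rightarrow> (nat \<Rightarrow> 'z \<Rightarrow> real) \<Rightarrow> nat \<Rightarrow> nat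
     \<Rightarrow> 'z measure" where
  "target_marginal S M1 M G T t = distr (target S M1 M G T) S (\<lambda>w. w t)"

text \<open>\<open>Q\<^bsub>p,q\<^esub>(f)\<close> for \<open>1 \<le> p \<le> q\<close>, then \<open>Q\<^bsub>0,p\<^esub>(f)\<close> and \<open>\<eta>\<^sub>p(f)\<close>, on nonnegative functions; values are in
  \<open>[0, \<infinity>]\<close> since the potentials may be unbounded.\<close>

definition Q ::
  "'z measure \<Rightarrow> (nat \<Rightarrow> 'z \<Rightarrow> 'z measure) \<Rightarrow> (nat \<Rightarrow> 'z \<Rightarrow> real) \<Rightarrow> nat \<Rightarrow> nat
     \<Rightarrow> ('z \<Rightarrow> ennreal) \<Rightarrow> 'z \<Rightarrow> ennreal" where
  "Q S M G p q f z =
     (\<integral>\<^sup>+ w. f (w q) * (\<Prod>k\<in>{p..<q}. ennreal (G k (w k))) \<partial>chain_from S M p z (q - p))"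

definition Q0 ::
  "'z measure \<Rightarrow> 'z measure \<Rightarrow> (nat \<Rightarrow> 'z \<Rightarrow> 'z measure) \<Rightarrow> (nat \<Rightarrow> 'z \<Rightarrow> real) \<Rightarrow> nat
     \<Rightarrow> ('z \<Rightarrow> ennreal) \<Rightarrow> ennreal" where
  "Q0 S M1 M G p f = (\<integral>\<^sup>+ z. Q S M G 1 p f z \<partial>M1)"

definition eta ::
  "'z measure \<Rightarrow> 'z measure \<Rightarrow> (nat \<Rightarrow> 'z \<Rightarrow> 'z measure) \<Rightarrow> (nat \<Rightarrow> 'z \<Rightarrow> real) \<Rightarrow> nat
     \<Rightarrow> ('z \<Rightarrow> ennreal) \<Rightarrow> ennreal" where
  "eta S M1 M G p f = Q0 S M1 M G p f / Q0 S M1 M G p (\<lambda>_. 1)"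

text \<open>\<open>Mbar M n p\<close> is the \<open>n\<close>-step kernel from time \<open>p\<close> to time \<open>p + n\<close>; it is meant for \<open>n \<ge> 1\<close>, and the
  value at \<open>n = 0\<close> is a dummy.\<close>

primrec Mbar :: "(nat \<Rightarrow> 'z \<Rightarrow> 'z measure) \<Rightarrow> nat \<Rightarrow> nat \<Rightarrow> 'z \<Rightarrow> 'z measure" where
  "Mbar M 0 p = M (Suc p)"
| "Mbar M (Suc n) p =
     (if n = 0 then M (Suc p) else (\<lambda>z. bind (M (Suc p) z) (Mbar M n (Suc p))))"

text \<open>Selection of an index in \<open>{1..N}\<close> with probability proportional to \<open>w\<close>; index 1 is selected if all
  weights vanish.\<close>

definition select :: "nat \<Rightarrow> (nat \<Rightarrow> real) \<Rightarrow> nat measure" where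
  "select N w = point_measure {1..N}
     (\<lambda>k. ennreal (if (\<Sum>j=1..N. w j) = 0 then (if k = 1 then 1 else 0)
                    else w k / (\<Sum>j=1..N. w j)))"

text \<open>Joint law of \<open>(A\<^sub>t\<^sup>i, Z\<^bsub>t+1\<^esub>\<^sup>i)\<close>, \<open>i \<in> {1..N}\<close>, given \<open>Z\<^sub>t = z\<close>, with reference path \<open>x\<close>.\<close>

definition csmc_step ::
  "'z measure \<Rightarrow> (nat \<Rightarrow> 'z \<Rightarrow> 'z measure) \<Rightarrow> (nat \<Rightarrow> 'z \<Rightarrow> real) \<Rightarrow> nat \<Rightarrow> (nat \<Rightarrow> 'z) \<Rightarrow> nat
     \<Rightarrow> (nat \<Rightarrow> 'z) \<Rightarrow> (nat \<Rightarrow> nat \<times> 'z) measure" where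
  "csmc_step S M G N x t z =
     (\<Pi>\<^sub>M i\<in>{1..N}.
        if i = 1 then return (count_space {1..N} \<Otimes>\<^sub>M S) (1, x (Suc t))
        else bind (select N (\<lambda>k. G t (z k)))
               (\<lambda>k. distr (M (Suc t) (z k)) (count_space {1..N} \<Otimes>\<^sub>M S) (Pair k)))"

text \<open>Space of \<open>((Z\<^sub>1, \<dots>, Z\<^bsub>n+1\<^esub>), (A\<^sub>1, \<dots>, A\<^sub>n))\<close>; \<open>Z t i\<close> and \<open>A t i\<close> stand for \<open>Z\<^sub>t\<^sup>i\<close> and \<open>A\<^sub>t\<^sup>i\<close>.\<close>

definition csmc_space ::
  "'z measure \<Rightarrow> nat \<Rightarrow> nat \<Rightarrow> ((nat \<Rightarrow> nat \<Rightarrow> 'z) \<times> (nat \<Rightarrow> nat \<Rightarrow> nat)) measure" where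
  "csmc_space S N n =
     (\<Pi>\<^sub>M t\<in>{1..Suc n}. \<Pi>\<^sub>M i\<in>{1..N}. S) \<Otimes>\<^sub>M (\<Pi>\<^sub>M t\<in>{1..n}. \<Pi>\<^sub>M i\<in>{1..N}. count_space {1..N})"

primrec csmc_hist ::
  "'z measure \<Rightarrow> 'z measure \<Rightarrow> (nat \<Rightarrow> 'z \<Rightarrow> 'z measure) \<Rightarrow> (nat \<Rightarrow> 'z \<Rightarrow> real) \<Rightarrow> nat \<Rightarrow> (nat \<Rightarrow> 'z)
     \<Rightarrow> nat \<Rightarrow> ((nat \<Rightarrow> nat \<Rightarrow> 'z) \<times> (nat \<Rightarrow> nat \<Rightarrow> nat)) measure" where
  "csmc_hist S M1 M G N x 0 =
     distr (\<Pi>\<^sub>M i\<in>{1..N}. if i = 1 then return S (x 1) else M1) (csmc_space S N 0)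
       (\<lambda>z. (\<lambda>t\<in>{1}. z, \<lambda>t\<in>{}. undefined))"
| "csmc_hist S M1 M G N x (Suc n) =
     bind (csmc_hist S M1 M G N x n)
       (\<lambda>(Z, A). distr (csmc_step S M G N x (Suc n) (Z (Suc n))) (csmc_space S N (Suc n))
          (\<lambda>y. (Z(Suc (Suc n) := (\<lambda>i\<in>{1..N}. snd (y i))), A(Suc n := (\<lambda>i\<in>{1..N}. fst (y i))))))"

text \<open>Law of \<open>((Z\<^sub>1, \<dots>, Z\<^sub>T), (A\<^sub>1, \<dots>, A\<^bsub>T-1\<^esub>), A\<^sub>T)\<close>.\<close>

definition csmc_law ::
  "'z measure \<Rightarrow> 'z measure \<Rightarrow> (nat \<Rightarrow> 'z \<Rightarrow> 'z measure) \<Rightarrow> (nat \<Rightarrow> 'z \<Rightarrow> real) \<Rightarrow> nat \<Rightarrow> nat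
     \<Rightarrow> (nat \<Rightarrow> 'z) \<Rightarrow> (((nat \<Rightarrow> nat \<Rightarrow> 'z) \<times> (nat \<Rightarrow> nat \<Rightarrow> nat)) \<times> nat) measure" where
  "csmc_law S M1 M G N T x =
     bind (csmc_hist S M1 M G N x (T - 1))
       (\<lambda>(Z, A). distr (select N (\<lambda>k. G T (Z T k))) (csmc_space S N (T - 1) \<Otimes>\<^sub>M count_space {1..N})
          (Pair (Z, A)))"

text \<open>\<open>lineage A T a j\<close> is \<open>i\<^bsub>T-j\<^esub>\<close>, where \<open>i\<^sub>T = a\<close> and \<open>i\<^sub>t = A t i\<^bsub>t+1\<^esub>\<close>.\<close>

primrec lineage :: "(nat \<Rightarrow> nat \<Rightarrow> nat) \<Rightarrow> nat \<Rightarrow> nat \<Rightarrow> nat \<Rightarrow> nat" where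
  "lineage A T a 0 = a"
| "lineage A T a (Suc j) = A (T - Suc j) (lineage A T a j)"

definition icsmc ::
  "'z measure \<Rightarrow> 'z measure \<Rightarrow> (nat \<Rightarrow> 'z \<Rightarrow> 'z measure) \<Rightarrow> (nat \<Rightarrow> 'z \<Rightarrow> real) \<Rightarrow> nat \<Rightarrow> nat
     \<Rightarrow> (nat \<Rightarrow> 'z) \<Rightarrow> (nat \<Rightarrow> 'z) measure" where
  "icsmc S M1 M G N T x =
     distr (csmc_law S M1 M G N T x) (paths S T)
       (\<lambda>((Z, A), a). \<lambda>t\<in>{1..T}. Z t (lineage A T a (T - t)))"

definition kernel_iter :: "'a measure \<Rightarrow> ('a \<Rightarrow> 'a measure) \<Rightarrow> nat \<Rightarrow> 'a measure" where
  "kernel_iter \<nu> P k = ((\<lambda>\<mu>. bind \<mu> P) ^^ k) \<nu>"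

text \<open>Total variation norm of the signed measure \<open>\<mu> - \<nu>\<close>, for probabilities on the same space.\<close>

definition tv_dist :: "'a measure \<Rightarrow> 'a measure \<Rightarrow> real" where
  "tv_dist \<mu> \<nu> =
     (SUP f\<in>{f \<in> borel_measurable \<mu>. \<forall>x\<in>space \<mu>. f x \<in> {-1..1}}. (\<integral>x. f x \<partial>\<mu>) - (\<integral>x. f x \<partial>\<nu>)) / 2"

text \<open>\<open>L\<^sup>2(\<pi>)\<close> norm of the signed measure \<open>\<mu> - \<nu>\<close>, for probabilities; it is infinite if one of them has no density
  or if the difference of the densities is not square integrable.\<close>

definition L2_dist :: "'a measure \<Rightarrow> 'a measure \<Rightarrow> 'a measure \<Rightarrow> ennreal" where
  "L2_dist \<pi> \<mu> \<nu> =
     (let I = (\<integral>\<^sup>+ x. ennreal ((enn2real (RN_deriv \<pi> \<mu> x) - enn2real (RN_deriv \<pi> \<nu> x))\<^sup>2) \<partial>\<pi>)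
      in if absolutely_continuous \<pi> \<mu> \<and> absolutely_continuous \<pi> \<nu> \<and> I < \<infinity>
         then ennreal (sqrt (enn2real I)) else \<infinity>)"

definition var :: "'a measure \<Rightarrow> ('a \<Rightarrow> real) \<Rightarrow> real" where
  "var \<mu> f = (\<integral>x. (f x)\<^sup>2 \<partial>\<mu>) - (\<integral>x. f x \<partial>\<mu>)\<^sup>2"

text \<open>Variance of \<open>n\<^bsup>-1/2\<^esup> \<Sum>\<^bsub>i\<le>n\<^esub> [f(\<xi>\<^sub>i) - \<pi>(f)]\<close> for the stationary chain \<open>\<xi>\<close> with kernel \<open>P\<close>.\<close>

definition avg_var :: "'a measure \<Rightarrow> ('a \<Rightarrow> 'a measure) \<Rightarrow> ('a \<Rightarrow> real) \<Rightarrow> nat \<Rightarrow> real" where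
  "avg_var \<pi> P f n =
     var (chain_law \<pi> \<pi> (\<lambda>_. P) n)
       (\<lambda>\<xi>. (\<Sum>i=1..n. f (\<xi> i) - (\<integral>x. f x \<partial>\<pi>)) / sqrt (real n))"

definition asym_var :: "'a measure \<Rightarrow> ('a \<Rightarrow> 'a measure) \<Rightarrow> ('a \<Rightarrow> real) \<Rightarrow> real" where
  "asym_var \<pi> P f = lim (avg_var \<pi> P f)"

end

theory Submission
  imports Defs
begin

text \<open>Three properties of the i-cSMC kernel \<open>P\<close> carry the theorem: it is
  reversible for the target \<open>\<pi>\<close>, it is positive as an operator on
  \<open>L\<^sup>2(\<pi>)\<close>, and it dominates \<open>\<epsilon> \<pi>\<close> from every
  starting path, where \<open>\<epsilon> = ((N - 1) / (2 a + N - 2))\<^sup>T\<close> and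
  \<open>a\<close> is a constant supplied by either mixing assumption.

  Any kernel with these properties converges at rate \<open>1 - \<epsilon>\<close> (locale
  \<open>positive_reversible_kernel\<close>). Since \<open>P x - \<epsilon> \<pi>\<close> is a
  nonnegative measure of mass \<open>1 - \<epsilon>\<close> that has \<open>(1 - \<epsilon>)
  \<pi>\<close> as its \<open>\<pi>\<close>-average, Cauchy-Schwarz makes \<open>P\<close> contract
  centred functions by \<open>1 - \<epsilon>\<close> (\<open>markov_op_contraction\<close>). By
  reversibility the density of \<open>\<nu> P\<close> is \<open>P (d\<nu> / d\<pi>)\<close>, so
  densities contract too (\<open>L2_contraction\<close>); the total variation bound comes from the
  minorisation and the invariance of \<open>\<pi>\<close> (\<open>tv_contraction\<close>).
  Positivity puts the autocovariances \<open>\<langle>f, P\<^sup>k f\<rangle>\<close> between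
  \<open>0\<close> and \<open>(1 - \<epsilon>)\<^sup>k var(f)\<close>, and summing the geometric
  series bounds the asymptotic variance (\<open>asymptotic_variance\<close>).

  For the minorisation, replace every particle by its whole ancestral path. One generation then
  consists of the reference path and \<open>N - 1\<close> conditionally independent newborn paths,
  and \<open>P(x, B)\<close> is at least the mean of \<open>\<Sum>\<^bsub>k\<ge>2\<^esub>
  \<phi>(\<xi>\<^sub>k) / \<Sum>\<^sub>j v(\<xi>\<^sub>j)\<close> with \<open>v = G\<^sub>T\<close>
  and \<open>\<phi> = G\<^sub>T 1\<^sub>B\<close>. Conditionally on the previous generation and on
  \<open>\<xi>\<^sub>k\<close>, Jensen's inequality for \<open>1 / y\<close> moves the expectation
  into the denominator. The two terms \<open>v(\<xi>\<^sub>1)\<close> and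
  \<open>v(\<xi>\<^sub>k)\<close> are replaced by an upper bound for \<open>v\<close>, and what
  remains is a ratio of the same shape one generation earlier. Going back to time 1 turns the
  numerator into \<open>\<gamma>\<^sub>T \<pi>(B)\<close> and the denominator into
  \<open>\<gamma>\<^sub>T\<close>, at the price of one factor \<open>(N - 1) / (2 a + N - 2)\<close>
  per generation (\<open>ratio_mean_lower_bound\<close>, \<open>icsmc_minorised\<close>). The upper
  bounds stay under control because all the \<open>v\<close> that occur lie in a cone
  (\<open>dominated\<close>) in which the supremum is at most \<open>a\<close> times a mean; (A1)
  and (A2) both imply that the potentials lie in it (\<open>stable_A1\<close>,
  \<open>stable_A2\<close>).

  For reversibility and positivity, draw the reference path itself from the unnormalised target. The
  resulting law of the whole particle system is exchangeable
  (\<open>extended_law_exchangeable\<close>): the weight carried by the tagged particle makes it,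
  after symmetrisation, a particle drawn like all the others. Hence \<open>\<gamma>\<^sub>T
  \<langle>u, P v\<rangle> = N\<^sup>-\<^sup>1 \<integral> W U V\<close>, where \<open>W\<close> is
  the total weight of the last generation, and \<open>U\<close> and \<open>V\<close> are the means
  of \<open>u\<close> and \<open>v\<close> over the selected path (\<open>bilinear_form\<close>).
  This form is symmetric and positive.

  Finally \<open>1 - \<epsilon> \<le> T (2 a - 1) / N\<close> and \<open>\<epsilon> \<ge> exp (- T
  (2 a - 1) / (N - 1))\<close>; for \<open>N = 2 T\<close> the second bound is at least \<open>exp
  (- (2 a - 1))\<close> whatever \<open>T\<close>, because \<open>T \<le> 2 T - 1\<close>.\<close>

section \<open>Elementary inequalities and integrals against mixtures\<close>

lemma ennreal_two_mult_le_squares: "2 * (a * b) \<le> a * a + b * (b :: ennreal)"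
proof (cases "a = top \<or> b = top")
  case True
  then show ?thesis by (auto simp: ennreal_top_mult)
next
  case False
  then obtain r q where "a = ennreal r" "b = ennreal q" "0 \<le> r" "0 \<le> q" by (cases a; cases b) auto
  moreover have "2 * (r * q) \<le> r * r + q * q" using sum_squares_bound[of r q] by (simp add: power2_eq_square mult.assoc)
  ultimately show ?thesis
    by (simp add: ennreal_mult[symmetric] ennreal_numeral[symmetric] del: ennreal_numeral flip: ennreal_plus)
qed

text \<open>The iterated integral formula for an unbounded \<open>f\<close>. The inner integral may
  be undefined on a null set; the identity is obtained by splitting \<open>f\<close> into its
  positive and negative parts and using the formula for nonnegative integrands.\<close>

lemma integral_bind_L1:
  fixes f :: "'b \<Rightarrow> real"
  assumes N[measurable]: "N \<in> M \<rightarrow>\<^sub>M subprob_algebra B" and f[measurable]: "f \<in> borel_measurable B"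
    and fin: "(\<integral>\<^sup>+x. \<integral>\<^sup>+y. ennreal \<bar>f y\<bar> \<partial>N x \<partial>M) < \<infinity>"
    and ne: "space M \<noteq> {}"
  shows "integrable (M \<bind> N) f" "(\<integral>y. f y \<partial>(M \<bind> N)) = (\<integral>x. \<integral>y. f y \<partial>N x \<partial>M)"
proof -
  have sb[measurable_cong]: "sets (M \<bind> N) = sets B" by (rule sets_bind_measurable[OF N ne])
  have fb: "(\<integral>\<^sup>+y. ennreal \<bar>f y\<bar> \<partial>(M \<bind> N)) = (\<integral>\<^sup>+x. \<integral>\<^sup>+y. ennreal \<bar>f y\<bar> \<partial>N x \<partial>M)"
    by (rule nn_integral_bind[where B=B]) auto
  show int: "integrable (M \<bind> N) f"
    by (rule integrableI_bounded) (use fb fin in auto)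
  define a where "a = (\<lambda>x. \<integral>\<^sup>+y. ennreal (f y) \<partial>N x)"
  define b where "b = (\<lambda>x. \<integral>\<^sup>+y. ennreal (- f y) \<partial>N x)"
  define c where "c = (\<lambda>x. \<integral>\<^sup>+y. ennreal \<bar>f y\<bar> \<partial>N x)"
  have [measurable]: "a \<in> borel_measurable M" "b \<in> borel_measurable M" "c \<in> borel_measurable M"
    by (auto simp: a_def b_def c_def)
  have ac: "a x \<le> c x" "b x \<le> c x" for x
    unfolding a_def b_def c_def by (auto intro!: nn_integral_mono ennreal_leI)
  have cfin: "(\<integral>\<^sup>+x. c x \<partial>M) < \<infinity>" using fin by (simp add: c_def)
  have aecfin: "AE x in M. c x < \<infinity>"
    using nn_integral_PInf_AE[of c M] cfin by (auto simp: less_top)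
  have afin: "(\<integral>\<^sup>+x. a x \<partial>M) < \<infinity>" "(\<integral>\<^sup>+x. b x \<partial>M) < \<infinity>"
    using nn_integral_mono[of M a c] nn_integral_mono[of M b c] ac cfin
    by (meson le_less_trans)+
  have en: "(\<integral>x. enn2real (h x) \<partial>M) = enn2real (\<integral>\<^sup>+x. h x \<partial>M) \<and> integrable M (\<lambda>x. enn2real (h x))"
    if [measurable]: "h \<in> borel_measurable M" and h: "(\<integral>\<^sup>+x. h x \<partial>M) < \<infinity>" "AE x in M. h x < \<infinity>" for h
  proof -
    have eq: "(\<integral>\<^sup>+x. ennreal (enn2real (h x)) \<partial>M) = (\<integral>\<^sup>+x. h x \<partial>M)"
      by (rule nn_integral_cong_AE) (use h(2) in \<open>eventually_elim; simp add: less_top\<close>)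
    have "integrable M (\<lambda>x. enn2real (h x))"
      by (rule integrableI_nonneg) (use eq h in auto)
    moreover have "(\<integral>x. enn2real (h x) \<partial>M) = enn2real (\<integral>\<^sup>+x. ennreal (enn2real (h x)) \<partial>M)"
      by (rule integral_eq_nn_integral) auto
    ultimately show ?thesis using eq by simp
  qed
  have aea: "AE x in M. a x < \<infinity>" "AE x in M. b x < \<infinity>"
    using aecfin by (eventually_elim, metis ac le_less_trans)+
  have "(\<integral>y. f y \<partial>(M \<bind> N)) = enn2real (\<integral>\<^sup>+x. a x \<partial>M) - enn2real (\<integral>\<^sup>+x. b x \<partial>M)"
    unfolding real_lebesgue_integral_def[OF int] a_def b_def
    by (subst (1 2) nn_integral_bind[where B=B]) auto
  also have "\<dots> = (\<integral>x. enn2real (a x) \<partial>M) - (\<integral>x. enn2real (b x) \<partial>M)"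
    using en[of a] en[of b] afin aea by auto
  also have "\<dots> = (\<integral>x. enn2real (a x) - enn2real (b x) \<partial>M)"
    using en[of a] en[of b] afin aea by (intro Bochner_Integration.integral_diff[symmetric]) auto
  also have "\<dots> = (\<integral>x. \<integral>y. f y \<partial>N x \<partial>M)"
  proof (rule integral_cong_AE)
    have [measurable]: "(\<lambda>x. \<integral>y. f y \<partial>N x) \<in> borel_measurable M"
      using measurable_compose[OF N integral_measurable_subprob_algebra[OF f]] .
    show "(\<lambda>x. \<integral>y. f y \<partial>N x) \<in> borel_measurable M" by simp
    show "AE x in M. enn2real (a x) - enn2real (b x) = (\<integral>y. f y \<partial>N x)"
      using aecfin AE_space
    proof eventually_elim
      case (elim x)
      have [measurable_cong]: "sets (N x) = sets B" by (rule sets_kernel[OF N elim(2)])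
      have "integrable (N x) f" by (rule integrableI_bounded) (use elim in \<open>auto simp: c_def\<close>)
      then show ?case by (simp add: real_lebesgue_integral_def a_def b_def)
    qed
  qed auto
  finally show "(\<integral>y. f y \<partial>(M \<bind> N)) = (\<integral>x. \<integral>y. f y \<partial>N x \<partial>M)" .
qed

text \<open>Domination between measures passes from sets to nonnegative integrands.\<close>

lemma cmult_nn_integral_le_cmult:
  assumes prob: "prob_space \<mu>" "prob_space \<nu>" and s: "sets \<mu> = sets \<nu>" and b: "0 \<le> b" "0 \<le> c"
    and le: "\<And>A. A \<in> sets \<nu> \<Longrightarrow> c * measure \<mu> A \<le> b * measure \<nu> A"
    and u: "u \<in> borel_measurable \<nu>"
  shows "ennreal c * (\<integral>\<^sup>+x. u x \<partial>\<mu>) \<le> ennreal b * (\<integral>\<^sup>+x. u x \<partial>\<nu>)"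
proof -
  interpret m: prob_space \<mu> by fact
  interpret n: prob_space \<nu> by fact
  have u': "u \<in> borel_measurable \<mu>" unfolding measurable_cong_sets[OF s refl] by (rule u)
  have "scale_measure (ennreal c) \<mu> \<le> scale_measure (ennreal b) \<nu>"
    by (subst le_measure)
      (use le b s in \<open>auto simp: m.emeasure_eq_measure n.emeasure_eq_measure ennreal_mult[symmetric] intro!: ennreal_leI\<close>)
  then have "(\<integral>\<^sup>+x. u x \<partial>scale_measure (ennreal c) \<mu>) \<le> (\<integral>\<^sup>+x. u x \<partial>scale_measure (ennreal b) \<nu>)"
    by (rule nn_integral_mono_measure[rotated]) (simp add: s)
  then show ?thesis using u u' by (simp add: nn_integral_scale_measure)
qed

lemma abs_mult_le_sum_squares: "\<bar>a * b\<bar> \<le> a\<^sup>2 + (b :: real)\<^sup>2"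
proof -
  have "2 * \<bar>a * b\<bar> \<le> a\<^sup>2 + b\<^sup>2"
    using sum_squares_bound[of "\<bar>a\<bar>" "\<bar>b\<bar>"] by (simp add: abs_mult mult.assoc)
  then show ?thesis by linarith
qed

section \<open>Positive reversible kernels with a minorisation\<close>

text \<open>Reversibility and positivity are required for nonnegative functions with values in
  \<open>[0, \<infinity>]\<close> only, where no integrability is at stake. The inequality
  \<open>pos\<close> says that the quadratic form of \<open>P\<close> is nonnegative at \<open>u -
  v\<close>, with the subtraction moved to the other side.\<close>

locale positive_reversible_kernel = prob_space \<pi> for \<pi> :: "'a measure" +
  fixes P :: "'a \<Rightarrow> 'a measure" and \<epsilon> :: real
  assumes P[measurable]: "P \<in> \<pi> \<rightarrow>\<^sub>M prob_algebra \<pi>"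
    and sym: "\<And>u v :: 'a \<Rightarrow> ennreal. u \<in> borel_measurable \<pi> \<Longrightarrow> v \<in> borel_measurable \<pi> \<Longrightarrow>
        (\<integral>\<^sup>+x. u x * (\<integral>\<^sup>+y. v y \<partial>P x) \<partial>\<pi>) = (\<integral>\<^sup>+x. v x * (\<integral>\<^sup>+y. u y \<partial>P x) \<partial>\<pi>)"
    and pos: "\<And>u v :: 'a \<Rightarrow> ennreal. u \<in> borel_measurable \<pi> \<Longrightarrow> v \<in> borel_measurable \<pi> \<Longrightarrow>
        2 * (\<integral>\<^sup>+x. u x * (\<integral>\<^sup>+y. v y \<partial>P x) \<partial>\<pi>)
          \<le> (\<integral>\<^sup>+x. u x * (\<integral>\<^sup>+y. u y \<partial>P x) \<partial>\<pi>) + (\<integral>\<^sup>+x. v x * (\<integral>\<^sup>+y. v y \<partial>P x) \<partial>\<pi>)"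
    and minor: "\<And>x B. x \<in> space \<pi> \<Longrightarrow> B \<in> sets \<pi> \<Longrightarrow> \<epsilon> * measure \<pi> B \<le> measure (P x) B"
    and eps: "0 < \<epsilon>" "\<epsilon> < 1"
begin

lemma P_sub[measurable]: "P \<in> \<pi> \<rightarrow>\<^sub>M subprob_algebra \<pi>"
  using P by (rule measurable_prob_algebraD)

lemma P_prob: "x \<in> space \<pi> \<Longrightarrow> prob_space (P x)"
  and P_sets: "x \<in> space \<pi> \<Longrightarrow> sets (P x) = sets \<pi>"
  and P_space: "x \<in> space \<pi> \<Longrightarrow> space (P x) = space \<pi>"
  using measurable_space[OF P] by (auto simp: space_prob_algebra dest: sets_eq_imp_space_eq)

lemma P_meas_iff: "x \<in> space \<pi> \<Longrightarrow> borel_measurable (P x) = borel_measurable \<pi>"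
  by (rule measurable_cong_sets) (auto simp: P_sets)

lemma P_one: "x \<in> space \<pi> \<Longrightarrow> (\<integral>\<^sup>+y. 1 \<partial>P x) = 1"
  using prob_space.emeasure_space_1[OF P_prob] by simp

text \<open>Invariance is reversibility tested against the constant 1.\<close>

lemma invariant_nn:
  assumes [measurable]: "v \<in> borel_measurable \<pi>"
  shows "(\<integral>\<^sup>+x. \<integral>\<^sup>+y. v y \<partial>P x \<partial>\<pi>) = (\<integral>\<^sup>+x. v x \<partial>\<pi>)"
proof -
  have "(\<integral>\<^sup>+x. v x * (\<integral>\<^sup>+y. 1 \<partial>P x) \<partial>\<pi>) = (\<integral>\<^sup>+x. v x \<partial>\<pi>)"
    by (rule nn_integral_cong) (simp only: P_one mult_1_right)
  then show ?thesis using sym[of "\<lambda>_. 1" v] by simp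
qed

lemma minor_nn:
  assumes x: "x \<in> space \<pi>" and u: "u \<in> borel_measurable \<pi>"
  shows "ennreal \<epsilon> * (\<integral>\<^sup>+y. u y \<partial>\<pi>) \<le> (\<integral>\<^sup>+y. u y \<partial>P x)"
  using cmult_nn_integral_le_cmult[OF prob_space_axioms P_prob[OF x], of 1 \<epsilon> u] minor[OF x] eps u
  by (simp add: P_sets[OF x] P_meas_iff[OF x])

definition L2 :: "('a \<Rightarrow> real) \<Rightarrow> bool" where
  "L2 f \<longleftrightarrow> f \<in> borel_measurable \<pi> \<and> integrable \<pi> (\<lambda>x. (f x)\<^sup>2)"

definition markov_op :: "('a \<Rightarrow> real) \<Rightarrow> 'a \<Rightarrow> real" where
  "markov_op f x = (\<integral>y. f y \<partial>P x)"

lemma L2_integrable: "L2 f \<Longrightarrow> integrable \<pi> f"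
  by (rule square_integrable_imp_integrable) (simp_all add: L2_def)

lemma markov_op_measurable[measurable]: "f \<in> borel_measurable \<pi> \<Longrightarrow> markov_op f \<in> borel_measurable \<pi>"
  unfolding markov_op_def using measurable_compose[OF P_sub integral_measurable_subprob_algebra] by blast

lemma L2_iff_nn: "L2 f \<longleftrightarrow> f \<in> borel_measurable \<pi> \<and> (\<integral>\<^sup>+x. ennreal ((f x)\<^sup>2) \<partial>\<pi>) < \<infinity>"
  unfolding L2_def by (auto simp: integrable_iff_bounded)

text \<open>By invariance the second moments of \<open>P x\<close> average to that of
  \<open>\<pi>\<close>, hence are finite almost everywhere.\<close>

lemma L2_AE_P:
  assumes "L2 f"
  shows "AE x in \<pi>. integrable (P x) (\<lambda>y. (f y)\<^sup>2) \<and> integrable (P x) f"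
proof -
  have [measurable]: "f \<in> borel_measurable \<pi>" using assms by (simp add: L2_def)
  have "(\<integral>\<^sup>+x. \<integral>\<^sup>+y. ennreal ((f y)\<^sup>2) \<partial>P x \<partial>\<pi>) < \<infinity>"
    by (subst invariant_nn) (use assms in \<open>auto simp: L2_iff_nn\<close>)
  then have "AE x in \<pi>. (\<integral>\<^sup>+y. ennreal ((f y)\<^sup>2) \<partial>P x) \<noteq> \<infinity>"
    by (intro nn_integral_PInf_AE) auto
  then show ?thesis using AE_space
  proof eventually_elim
    case (elim x)
    interpret Px: prob_space "P x" by (rule P_prob) fact
    have m: "f \<in> borel_measurable (P x)" using assms by (simp add: P_meas_iff[OF elim(2)] L2_def)
    then have "integrable (P x) (\<lambda>y. (f y)\<^sup>2)"
      using elim(1) by (auto simp: integrable_iff_bounded less_top)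
    then show ?case using Px.square_integrable_imp_integrable[OF m] by auto
  qed
qed

text \<open>This is Cauchy-Schwarz for the nonnegative measure \<open>P x - \<epsilon> \<pi>\<close>
  of mass \<open>1 - \<epsilon>\<close>, in the form that \<open>(f - c)\<^sup>2\<close> has a
  nonnegative integral against it. As \<open>f\<close> is centred, subtracting \<open>\<epsilon>
  \<pi>\<close> does not change the integral of \<open>f\<close>.\<close>

lemma markov_op_square_le:
  assumes f: "L2 f" and f0: "(\<integral>x. f x \<partial>\<pi>) = 0" and x: "x \<in> space \<pi>"
    and int: "integrable (P x) (\<lambda>y. (f y)\<^sup>2)" "integrable (P x) f"
  shows "(markov_op f x)\<^sup>2 \<le> (1 - \<epsilon>) * (markov_op (\<lambda>y. (f y)\<^sup>2) x - \<epsilon> * (\<integral>y. (f y)\<^sup>2 \<partial>\<pi>))"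
proof -
  interpret Px: prob_space "P x" by (rule P_prob) fact
  \<comment> \<open>The minimiser of the integral of \<open>(f - c)\<^sup>2\<close> against \<open>P x
    - \<epsilon> \<pi>\<close>.\<close>
  define c where "c = markov_op f x / (1 - \<epsilon>)"
  have [measurable]: "f \<in> borel_measurable \<pi>" using f by (simp add: L2_def)
  have m: "f \<in> borel_measurable (P x)" using f by (simp add: P_meas_iff[OF x] L2_def)
  have i\<pi>: "integrable \<pi> (\<lambda>y. (f y)\<^sup>2)" "integrable \<pi> f" using f L2_integrable[OF f] by (simp_all add: L2_def)
  have e: "(f y - c)\<^sup>2 = (f y)\<^sup>2 - 2 * c * f y + c\<^sup>2" for y by (simp add: power2_eq_square algebra_simps)
  have iq: "integrable \<pi> (\<lambda>y. (f y - c)\<^sup>2)" "integrable (P x) (\<lambda>y. (f y - c)\<^sup>2)"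
    unfolding e using i\<pi> int by auto
  have "ennreal \<epsilon> * (\<integral>\<^sup>+y. ennreal ((f y - c)\<^sup>2) \<partial>\<pi>) \<le> (\<integral>\<^sup>+y. ennreal ((f y - c)\<^sup>2) \<partial>P x)"
    by (rule minor_nn[OF x]) auto
  then have "\<epsilon> * (\<integral>y. (f y - c)\<^sup>2 \<partial>\<pi>) \<le> (\<integral>y. (f y - c)\<^sup>2 \<partial>P x)"
    using iq eps by (simp add: nn_integral_eq_integral ennreal_mult[symmetric])
  also have "(\<integral>y. (f y - c)\<^sup>2 \<partial>P x) = markov_op (\<lambda>y. (f y)\<^sup>2) x - 2 * c * markov_op f x + c\<^sup>2"
    unfolding e markov_op_def using int by (simp add: Px.prob_space)
  also have "(\<integral>y. (f y - c)\<^sup>2 \<partial>\<pi>) = (\<integral>y. (f y)\<^sup>2 \<partial>\<pi>) + c\<^sup>2"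
    unfolding e using i\<pi> f0 by (simp add: prob_space)
  finally have "2 * c * markov_op f x - (1 - \<epsilon>) * c\<^sup>2 \<le> markov_op (\<lambda>y. (f y)\<^sup>2) x - \<epsilon> * (\<integral>y. (f y)\<^sup>2 \<partial>\<pi>)"
    by (simp add: algebra_simps)
  moreover have "markov_op f x = c * (1 - \<epsilon>)" using eps by (simp add: c_def)
  ultimately have "(1 - \<epsilon>) * c\<^sup>2 \<le> markov_op (\<lambda>y. (f y)\<^sup>2) x - \<epsilon> * (\<integral>y. (f y)\<^sup>2 \<partial>\<pi>)"
    by (simp add: power2_eq_square algebra_simps)
  then have "(1 - \<epsilon>) * ((1 - \<epsilon>) * c\<^sup>2) \<le> (1 - \<epsilon>) * (markov_op (\<lambda>y. (f y)\<^sup>2) x - \<epsilon> * (\<integral>y. (f y)\<^sup>2 \<partial>\<pi>))"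
    using eps by (intro mult_left_mono) auto
  moreover have "(markov_op f x)\<^sup>2 = (1 - \<epsilon>) * ((1 - \<epsilon>) * c\<^sup>2)"
    using \<open>markov_op f x = c * (1 - \<epsilon>)\<close> by (simp add: power2_eq_square mult_ac)
  ultimately show ?thesis by simp
qed

lemma bind_invariant: "\<pi> \<bind> P = \<pi>"
proof (rule measure_eqI)
  show s: "sets (\<pi> \<bind> P) = sets \<pi>" by (rule sets_bind_measurable[OF P_sub not_empty])
  fix A assume "A \<in> sets (\<pi> \<bind> P)"
  then have [measurable]: "A \<in> sets \<pi>" using s by simp
  have "emeasure (\<pi> \<bind> P) A = (\<integral>\<^sup>+x. emeasure (P x) A \<partial>\<pi>)"
    by (rule emeasure_bind[OF not_empty P_sub]) simp
  also have "\<dots> = (\<integral>\<^sup>+x. \<integral>\<^sup>+y. indicator A y \<partial>P x \<partial>\<pi>)"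
    by (rule nn_integral_cong) (simp add: P_sets)
  finally show "emeasure (\<pi> \<bind> P) A = emeasure \<pi> A"
    by (simp add: invariant_nn)
qed

lemma integral_markov_op:
  assumes f: "integrable \<pi> f"
  shows "integrable \<pi> (markov_op f)" "(\<integral>x. markov_op f x \<partial>\<pi>) = (\<integral>x. f x \<partial>\<pi>)"
proof -
  have [measurable]: "f \<in> borel_measurable \<pi>" using f by simp
  have fin: "(\<integral>\<^sup>+x. \<integral>\<^sup>+y. ennreal \<bar>f y\<bar> \<partial>P x \<partial>\<pi>) < \<infinity>"
    by (subst invariant_nn) (use f in \<open>auto simp: integrable_iff_bounded\<close>)
  show "(\<integral>x. markov_op f x \<partial>\<pi>) = (\<integral>x. f x \<partial>\<pi>)"
    using integral_bind_L1(2)[OF P_sub _ fin not_empty] by (simp add: bind_invariant markov_op_def)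
  show "integrable \<pi> (markov_op f)"
  proof (rule integrableI_bounded)
    have "(\<integral>\<^sup>+x. ennreal (norm (markov_op f x)) \<partial>\<pi>) \<le> (\<integral>\<^sup>+x. \<integral>\<^sup>+y. ennreal \<bar>f y\<bar> \<partial>P x \<partial>\<pi>)"
    proof (rule nn_integral_mono)
      fix x assume x: "x \<in> space \<pi>"
      show "ennreal (norm (markov_op f x)) \<le> (\<integral>\<^sup>+y. ennreal \<bar>f y\<bar> \<partial>P x)"
      proof (cases "integrable (P x) f")
        case True
        then show ?thesis unfolding markov_op_def using integral_norm_bound_ennreal[OF True] by simp
      qed (simp add: markov_op_def not_integrable_integral_eq)
    qed
    then show "(\<integral>\<^sup>+x. ennreal (norm (markov_op f x)) \<partial>\<pi>) < \<infinity>" using fin by simp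
  qed simp
qed

text \<open>Integrating \<open>markov_op_square_le\<close> over \<open>\<pi>\<close> gives the
  square of \<open>1 - \<epsilon>\<close>: one factor is the mass of \<open>P x - \<epsilon>
  \<pi>\<close>, the other is left when invariance turns \<open>P (f\<^sup>2) - \<epsilon>
  \<pi>(f\<^sup>2)\<close> into a multiple of \<open>\<pi>(f\<^sup>2)\<close>.\<close>

lemma markov_op_contraction:
  assumes f: "L2 f" and f0: "(\<integral>x. f x \<partial>\<pi>) = 0"
  shows "L2 (markov_op f)" "(\<integral>x. markov_op f x \<partial>\<pi>) = 0"
    "(\<integral>x. (markov_op f x)\<^sup>2 \<partial>\<pi>) \<le> (1 - \<epsilon>)\<^sup>2 * (\<integral>x. (f x)\<^sup>2 \<partial>\<pi>)"
proof -
  have [measurable]: "f \<in> borel_measurable \<pi>" using f by (simp add: L2_def)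
  have if2: "integrable \<pi> (\<lambda>x. (f x)\<^sup>2)" using f by (simp add: L2_def)
  show "(\<integral>x. markov_op f x \<partial>\<pi>) = 0" using integral_markov_op(2)[OF L2_integrable[OF f]] f0 by simp
  let ?R = "\<lambda>x. (1 - \<epsilon>) * (markov_op (\<lambda>y. (f y)\<^sup>2) x - \<epsilon> * (\<integral>y. (f y)\<^sup>2 \<partial>\<pi>))"
  have le: "AE x in \<pi>. (markov_op f x)\<^sup>2 \<le> ?R x"
    using L2_AE_P[OF f] AE_space by eventually_elim (intro markov_op_square_le f f0; simp)
  have iR: "integrable \<pi> ?R" using integral_markov_op(1)[OF if2] by simp
  have iP: "integrable \<pi> (\<lambda>x. (markov_op f x)\<^sup>2)"
    by (rule Bochner_Integration.integrable_bound[OF iR]) (simp, use le in \<open>eventually_elim, simp\<close>)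
  then show "L2 (markov_op f)" by (simp add: L2_def)
  have "(\<integral>x. (markov_op f x)\<^sup>2 \<partial>\<pi>) \<le> (\<integral>x. ?R x \<partial>\<pi>)" by (rule integral_mono_AE[OF iP iR le])
  also have "\<dots> = (1 - \<epsilon>)\<^sup>2 * (\<integral>x. (f x)\<^sup>2 \<partial>\<pi>)"
    using integral_markov_op[OF if2] by (simp add: prob_space power2_eq_square algebra_simps)
  finally show "(\<integral>x. (markov_op f x)\<^sup>2 \<partial>\<pi>) \<le> (1 - \<epsilon>)\<^sup>2 * (\<integral>x. (f x)\<^sup>2 \<partial>\<pi>)" .
qed

text \<open>The law of two consecutive states of the stationary chain. Writing \<open>\<langle>f, P
  g\<rangle>\<close> as an integral over pairs makes it bilinear without any discussion of where
  \<open>P g\<close> is defined, which is what the passage from nonnegative to signed functions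
  needs.\<close>

definition two_step :: "('a \<times> 'a) measure" where
  "two_step = \<pi> \<bind> (\<lambda>x. distr (P x) (\<pi> \<Otimes>\<^sub>M \<pi>) (Pair x))"

lemma two_step_kernel[measurable]: "(\<lambda>x. distr (P x) (\<pi> \<Otimes>\<^sub>M \<pi>) (Pair x)) \<in> \<pi> \<rightarrow>\<^sub>M subprob_algebra (\<pi> \<Otimes>\<^sub>M \<pi>)"
  by (rule measurable_prob_algebraD, rule measurable_distr_prob_space2[OF P]) simp

lemma sets_two_step[measurable_cong]: "sets two_step = sets (\<pi> \<Otimes>\<^sub>M \<pi>)"
  unfolding two_step_def by (rule sets_bind_measurable[OF two_step_kernel not_empty])

lemma nn_integral_two_step:
  assumes [measurable]: "F \<in> borel_measurable (\<pi> \<Otimes>\<^sub>M \<pi>)"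
  shows "(\<integral>\<^sup>+z. F z \<partial>two_step) = (\<integral>\<^sup>+x. \<integral>\<^sup>+y. F (x, y) \<partial>P x \<partial>\<pi>)"
proof -
  have "(\<integral>\<^sup>+z. F z \<partial>two_step) = (\<integral>\<^sup>+x. \<integral>\<^sup>+z. F z \<partial>distr (P x) (\<pi> \<Otimes>\<^sub>M \<pi>) (Pair x) \<partial>\<pi>)"
    unfolding two_step_def by (rule nn_integral_bind[OF _ two_step_kernel]) measurable
  also have "\<dots> = (\<integral>\<^sup>+x. \<integral>\<^sup>+y. F (x, y) \<partial>P x \<partial>\<pi>)"
    by (intro nn_integral_cong nn_integral_distr) (auto simp: P_sets measurable_cong_sets[OF P_sets refl])
  finally show ?thesis .
qed

lemma integral_two_step:
  fixes F :: "'a \<times> 'a \<Rightarrow> real"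
  assumes [measurable]: "F \<in> borel_measurable (\<pi> \<Otimes>\<^sub>M \<pi>)" and i: "integrable two_step F"
  shows "(\<integral>z. F z \<partial>two_step) = (\<integral>x. \<integral>y. F (x, y) \<partial>P x \<partial>\<pi>)"
proof -
  have fin: "(\<integral>\<^sup>+x. \<integral>\<^sup>+y. ennreal \<bar>F y\<bar> \<partial>distr (P x) (\<pi> \<Otimes>\<^sub>M \<pi>) (Pair x) \<partial>\<pi>) < \<infinity>"
  proof -
    have "(\<integral>\<^sup>+x. \<integral>\<^sup>+y. ennreal \<bar>F y\<bar> \<partial>distr (P x) (\<pi> \<Otimes>\<^sub>M \<pi>) (Pair x) \<partial>\<pi>) = (\<integral>\<^sup>+z. ennreal \<bar>F z\<bar> \<partial>two_step)"
      unfolding two_step_def by (rule nn_integral_bind[OF _ two_step_kernel, symmetric]) measurable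
    also have "\<dots> < \<infinity>" using i by (simp add: integrable_iff_bounded)
    finally show ?thesis .
  qed
  have "(\<integral>z. F z \<partial>two_step) = (\<integral>x. \<integral>z. F z \<partial>distr (P x) (\<pi> \<Otimes>\<^sub>M \<pi>) (Pair x) \<partial>\<pi>)"
    unfolding two_step_def by (rule integral_bind_L1(2)[OF two_step_kernel _ fin not_empty]) measurable
  also have "\<dots> = (\<integral>x. \<integral>y. F (x, y) \<partial>P x \<partial>\<pi>)"
    by (intro Bochner_Integration.integral_cong integral_distr) (auto simp: P_sets measurable_cong_sets[OF P_sets refl])
  finally show ?thesis .
qed

lemma two_step_fst: "u \<in> borel_measurable \<pi> \<Longrightarrow> (\<integral>\<^sup>+z. u (fst z) \<partial>two_step) = (\<integral>\<^sup>+x. u x \<partial>\<pi>)"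
proof -
  assume [measurable]: "u \<in> borel_measurable \<pi>"
  have "(\<integral>\<^sup>+z. u (fst z) \<partial>two_step) = (\<integral>\<^sup>+x. \<integral>\<^sup>+y. u x \<partial>P x \<partial>\<pi>)" by (subst nn_integral_two_step) auto
  also have "\<dots> = (\<integral>\<^sup>+x. u x \<partial>\<pi>)" by (rule nn_integral_cong) (simp add: P_prob prob_space.emeasure_space_1)
  finally show ?thesis .
qed

lemma two_step_snd: "u \<in> borel_measurable \<pi> \<Longrightarrow> (\<integral>\<^sup>+z. u (snd z) \<partial>two_step) = (\<integral>\<^sup>+x. u x \<partial>\<pi>)"
proof -
  assume [measurable]: "u \<in> borel_measurable \<pi>"
  have "(\<integral>\<^sup>+z. u (snd z) \<partial>two_step) = (\<integral>\<^sup>+x. \<integral>\<^sup>+y. u y \<partial>P x \<partial>\<pi>)" by (subst nn_integral_two_step) auto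
  then show ?thesis by (simp add: invariant_nn)
qed

lemma L2_two_step_integrable:
  assumes "L2 f" "L2 g"
  shows "integrable two_step (\<lambda>z. f (fst z) * g (snd z))"
proof -
  have [measurable]: "f \<in> borel_measurable \<pi>" "g \<in> borel_measurable \<pi>" using assms by (auto simp: L2_def)
  have "(\<integral>\<^sup>+z. ennreal ((f (fst z))\<^sup>2) \<partial>two_step) < \<infinity>" "(\<integral>\<^sup>+z. ennreal ((g (snd z))\<^sup>2) \<partial>two_step) < \<infinity>"
    using assms two_step_fst[of "\<lambda>x. ennreal ((f x)\<^sup>2)"] two_step_snd[of "\<lambda>x. ennreal ((g x)\<^sup>2)"]
    by (simp_all add: L2_iff_nn)
  then have "integrable two_step (\<lambda>z. (f (fst z))\<^sup>2)" "integrable two_step (\<lambda>z. (g (snd z))\<^sup>2)"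
    by (simp_all add: integrable_iff_bounded)
  then have s: "integrable two_step (\<lambda>z. (f (fst z))\<^sup>2 + (g (snd z))\<^sup>2)" by simp
  show ?thesis
  proof (rule Bochner_Integration.integrable_bound[OF s])
    show "AE z in two_step. norm (f (fst z) * g (snd z)) \<le> norm ((f (fst z))\<^sup>2 + (g (snd z))\<^sup>2)"
      by (intro AE_I2) (simp add: abs_mult_le_sum_squares)
  qed simp
qed

lemma inner_eq_pairing:
  assumes "L2 f" "L2 g"
  shows "(\<integral>x. f x * markov_op g x \<partial>\<pi>) = (\<integral>z. f (fst z) * g (snd z) \<partial>two_step)"
proof -
  have [measurable]: "f \<in> borel_measurable \<pi>" "g \<in> borel_measurable \<pi>" using assms by (auto simp: L2_def)
  have m: "(\<lambda>z. f (fst z) * g (snd z)) \<in> borel_measurable (\<pi> \<Otimes>\<^sub>M \<pi>)" by simp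
  show ?thesis
    by (subst integral_two_step[OF m L2_two_step_integrable[OF assms]]) (simp add: markov_op_def)
qed

lemma nn_inner_eq_pairing:
  assumes "L2 f" "L2 g" "\<And>x. 0 \<le> f x" "\<And>x. 0 \<le> g x"
  shows "ennreal (\<integral>z. f (fst z) * g (snd z) \<partial>two_step) = (\<integral>\<^sup>+x. ennreal (f x) * (\<integral>\<^sup>+y. ennreal (g y) \<partial>P x) \<partial>\<pi>)"
proof -
  have [measurable]: "f \<in> borel_measurable \<pi>" "g \<in> borel_measurable \<pi>" using assms by (auto simp: L2_def)
  have "ennreal (\<integral>z. f (fst z) * g (snd z) \<partial>two_step) = (\<integral>\<^sup>+z. ennreal (f (fst z) * g (snd z)) \<partial>two_step)"
    by (rule nn_integral_eq_integral[symmetric]) (use L2_two_step_integrable assms in auto)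
  also have "\<dots> = (\<integral>\<^sup>+x. \<integral>\<^sup>+y. ennreal (f x) * ennreal (g y) \<partial>P x \<partial>\<pi>)"
    by (subst nn_integral_two_step) (auto simp: ennreal_mult assms)
  also have "\<dots> = (\<integral>\<^sup>+x. ennreal (f x) * (\<integral>\<^sup>+y. ennreal (g y) \<partial>P x) \<partial>\<pi>)"
    by (intro nn_integral_cong nn_integral_cmult) (auto simp: measurable_cong_sets[OF P_sets refl])
  finally show ?thesis .
qed

abbreviation pairing :: "('a \<Rightarrow> real) \<Rightarrow> ('a \<Rightarrow> real) \<Rightarrow> real" where
  "pairing f g \<equiv> \<integral>z. f (fst z) * g (snd z) \<partial>two_step"

lemma L2_split:
  assumes f: "L2 f"
  obtains u v where "L2 u" "L2 v" "\<And>x. 0 \<le> u x" "\<And>x. 0 \<le> v x" "f = (\<lambda>x. u x - v x)"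
proof
  have [measurable]: "f \<in> borel_measurable \<pi>" using f by (simp add: L2_def)
  have i2: "integrable \<pi> (\<lambda>x. (f x)\<^sup>2)" using f by (simp add: L2_def)
  show "L2 (\<lambda>x. max 0 (f x))" "L2 (\<lambda>x. max 0 (- f x))" unfolding L2_def
    by (auto intro!: Bochner_Integration.integrable_bound[OF i2] simp: max_def)
qed auto

lemma nn_pairing_sym:
  assumes "L2 f" "L2 g" "\<And>x. 0 \<le> f x" "\<And>x. 0 \<le> g x"
  shows "pairing f g = pairing g f"
proof -
  have [measurable]: "f \<in> borel_measurable \<pi>" "g \<in> borel_measurable \<pi>" using assms by (auto simp: L2_def)
  have "ennreal (pairing f g) = ennreal (pairing g f)"
    unfolding nn_inner_eq_pairing[OF assms] nn_inner_eq_pairing[OF assms(2,1,4,3)] by (rule sym) auto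
  moreover have "0 \<le> pairing f g" "0 \<le> pairing g f" using assms by (auto intro!: Bochner_Integration.integral_nonneg)
  ultimately show ?thesis by simp
qed

lemma pairing_diff_diff:
  assumes "L2 u" "L2 v" "L2 u'" "L2 v'"
  shows "pairing (\<lambda>x. u x - v x) (\<lambda>x. u' x - v' x) = pairing u u' - pairing u v' - pairing v u' + pairing v v'"
proof -
  have e: "(\<lambda>z. (u (fst z) - v (fst z)) * (u' (snd z) - v' (snd z))) =
      (\<lambda>z. u (fst z) * u' (snd z) - u (fst z) * v' (snd z) - v (fst z) * u' (snd z) + v (fst z) * v' (snd z))"
    by (auto simp: algebra_simps)
  show ?thesis unfolding e using L2_two_step_integrable assms by simp
qed

text \<open>Reversibility extends from nonnegative to signed functions by bilinearity.\<close>

lemma inner_sym: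
  assumes "L2 f" "L2 g"
  shows "(\<integral>x. f x * markov_op g x \<partial>\<pi>) = (\<integral>x. markov_op f x * g x \<partial>\<pi>)"
proof -
  obtain u v where f: "L2 u" "L2 v" "\<And>x. 0 \<le> u x" "\<And>x. 0 \<le> v x" "f = (\<lambda>x. u x - v x)"
    by (rule L2_split[OF assms(1)]) (rule that; assumption)
  obtain u' v' where g: "L2 u'" "L2 v'" "\<And>x. 0 \<le> u' x" "\<And>x. 0 \<le> v' x" "g = (\<lambda>x. u' x - v' x)"
    by (rule L2_split[OF assms(2)]) (rule that; assumption)
  have "pairing f g = pairing g f"
    unfolding f(5) g(5) pairing_diff_diff[OF f(1,2) g(1,2)] pairing_diff_diff[OF g(1,2) f(1,2)]
    using nn_pairing_sym[OF f(1) g(1) f(3) g(3)] nn_pairing_sym[OF f(1) g(2) f(3) g(4)]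
      nn_pairing_sym[OF f(2) g(1) f(4) g(3)] nn_pairing_sym[OF f(2) g(2) f(4) g(4)] by simp
  then show ?thesis
    unfolding inner_eq_pairing[OF assms, symmetric] inner_eq_pairing[OF assms(2,1), symmetric] by (simp add: mult.commute)
qed

text \<open>For \<open>f = u - v\<close> with \<open>u\<close> and \<open>v\<close> the positive and
  negative parts, expanding the form and using its symmetry leaves exactly the inequality
  \<open>pos\<close>.\<close>

lemma inner_nonneg:
  assumes "L2 f"
  shows "0 \<le> (\<integral>x. f x * markov_op f x \<partial>\<pi>)"
proof -
  obtain u v where f: "L2 u" "L2 v" "\<And>x. 0 \<le> u x" "\<And>x. 0 \<le> v x" "f = (\<lambda>x. u x - v x)"
    by (rule L2_split[OF assms(1)]) (rule that; assumption)
  have [measurable]: "u \<in> borel_measurable \<pi>" "v \<in> borel_measurable \<pi>" using f(1,2) by (auto simp: L2_def)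
  have nn: "0 \<le> pairing u v" "0 \<le> pairing u u" "0 \<le> pairing v v"
    using f(3,4) by (auto intro!: Bochner_Integration.integral_nonneg)
  have "ennreal (2 * pairing u v) = 2 * ennreal (pairing u v)" using nn by (simp add: ennreal_mult)
  also have "\<dots> \<le> ennreal (pairing u u) + ennreal (pairing v v)"
    unfolding nn_inner_eq_pairing[OF f(1,2,3,4)] nn_inner_eq_pairing[OF f(1,1,3,3)] nn_inner_eq_pairing[OF f(2,2,4,4)]
    by (rule pos) auto
  also have "\<dots> = ennreal (pairing u u + pairing v v)" using nn by simp
  finally have "ennreal (2 * pairing u v) \<le> ennreal (pairing u u + pairing v v)" .
  then have le: "2 * pairing u v \<le> pairing u u + pairing v v"
    by (rule ennreal_le_iff[THEN iffD1, rotated]) (use nn in linarith)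
  have "pairing f f = pairing u u - pairing u v - pairing v u + pairing v v"
    unfolding f(5) by (rule pairing_diff_diff[OF f(1,2,1,2)])
  then show ?thesis
    using le nn_pairing_sym[OF f(1,2,3,4)] unfolding inner_eq_pairing[OF assms assms] by linarith
qed

section \<open>Geometric convergence in total variation and in the mean square\<close>

lemma iter_Suc: "kernel_iter \<nu> P (Suc k) = kernel_iter \<nu> P k \<bind> P"
  by (simp add: kernel_iter_def)

lemma bind_P_prob:
  assumes "\<nu> \<in> space (prob_algebra \<pi>)"
  shows "\<nu> \<bind> P \<in> space (prob_algebra \<pi>)"
  using assms P prob_space_bind'[OF assms P] sets_bind'[OF assms P] by (auto simp: space_prob_algebra)

lemma iter_prob:
  assumes "\<nu> \<in> space (prob_algebra \<pi>)"
  shows "kernel_iter \<nu> P k \<in> space (prob_algebra \<pi>)"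
proof (induction k)
  case 0 then show ?case using assms by (simp add: kernel_iter_def)
next
  case (Suc k) then show ?case by (simp only: iter_Suc bind_P_prob)
qed

lemma nn_integral_minor:
  assumes \<nu>: "\<nu> \<in> space (prob_algebra \<pi>)" and c: "0 \<le> c"
    and le: "\<And>B. B \<in> sets \<pi> \<Longrightarrow> c * measure \<pi> B \<le> measure \<nu> B"
    and u: "u \<in> borel_measurable \<pi>"
  shows "ennreal c * (\<integral>\<^sup>+y. u y \<partial>\<pi>) \<le> (\<integral>\<^sup>+y. u y \<partial>\<nu>)"
proof -
  have p: "prob_space \<nu>" and s: "sets \<pi> = sets \<nu>" using \<nu> by (simp_all add: space_prob_algebra)
  have u': "u \<in> borel_measurable \<nu>" unfolding measurable_cong_sets[OF s[symmetric] refl] by (rule u)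
  show ?thesis
    using cmult_nn_integral_le_cmult[OF prob_space_axioms p s, of 1 c u] c le u' by (simp add: s)
qed

text \<open>Induction on \<open>k\<close>. Apply the integrated form of the induction hypothesis to
  the nonnegative function \<open>x \<mapsto> P(x, B) - \<epsilon> \<pi>(B)\<close>: its
  \<open>\<pi>\<close>-integral is \<open>(1 - \<epsilon>) \<pi>(B)\<close> by invariance, and its
  integral against \<open>\<nu> P\<^sup>k\<close> is \<open>\<nu> P\<^bsup>k+1\<^esup>(B) -
  \<epsilon> \<pi>(B)\<close>.\<close>

lemma iter_minor:
  assumes \<nu>: "\<nu> \<in> space (prob_algebra \<pi>)" and B: "B \<in> sets \<pi>"
  shows "(1 - (1 - \<epsilon>) ^ k) * measure \<pi> B \<le> measure (kernel_iter \<nu> P k) B"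
  using B
proof (induction k arbitrary: B)
  case 0 then show ?case by simp
next
  case (Suc k)
  let ?\<nu> = "kernel_iter \<nu> P k" and ?d = "(1 - \<epsilon>) ^ k"
  have \<nu>k: "?\<nu> \<in> space (prob_algebra \<pi>)" by (rule iter_prob[OF \<nu>])
  interpret N: prob_space ?\<nu> using \<nu>k by (simp add: space_prob_algebra)
  have s[measurable_cong]: "sets ?\<nu> = sets \<pi>" using \<nu>k by (simp add: space_prob_algebra)
  note [measurable] = Suc.prems
  have d: "0 \<le> ?d" "?d \<le> 1" using eps by (auto intro: power_le_one)
  define u where "u = (\<lambda>x. measure (P x) B - \<epsilon> * measure \<pi> B)"
  have um[measurable]: "u \<in> borel_measurable \<pi>" unfolding u_def by measurable
  have u0: "0 \<le> u x" if "x \<in> space \<pi>" for x using minor[OF that Suc.prems] by (simp add: u_def)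
  have ub: "\<bar>u x\<bar> \<le> 1" if "x \<in> space \<pi>" for x
  proof -
    have "0 \<le> \<epsilon> * measure \<pi> B" using eps by simp
    then have "u x \<le> 1" unfolding u_def using prob_space.prob_le_1[OF P_prob[OF that], of B] by linarith
    then show ?thesis using u0[OF that] by simp
  qed
  have i1: "integrable \<pi> u" by (rule integrable_const_bound[of _ 1]) (use ub in \<open>auto intro!: AE_I2\<close>)
  have i2: "integrable ?\<nu> u"
    by (rule N.integrable_const_bound[of _ 1]) (use ub in \<open>auto intro!: AE_I2 simp: sets_eq_imp_space_eq[OF s]\<close>)
  have m1: "(\<integral>x. u x \<partial>\<mu>) = measure (\<mu> \<bind> P) B - \<epsilon> * measure \<pi> B" if \<mu>: "\<mu> \<in> space (prob_algebra \<pi>)" for \<mu>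
  proof -
    interpret M: prob_space \<mu> using \<mu> by (simp add: space_prob_algebra)
    have s'[measurable_cong]: "sets \<mu> = sets \<pi>" using \<mu> by (simp add: space_prob_algebra)
    have P\<mu>: "P \<in> \<mu> \<rightarrow>\<^sub>M subprob_algebra \<pi>" using P_sub by (simp add: measurable_cong_sets[OF s' refl])
    have "integrable \<mu> (\<lambda>x. measure (P x) B)"
      by (rule M.integrable_const_bound[of _ 1])
        (auto intro!: AE_I2 simp: sets_eq_imp_space_eq[OF s'] prob_space.prob_le_1[OF P_prob])
    then show ?thesis unfolding u_def by (simp add: M.prob_space M.measure_bind[OF P\<mu> Suc.prems])
  qed
  have "ennreal (1 - ?d) * (\<integral>\<^sup>+x. ennreal (u x) \<partial>\<pi>) \<le> (\<integral>\<^sup>+x. ennreal (u x) \<partial>?\<nu>)"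
    by (rule nn_integral_minor[OF \<nu>k]) (use d Suc.IH in auto)
  also have "(\<integral>\<^sup>+x. ennreal (u x) \<partial>?\<nu>) = ennreal (\<integral>x. u x \<partial>?\<nu>)"
    by (rule nn_integral_eq_integral[OF i2]) (use u0 in \<open>auto intro!: AE_I2 simp: sets_eq_imp_space_eq[OF s]\<close>)
  also have "(\<integral>\<^sup>+x. ennreal (u x) \<partial>\<pi>) = ennreal (\<integral>x. u x \<partial>\<pi>)"
    by (rule nn_integral_eq_integral[OF i1]) (use u0 in \<open>auto intro!: AE_I2\<close>)
  also have "ennreal (1 - ?d) * ennreal (\<integral>x. u x \<partial>\<pi>) = ennreal ((1 - ?d) * (\<integral>x. u x \<partial>\<pi>))"
    by (rule ennreal_mult[symmetric]) (use d u0 in \<open>auto intro!: Bochner_Integration.integral_nonneg_AE AE_I2\<close>)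
  finally have "(1 - ?d) * (\<integral>x. u x \<partial>\<pi>) \<le> (\<integral>x. u x \<partial>?\<nu>)"
    by (rule ennreal_le_iff[THEN iffD1, rotated])
      (use u0 in \<open>auto intro!: Bochner_Integration.integral_nonneg_AE AE_I2 simp: sets_eq_imp_space_eq[OF s]\<close>)
  moreover have "\<pi> \<in> space (prob_algebra \<pi>)" by (simp add: space_prob_algebra prob_space_axioms)
  ultimately have "(1 - ?d) * ((1 - \<epsilon>) * measure \<pi> B) \<le> measure (kernel_iter \<nu> P (Suc k)) B - \<epsilon> * measure \<pi> B"
    using m1[of \<pi>] m1[OF \<nu>k] by (simp add: bind_invariant iter_Suc algebra_simps)
  then show ?case by (simp add: algebra_simps)
qed

text \<open>By \<open>iter_minor\<close>, \<open>\<nu> P\<^sup>k\<close> is \<open>(1 - (1 -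
  \<epsilon>)\<^sup>k) \<pi>\<close> plus a nonnegative measure of mass \<open>(1 -
  \<epsilon>)\<^sup>k\<close>, so integrals of functions with values in \<open>[-1, 1]\<close>
  differ by at most \<open>2 (1 - \<epsilon>)\<^sup>k\<close>.\<close>

lemma tv_contraction:
  assumes \<nu>: "\<nu> \<in> space (prob_algebra \<pi>)"
  shows "tv_dist (kernel_iter \<nu> P k) \<pi> \<le> (1 - \<epsilon>) ^ k"
proof -
  let ?\<nu> = "kernel_iter \<nu> P k" and ?d = "(1 - \<epsilon>) ^ k"
  have \<nu>k: "?\<nu> \<in> space (prob_algebra \<pi>)" by (rule iter_prob[OF \<nu>])
  interpret N: prob_space ?\<nu> using \<nu>k by (simp add: space_prob_algebra)
  have s[measurable_cong]: "sets ?\<nu> = sets \<pi>" using \<nu>k by (simp add: space_prob_algebra)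
  have sp: "space ?\<nu> = space \<pi>" by (rule sets_eq_imp_space_eq[OF s])
  have d: "0 \<le> ?d" "?d \<le> 1" using eps by (auto intro: power_le_one)
  have "(\<integral>x. f x \<partial>?\<nu>) - (\<integral>x. f x \<partial>\<pi>) \<le> 2 * ?d"
    if f: "f \<in> borel_measurable ?\<nu>" "\<forall>x\<in>space ?\<nu>. f x \<in> {-1..1}" for f
  proof -
    have [measurable]: "f \<in> borel_measurable \<pi>" using f(1) by (simp add: measurable_cong_sets[OF s refl])
    have b: "\<bar>f x\<bar> \<le> 1" "0 \<le> 1 - f x" if "x \<in> space \<pi>" for x using f(2) that by (auto simp: sp abs_le_iff)
    have i: "integrable \<pi> f" "integrable ?\<nu> f"
      by (rule integrable_const_bound[of _ 1] N.integrable_const_bound[of _ 1];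
          use b in \<open>auto intro!: AE_I2 simp: sp\<close>)+
    have "ennreal (1 - ?d) * (\<integral>\<^sup>+x. ennreal (1 - f x) \<partial>\<pi>) \<le> (\<integral>\<^sup>+x. ennreal (1 - f x) \<partial>?\<nu>)"
      by (rule nn_integral_minor[OF \<nu>k]) (use d iter_minor[OF \<nu>] in auto)
    also have "(\<integral>\<^sup>+x. ennreal (1 - f x) \<partial>?\<nu>) = ennreal (\<integral>x. 1 - f x \<partial>?\<nu>)"
      by (rule nn_integral_eq_integral) (use i b in \<open>auto intro!: AE_I2 simp: sp\<close>)
    also have "(\<integral>\<^sup>+x. ennreal (1 - f x) \<partial>\<pi>) = ennreal (\<integral>x. 1 - f x \<partial>\<pi>)"
      by (rule nn_integral_eq_integral) (use i b in \<open>auto intro!: AE_I2\<close>)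
    also have "ennreal (1 - ?d) * ennreal (\<integral>x. 1 - f x \<partial>\<pi>) = ennreal ((1 - ?d) * (\<integral>x. 1 - f x \<partial>\<pi>))"
      by (rule ennreal_mult[symmetric]) (use d b in \<open>auto intro!: Bochner_Integration.integral_nonneg_AE AE_I2\<close>)
    finally have "(1 - ?d) * (\<integral>x. 1 - f x \<partial>\<pi>) \<le> (\<integral>x. 1 - f x \<partial>?\<nu>)"
      by (rule ennreal_le_iff[THEN iffD1, rotated])
        (use b in \<open>auto intro!: Bochner_Integration.integral_nonneg_AE AE_I2 simp: sp\<close>)
    then have "(1 - ?d) * (1 - (\<integral>x. f x \<partial>\<pi>)) \<le> 1 - (\<integral>x. f x \<partial>?\<nu>)"
      using i by (simp add: prob_space N.prob_space)
    then have le: "(\<integral>x. f x \<partial>?\<nu>) - (\<integral>x. f x \<partial>\<pi>) \<le> ?d * (1 - (\<integral>x. f x \<partial>\<pi>))"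
      by (simp add: algebra_simps)
    have "-1 \<le> (\<integral>x. f x \<partial>\<pi>)"
      using integral_mono_AE[of \<pi> "\<lambda>_. -1" f] i b by (force intro!: AE_I2 simp: prob_space)
    then have "?d * (1 - (\<integral>x. f x \<partial>\<pi>)) \<le> ?d * 2" using d by (intro mult_left_mono) auto
    then show ?thesis using le by linarith
  qed
  then have "(SUP f\<in>{f \<in> borel_measurable ?\<nu>. \<forall>x\<in>space ?\<nu>. f x \<in> {-1..1}}. (\<integral>x. f x \<partial>?\<nu>) - (\<integral>x. f x \<partial>\<pi>)) \<le> 2 * ?d"
    by (intro cSUP_least) (auto intro!: exI[of _ "\<lambda>_. 0"])
  then show ?thesis by (simp add: tv_dist_def)
qed

lemma ac_density:
  assumes \<nu>: "\<nu> \<in> space (prob_algebra \<pi>)" and ac: "absolutely_continuous \<pi> \<nu>"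
  shows "density \<pi> (RN_deriv \<pi> \<nu>) = \<nu>"
  using density_RN_deriv[OF ac] \<nu> by (simp add: space_prob_algebra)

text \<open>Here reversibility enters: a reversible kernel acts on densities as it acts on
  functions.\<close>

lemma bind_density:
  assumes h[measurable]: "h \<in> borel_measurable \<pi>" and \<nu>: "density \<pi> h \<in> space (prob_algebra \<pi>)"
  shows "density \<pi> h \<bind> P = density \<pi> (\<lambda>x. \<integral>\<^sup>+y. h y \<partial>P x)"
proof (rule measure_eqI)
  let ?\<nu> = "density \<pi> h"
  have Pm: "P \<in> ?\<nu> \<rightarrow>\<^sub>M subprob_algebra \<pi>" using P_sub by simp
  have ne: "space ?\<nu> \<noteq> {}" using not_empty by simp
  show s: "sets (?\<nu> \<bind> P) = sets (density \<pi> (\<lambda>x. \<integral>\<^sup>+y. h y \<partial>P x))"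
    using sets_bind_measurable[OF Pm ne] by simp
  fix A assume "A \<in> sets (?\<nu> \<bind> P)"
  then have [measurable]: "A \<in> sets \<pi>" using s by simp
  have "emeasure (?\<nu> \<bind> P) A = (\<integral>\<^sup>+x. emeasure (P x) A \<partial>?\<nu>)"
    by (rule emeasure_bind[OF ne Pm]) simp
  also have "\<dots> = (\<integral>\<^sup>+x. h x * emeasure (P x) A \<partial>\<pi>)" by (rule nn_integral_density) auto
  also have "\<dots> = (\<integral>\<^sup>+x. h x * (\<integral>\<^sup>+y. indicator A y \<partial>P x) \<partial>\<pi>)"
    by (rule nn_integral_cong) (simp add: P_sets)
  also have "\<dots> = (\<integral>\<^sup>+x. indicator A x * (\<integral>\<^sup>+y. h y \<partial>P x) \<partial>\<pi>)" by (rule sym) auto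
  finally show "emeasure (?\<nu> \<bind> P) A = emeasure (density \<pi> (\<lambda>x. \<integral>\<^sup>+y. h y \<partial>P x)) A"
    by (simp add: emeasure_density mult.commute)
qed

lemma RN_density_unique:
  assumes h[measurable]: "h \<in> borel_measurable \<pi>"
  shows "AE x in \<pi>. RN_deriv \<pi> (density \<pi> h) x = h x"
  using RN_deriv_unique[OF h refl] by (auto elim!: AE_mp)

lemma L2_dist_density:
  assumes h[measurable]: "h \<in> borel_measurable \<pi>" and \<nu>: "density \<pi> h \<in> space (prob_algebra \<pi>)"
  shows "L2_dist \<pi> (density \<pi> h) \<pi> =
    (if (\<integral>\<^sup>+x. ennreal ((enn2real (h x) - 1)\<^sup>2) \<partial>\<pi>) < \<infinity>
     then ennreal (sqrt (enn2real (\<integral>\<^sup>+x. ennreal ((enn2real (h x) - 1)\<^sup>2) \<partial>\<pi>))) else \<infinity>)"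
proof -
  have d1: "density \<pi> (\<lambda>_. 1) = \<pi>" by (rule density_1)
  have "AE x in \<pi>. RN_deriv \<pi> \<pi> x = 1" using RN_density_unique[of "\<lambda>_. 1"] by (simp add: d1)
  note one = this
  have e: "(\<integral>\<^sup>+x. ennreal ((enn2real (RN_deriv \<pi> (density \<pi> h) x) - enn2real (RN_deriv \<pi> \<pi> x))\<^sup>2) \<partial>\<pi>)
      = (\<integral>\<^sup>+x. ennreal ((enn2real (h x) - 1)\<^sup>2) \<partial>\<pi>)"
    by (intro nn_integral_cong_AE) (use one RN_density_unique[OF h] in \<open>eventually_elim, simp\<close>)
  have "absolutely_continuous \<pi> (density \<pi> h)" "absolutely_continuous \<pi> \<pi>"
    by (rule absolutely_continuousI_density[OF h]) (simp add: absolutely_continuous_def)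
  then show ?thesis unfolding L2_dist_def Let_def e by simp
qed

text \<open>The density of \<open>\<nu> P\<close> minus 1 is \<open>P\<close> applied to the density
  of \<open>\<nu>\<close> minus 1, and the latter is a centred function. If it is not square
  integrable, the right-hand side is infinite.\<close>

lemma L2_dist_step:
  assumes \<nu>: "\<nu> \<in> space (prob_algebra \<pi>)" and ac: "absolutely_continuous \<pi> \<nu>"
  shows "absolutely_continuous \<pi> (\<nu> \<bind> P)"
    "L2_dist \<pi> (\<nu> \<bind> P) \<pi> \<le> L2_dist \<pi> \<nu> \<pi> * ennreal (1 - \<epsilon>)"
proof -
  define h where "h = RN_deriv \<pi> \<nu>"
  have h[measurable]: "h \<in> borel_measurable \<pi>" by (simp add: h_def)
  have \<nu>h: "\<nu> = density \<pi> h" using ac_density[OF \<nu> ac] by (simp add: h_def)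
  have \<nu>': "density \<pi> h \<in> space (prob_algebra \<pi>)" using \<nu> \<nu>h by simp
  define g where "g = (\<lambda>x. \<integral>\<^sup>+y. h y \<partial>P x)"
  have g[measurable]: "g \<in> borel_measurable \<pi>" unfolding g_def by measurable
  have \<nu>P: "\<nu> \<bind> P = density \<pi> g" unfolding \<nu>h g_def by (rule bind_density[OF h \<nu>'])
  show "absolutely_continuous \<pi> (\<nu> \<bind> P)" unfolding \<nu>P by (auto intro: absolutely_continuousI_density)
  have g': "density \<pi> g \<in> space (prob_algebra \<pi>)" using bind_P_prob[OF \<nu>] \<nu>P by simp
  have inth: "(\<integral>\<^sup>+x. h x \<partial>\<pi>) = 1"
  proof -
    have "emeasure (density \<pi> h) (space \<pi>) = 1"
      using prob_space.emeasure_space_1[of "density \<pi> h"] \<nu>' by (simp add: space_prob_algebra)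
    then show ?thesis by (simp add: emeasure_density cong: nn_integral_cong)
  qed
  show "L2_dist \<pi> (\<nu> \<bind> P) \<pi> \<le> L2_dist \<pi> \<nu> \<pi> * ennreal (1 - \<epsilon>)"
  proof (cases "(\<integral>\<^sup>+x. ennreal ((enn2real (h x) - 1)\<^sup>2) \<partial>\<pi>) < \<infinity>")
    case False
    then have "L2_dist \<pi> \<nu> \<pi> = \<infinity>" unfolding \<nu>h by (simp add: L2_dist_density[OF h \<nu>'])
    then show ?thesis using eps by (simp add: ennreal_top_mult)
  next
    case True
    define f where "f = (\<lambda>x. enn2real (h x) - 1)"
    have [measurable]: "f \<in> borel_measurable \<pi>" unfolding f_def by measurable
    have f: "L2 f" using True by (simp add: L2_iff_nn f_def)
    have aeh: "AE x in \<pi>. h x \<noteq> \<infinity>" by (rule nn_integral_PInf_AE) (use inth in auto)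
    have "(\<integral>x. enn2real (h x) \<partial>\<pi>) = enn2real (\<integral>\<^sup>+x. ennreal (enn2real (h x)) \<partial>\<pi>)"
      by (rule integral_eq_nn_integral) auto
    also have "(\<integral>\<^sup>+x. ennreal (enn2real (h x)) \<partial>\<pi>) = (\<integral>\<^sup>+x. h x \<partial>\<pi>)"
      by (rule nn_integral_cong_AE) (use aeh in \<open>eventually_elim, simp add: less_top\<close>)
    finally have inth': "(\<integral>x. enn2real (h x) \<partial>\<pi>) = 1" using inth by simp
    have ih: "integrable \<pi> (\<lambda>x. enn2real (h x))"
      using Bochner_Integration.integrable_add[OF L2_integrable[OF f] integrable_const[of 1]] by (simp add: f_def)
    have f0: "(\<integral>x. f x \<partial>\<pi>) = 0" unfolding f_def using ih inth' by (simp add: prob_space)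
    have aehP: "AE x in \<pi>. AE y in P x. h y \<noteq> \<infinity>"
    proof -
      have "AE x in \<pi> \<bind> P. h x \<noteq> \<infinity>" using aeh by (subst bind_invariant)
      then show ?thesis by (subst (asm) AE_bind[OF P_sub]) auto
    qed
    have gP: "AE x in \<pi>. enn2real (g x) - 1 = markov_op f x"
      using L2_AE_P[OF f] aehP AE_space
    proof eventually_elim
      case (elim x)
      interpret Px: prob_space "P x" by (rule P_prob) fact
      have [measurable_cong]: "sets (P x) = sets \<pi>" by (rule P_sets) fact
      have i: "integrable (P x) (\<lambda>y. enn2real (h y))"
        using Bochner_Integration.integrable_add[of "P x" f "\<lambda>_. 1"] elim(1) by (simp add: f_def)
      have hm: "(\<lambda>y. enn2real (h y)) \<in> borel_measurable (P x)" unfolding P_meas_iff[OF elim(3)] by measurable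
      have "(\<integral>y. enn2real (h y) \<partial>P x) = enn2real (\<integral>\<^sup>+y. ennreal (enn2real (h y)) \<partial>P x)"
        by (rule integral_eq_nn_integral[OF hm]) simp
      also have "(\<integral>\<^sup>+y. ennreal (enn2real (h y)) \<partial>P x) = g x"
        unfolding g_def by (rule nn_integral_cong_AE) (use elim(2) in \<open>eventually_elim, simp add: less_top\<close>)
      finally show ?case using i by (simp add: markov_op_def f_def Px.prob_space)
    qed
    have ng: "(\<integral>\<^sup>+x. ennreal ((enn2real (g x) - 1)\<^sup>2) \<partial>\<pi>) = ennreal (\<integral>x. (markov_op f x)\<^sup>2 \<partial>\<pi>)"
    proof -
      have "(\<integral>\<^sup>+x. ennreal ((enn2real (g x) - 1)\<^sup>2) \<partial>\<pi>) = (\<integral>\<^sup>+x. ennreal ((markov_op f x)\<^sup>2) \<partial>\<pi>)"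
        by (rule nn_integral_cong_AE) (use gP in \<open>eventually_elim, simp\<close>)
      also have "\<dots> = ennreal (\<integral>x. (markov_op f x)\<^sup>2 \<partial>\<pi>)"
        using markov_op_contraction(1)[OF f f0] by (intro nn_integral_eq_integral) (auto simp: L2_def)
      finally show ?thesis .
    qed
    have nf: "(\<integral>\<^sup>+x. ennreal ((enn2real (h x) - 1)\<^sup>2) \<partial>\<pi>) = ennreal (\<integral>x. (f x)\<^sup>2 \<partial>\<pi>)"
      using f unfolding f_def by (intro nn_integral_eq_integral) (auto simp: L2_def)
    have "L2_dist \<pi> (\<nu> \<bind> P) \<pi> = ennreal (sqrt (\<integral>x. (markov_op f x)\<^sup>2 \<partial>\<pi>))"
      unfolding \<nu>P by (simp add: L2_dist_density[OF g g'] ng)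
    also have "\<dots> \<le> ennreal (sqrt ((1 - \<epsilon>)\<^sup>2 * (\<integral>x. (f x)\<^sup>2 \<partial>\<pi>)))"
      using markov_op_contraction(3)[OF f f0] by (intro ennreal_leI real_sqrt_le_mono)
    also have "\<dots> = ennreal (sqrt (\<integral>x. (f x)\<^sup>2 \<partial>\<pi>)) * ennreal (1 - \<epsilon>)"
      using eps by (simp add: real_sqrt_mult ennreal_mult[symmetric] mult.commute)
    also have "ennreal (sqrt (\<integral>x. (f x)\<^sup>2 \<partial>\<pi>)) = L2_dist \<pi> \<nu> \<pi>"
      unfolding \<nu>h by (simp add: L2_dist_density[OF h \<nu>'] nf)
    finally show ?thesis .
  qed
qed

lemma L2_contraction:
  assumes \<nu>: "\<nu> \<in> space (prob_algebra \<pi>)" and ac: "absolutely_continuous \<pi> \<nu>"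
  shows "L2_dist \<pi> (kernel_iter \<nu> P k) \<pi> \<le> L2_dist \<pi> \<nu> \<pi> * ennreal ((1 - \<epsilon>) ^ k)"
proof -
  have "absolutely_continuous \<pi> (kernel_iter \<nu> P k) \<and>
    L2_dist \<pi> (kernel_iter \<nu> P k) \<pi> \<le> L2_dist \<pi> \<nu> \<pi> * ennreal ((1 - \<epsilon>) ^ k)"
  proof (induction k)
    case 0 then show ?case using ac by (simp add: kernel_iter_def)
  next
    case (Suc k)
    note step = L2_dist_step[OF iter_prob[OF \<nu>], of k]
    have "L2_dist \<pi> (kernel_iter \<nu> P (Suc k)) \<pi> \<le> L2_dist \<pi> (kernel_iter \<nu> P k) \<pi> * ennreal (1 - \<epsilon>)"
      using step Suc by (simp add: iter_Suc)
    also have "\<dots> \<le> L2_dist \<pi> \<nu> \<pi> * ennreal ((1 - \<epsilon>) ^ k) * ennreal (1 - \<epsilon>)"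
      using Suc by (intro mult_right_mono) auto
    also have "\<dots> = L2_dist \<pi> \<nu> \<pi> * ennreal ((1 - \<epsilon>) ^ Suc k)"
      using eps by (simp add: mult.assoc ennreal_mult[symmetric] mult.commute[of "1 - \<epsilon>"])
    finally show ?case using step Suc by (simp add: iter_Suc)
  qed
  then show ?thesis by simp
qed

end

section \<open>Laws of Markov chains\<close>

text \<open>Only the kernels \<open>K t\<close> with \<open>t \<ge> 2\<close> enter the law of the
  chain; \<open>\<mu>\<close> takes the place of the first one.\<close>

locale markov_chain_model =
  fixes S \<mu> :: "'a measure" and K :: "nat \<Rightarrow> 'a \<Rightarrow> 'a measure"
  assumes \<mu>: "\<mu> \<in> space (prob_algebra S)"
    and K: "\<And>t. 2 \<le> t \<Longrightarrow> K t \<in> S \<rightarrow>\<^sub>M prob_algebra S"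
begin

lemma sets_\<mu>: "sets \<mu> = sets S" and prob_\<mu>: "prob_space \<mu>" and space_\<mu>: "space \<mu> = space S"
  using \<mu> by (auto simp: space_prob_algebra dest: sets_eq_imp_space_eq)

lemma ne_S: "space S \<noteq> {}"
  using prob_space.not_empty[OF prob_\<mu>] by (simp add: space_\<mu>)

lemma measurable_extend:
  "(\<lambda>(w, y). w(Suc t := y)) \<in> (\<Pi>\<^sub>M i\<in>{p..t}. S) \<Otimes>\<^sub>M S \<rightarrow>\<^sub>M (\<Pi>\<^sub>M i\<in>{p..Suc t}. S)" if "p \<le> Suc t"
proof -
  have "{p..Suc t} = insert (Suc t) {p..t}" using that by auto
  then show ?thesis using measurable_add_dim[of "Suc t" "{p..t}" "\<lambda>_. S"] by simp
qed

lemma measurable_extend_kernel: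
  assumes t: "1 \<le> t" "p \<le> t"
  shows "(\<lambda>w. distr (K (Suc t) (w t)) (\<Pi>\<^sub>M i\<in>{p..Suc t}. S) (\<lambda>y. w(Suc t := y)))
    \<in> (\<Pi>\<^sub>M i\<in>{p..t}. S) \<rightarrow>\<^sub>M prob_algebra (\<Pi>\<^sub>M i\<in>{p..Suc t}. S)"
proof (rule measurable_distr_prob_space2)
  show "(\<lambda>w. K (Suc t) (w t)) \<in> (\<Pi>\<^sub>M i\<in>{p..t}. S) \<rightarrow>\<^sub>M prob_algebra S"
    by (rule measurable_compose[of "\<lambda>w. w t" _ S, OF measurable_component_singleton K]) (use t in auto)
qed (use t measurable_extend in auto)

lemma measurable_chain_from:
  assumes p: "1 \<le> p"
  shows "(\<lambda>z. chain_from S K p z n) \<in> S \<rightarrow>\<^sub>M prob_algebra (\<Pi>\<^sub>M t\<in>{p..p + n}. S)"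
proof (induction n)
  case 0
  have "(\<lambda>z. \<lambda>t\<in>{p}. z) \<in> S \<rightarrow>\<^sub>M (\<Pi>\<^sub>M t\<in>{p..p}. S)" by (simp add: measurable_restrict)
  from measurable_compose[OF this measurable_return_prob_space] show ?case by simp
next
  case (Suc n)
  from measurable_bind_prob_space[OF Suc measurable_extend_kernel[of "p + n" p]] p
  show ?case by simp
qed

lemma chain_law_1: "chain_law S \<mu> K 1 = distr \<mu> (paths S 1) (\<lambda>z. \<lambda>t\<in>{1}. z)"
proof -
  have "(\<lambda>z. \<lambda>t\<in>{1::nat}. z) \<in> \<mu> \<rightarrow>\<^sub>M paths S 1"
    unfolding paths_def measurable_cong_sets[OF sets_\<mu> refl] by (simp add: measurable_restrict)
  from bind_return_distr'[OF _ this] show ?thesis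
    using ne_S by (simp add: chain_law_def paths_def space_\<mu>)
qed

lemma chain_law_Suc:
  assumes T: "1 \<le> T"
  shows "chain_law S \<mu> K (Suc T) =
    chain_law S \<mu> K T \<bind> (\<lambda>w. distr (K (Suc T) (w T)) (paths S (Suc T)) (\<lambda>y. w(Suc T := y)))"
proof -
  obtain n where n: "T = Suc n" using T by (cases T) auto
  have m: "(\<lambda>z. chain_from S K 1 z n) \<in> \<mu> \<rightarrow>\<^sub>M subprob_algebra (\<Pi>\<^sub>M t\<in>{1..Suc n}. S)"
    unfolding measurable_cong_sets[OF sets_\<mu> refl]
    using measurable_prob_algebraD[OF measurable_chain_from[of 1 n]] by simp
  have m2: "(\<lambda>w. distr (K (Suc (Suc n)) (w (Suc n))) (\<Pi>\<^sub>M i\<in>{1..Suc (Suc n)}. S) (\<lambda>y. w(Suc (Suc n) := y)))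
    \<in> (\<Pi>\<^sub>M i\<in>{1..Suc n}. S) \<rightarrow>\<^sub>M subprob_algebra (\<Pi>\<^sub>M i\<in>{1..Suc (Suc n)}. S)"
    by (rule measurable_prob_algebraD[OF measurable_extend_kernel]) auto
  show ?thesis
    unfolding chain_law_def n using bind_assoc[OF m m2] by (simp add: paths_def)
qed

lemma chain_law_prob: "1 \<le> T \<Longrightarrow> chain_law S \<mu> K T \<in> space (prob_algebra (paths S T))"
proof -
  assume T: "1 \<le> T"
  have m: "(\<lambda>z. chain_from S K 1 z (T - 1)) \<in> S \<rightarrow>\<^sub>M prob_algebra (paths S T)"
    using measurable_chain_from[of 1 "T - 1"] T by (simp add: paths_def)
  show ?thesis unfolding chain_law_def
    using prob_space_bind'[OF \<mu> m] sets_bind'[OF \<mu> m] by (simp add: space_prob_algebra)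
qed

lemma sets_chain_law: "1 \<le> T \<Longrightarrow> sets (chain_law S \<mu> K T) = sets (paths S T)"
  and prob_chain_law: "1 \<le> T \<Longrightarrow> prob_space (chain_law S \<mu> K T)"
  and space_chain_law: "1 \<le> T \<Longrightarrow> space (chain_law S \<mu> K T) = space (paths S T)"
  using chain_law_prob[of T] by (auto simp: space_prob_algebra dest: sets_eq_imp_space_eq)

lemma measurable_extend_paths: "(\<lambda>(w, y). w(Suc T := y)) \<in> paths S T \<Otimes>\<^sub>M S \<rightarrow>\<^sub>M paths S (Suc T)"
  unfolding paths_def by (rule measurable_extend) simp

lemma measurable_extend_path:
  "w \<in> space (paths S T) \<Longrightarrow> (\<lambda>y. w(Suc T := y)) \<in> S \<rightarrow>\<^sub>M paths S (Suc T)"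
  using measurable_compose[OF measurable_Pair1' measurable_extend_paths] by fastforce

lemma measurable_extend_kernel_paths:
  "1 \<le> T \<Longrightarrow> (\<lambda>w. distr (K (Suc T) (w T)) (paths S (Suc T)) (\<lambda>y. w(Suc T := y)))
    \<in> paths S T \<rightarrow>\<^sub>M prob_algebra (paths S (Suc T))"
  unfolding paths_def by (rule measurable_extend_kernel) auto

lemma path_in_space: "w \<in> space (paths S T) \<Longrightarrow> 1 \<le> t \<Longrightarrow> t \<le> T \<Longrightarrow> w t \<in> space S"
  by (auto simp: paths_def space_PiM)

lemma measurable_path_component: "1 \<le> t \<Longrightarrow> t \<le> T \<Longrightarrow> (\<lambda>w. w t) \<in> paths S T \<rightarrow>\<^sub>M S"
  unfolding paths_def by (rule measurable_component_singleton) simp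

lemma sets_K: "2 \<le> t \<Longrightarrow> z \<in> space S \<Longrightarrow> sets (K t z) = sets S"
  and prob_K: "2 \<le> t \<Longrightarrow> z \<in> space S \<Longrightarrow> prob_space (K t z)"
  using measurable_space[OF K] by (auto simp: space_prob_algebra)

lemma nn_integral_extend:
  assumes T: "1 \<le> T" and w: "w \<in> space (paths S T)" and F: "F \<in> borel_measurable (paths S (Suc T))"
  shows "(\<integral>\<^sup>+y. F y \<partial>distr (K (Suc T) (w T)) (paths S (Suc T)) (\<lambda>y. w(Suc T := y)))
    = (\<integral>\<^sup>+y. F (w(Suc T := y)) \<partial>K (Suc T) (w T))"
proof (rule nn_integral_distr)
  have s: "sets (K (Suc T) (w T)) = sets S" using T path_in_space[OF w T] by (intro sets_K) auto
  show "(\<lambda>y. w(Suc T := y)) \<in> K (Suc T) (w T) \<rightarrow>\<^sub>M paths S (Suc T)"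
    unfolding measurable_cong_sets[OF s refl] by (rule measurable_extend_path[OF w])
qed (use F in simp)

lemma nn_integral_chain_1:
  assumes F: "F \<in> borel_measurable (paths S 1)"
  shows "(\<integral>\<^sup>+w. F w \<partial>chain_law S \<mu> K 1) = (\<integral>\<^sup>+z. F (\<lambda>t\<in>{1}. z) \<partial>\<mu>)"
  unfolding chain_law_1
proof (rule nn_integral_distr)
  show "(\<lambda>z. \<lambda>t\<in>{1::nat}. z) \<in> \<mu> \<rightarrow>\<^sub>M paths S 1"
    unfolding paths_def measurable_cong_sets[OF sets_\<mu> refl] by (simp add: measurable_restrict)
qed (use F in simp)

lemma nn_integral_chain_Suc:
  assumes T: "1 \<le> T" and F: "F \<in> borel_measurable (paths S (Suc T))"
  shows "(\<integral>\<^sup>+w. F w \<partial>chain_law S \<mu> K (Suc T))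
    = (\<integral>\<^sup>+w. \<integral>\<^sup>+y. F (w(Suc T := y)) \<partial>K (Suc T) (w T) \<partial>chain_law S \<mu> K T)"
proof -
  have k: "(\<lambda>w. distr (K (Suc T) (w T)) (paths S (Suc T)) (\<lambda>y. w(Suc T := y)))
      \<in> chain_law S \<mu> K T \<rightarrow>\<^sub>M subprob_algebra (paths S (Suc T))"
    unfolding measurable_cong_sets[OF sets_chain_law[OF T] refl]
    by (rule measurable_prob_algebraD[OF measurable_extend_kernel_paths[OF T]])
  show ?thesis
    unfolding chain_law_Suc[OF T] nn_integral_bind[OF F k]
    by (rule nn_integral_cong) (use T F nn_integral_extend in \<open>simp add: space_chain_law\<close>)
qed

lemma integral_chain_Suc:
  fixes F :: "_ \<Rightarrow> real"
  assumes T: "1 \<le> T" and i: "integrable (chain_law S \<mu> K (Suc T)) F"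
  shows "(\<integral>w. F w \<partial>chain_law S \<mu> K (Suc T))
    = (\<integral>w. \<integral>y. F (w(Suc T := y)) \<partial>K (Suc T) (w T) \<partial>chain_law S \<mu> K T)"
proof -
  have F: "F \<in> borel_measurable (paths S (Suc T))"
    using i by (simp add: integrable_iff_bounded measurable_cong_sets[OF sets_chain_law refl])
  let ?k = "\<lambda>w. distr (K (Suc T) (w T)) (paths S (Suc T)) (\<lambda>y. w(Suc T := y))"
  have k: "?k \<in> chain_law S \<mu> K T \<rightarrow>\<^sub>M subprob_algebra (paths S (Suc T))"
    unfolding measurable_cong_sets[OF sets_chain_law[OF T] refl]
    by (rule measurable_prob_algebraD[OF measurable_extend_kernel_paths[OF T]])
  have ab: "(\<lambda>w. ennreal \<bar>F w\<bar>) \<in> borel_measurable (paths S (Suc T))" using F by measurable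
  have "(\<integral>\<^sup>+w. ennreal \<bar>F w\<bar> \<partial>chain_law S \<mu> K (Suc T)) < \<infinity>"
    using i by (simp add: integrable_iff_bounded)
  then have fin: "(\<integral>\<^sup>+w. \<integral>\<^sup>+y. ennreal \<bar>F y\<bar> \<partial>?k w \<partial>chain_law S \<mu> K T) < \<infinity>"
    unfolding chain_law_Suc[OF T] nn_integral_bind[OF ab k] .
  have ne: "space (chain_law S \<mu> K T) \<noteq> {}"
    using prob_space.not_empty[OF prob_chain_law[OF T]] .
  show ?thesis
    unfolding chain_law_Suc[OF T] integral_bind_L1(2)[OF k F fin ne]
  proof (rule Bochner_Integration.integral_cong[OF refl])
    fix w assume "w \<in> space (chain_law S \<mu> K T)"
    then have w: "w \<in> space (paths S T)" by (simp add: space_chain_law[OF T])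
    have s: "sets (K (Suc T) (w T)) = sets S" using T path_in_space[OF w T] by (intro sets_K) auto
    show "(\<integral>y. F y \<partial>?k w) = (\<integral>y. F (w(Suc T := y)) \<partial>K (Suc T) (w T))"
    proof (rule integral_distr[OF _ F])
      show "(\<lambda>y. w(Suc T := y)) \<in> K (Suc T) (w T) \<rightarrow>\<^sub>M paths S (Suc T)"
        unfolding measurable_cong_sets[OF s refl] by (rule measurable_extend_path[OF w])
    qed
  qed
qed

lemma chain_from_prob: "1 \<le> p \<Longrightarrow> z \<in> space S \<Longrightarrow> chain_from S K p z n \<in> space (prob_algebra (\<Pi>\<^sub>M t\<in>{p..p + n}. S))"
  using measurable_space[OF measurable_chain_from] .

text \<open>Testing against one more step, for the chain started from a point at an arbitrary time;
  this is what makes the recursion of \<open>Q\<close> in its upper index available.\<close>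

lemma nn_integral_chain_from_Suc:
  assumes p: "1 \<le> p" and z: "z \<in> space S" and F: "F \<in> borel_measurable (\<Pi>\<^sub>M t\<in>{p..p + Suc n}. S)"
  shows "(\<integral>\<^sup>+w. F w \<partial>chain_from S K p z (Suc n)) =
    (\<integral>\<^sup>+w. \<integral>\<^sup>+y. F (w(Suc (p + n) := y)) \<partial>K (Suc (p + n)) (w (p + n)) \<partial>chain_from S K p z n)"
proof -
  let ?k = "\<lambda>w. distr (K (Suc (p + n)) (w (p + n))) (\<Pi>\<^sub>M t\<in>{p..p + Suc n}. S) (\<lambda>y. w(Suc (p + n) := y))"
  have c: "chain_from S K p z n \<in> space (prob_algebra (\<Pi>\<^sub>M t\<in>{p..p + n}. S))" by (rule chain_from_prob[OF p z])
  have s: "sets (chain_from S K p z n) = sets (\<Pi>\<^sub>M t\<in>{p..p + n}. S)" using c by (simp add: space_prob_algebra)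
  have k: "?k \<in> chain_from S K p z n \<rightarrow>\<^sub>M subprob_algebra (\<Pi>\<^sub>M t\<in>{p..p + Suc n}. S)"
    unfolding measurable_cong_sets[OF s refl]
    using measurable_prob_algebraD[OF measurable_extend_kernel[of "p + n" p]] p by simp
  show ?thesis
    unfolding chain_from.simps(2) nn_integral_bind[OF F k]
  proof (rule nn_integral_cong)
    fix w assume "w \<in> space (chain_from S K p z n)"
    then have w: "w \<in> space (\<Pi>\<^sub>M t\<in>{p..p + n}. S)" by (simp add: sets_eq_imp_space_eq[OF s])
    then have "w (p + n) \<in> space S" by (auto simp: space_PiM)
    then have s': "sets (K (Suc (p + n)) (w (p + n))) = sets S" using p by (intro sets_K) auto
    have "(\<lambda>y. w(Suc (p + n) := y)) \<in> S \<rightarrow>\<^sub>M (\<Pi>\<^sub>M t\<in>{p..Suc (p + n)}. S)"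
      using measurable_compose[OF measurable_Pair1'[OF w] measurable_extend[of p "p + n"]] by simp
    then show "(\<integral>\<^sup>+y. F y \<partial>?k w) = (\<integral>\<^sup>+y. F (w(Suc (p + n) := y)) \<partial>K (Suc (p + n)) (w (p + n)))"
      using F by (subst nn_integral_distr) (auto simp: measurable_cong_sets[OF s' refl])
  qed
qed

end

context positive_reversible_kernel begin

sublocale chain: markov_chain_model \<pi> \<pi> "\<lambda>_. P"
  by unfold_locales (auto simp: space_prob_algebra prob_space_axioms P)

section \<open>The asymptotic variance of a stationary chain\<close>

abbreviation stationary :: "nat \<Rightarrow> (nat \<Rightarrow> 'a) measure" where "stationary n \<equiv> chain_law \<pi> \<pi> (\<lambda>_. P) n"

lemma stationary_component: "1 \<le> i \<Longrightarrow> i \<le> n \<Longrightarrow> (\<lambda>w. w i) \<in> stationary n \<rightarrow>\<^sub>M \<pi>"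
  using chain.measurable_path_component[of i n]
  by (simp add: measurable_cong_sets[OF chain.sets_chain_law refl])

lemma path_component_borel:
  "u \<in> borel_measurable \<pi> \<Longrightarrow> 1 \<le> i \<Longrightarrow> i \<le> n \<Longrightarrow> (\<lambda>w. u (w i)) \<in> borel_measurable (paths \<pi> n)"
  by (rule measurable_compose[OF chain.measurable_path_component])

lemma nn_marginal_last:
  assumes u: "u \<in> borel_measurable \<pi>" and n: "1 \<le> n"
  shows "(\<integral>\<^sup>+w. u (w n) \<partial>stationary n) = (\<integral>\<^sup>+x. u x \<partial>\<pi>)"
  using n u
proof (induction n arbitrary: u rule: dec_induct)
  case base
  show ?case by (subst chain.nn_integral_chain_1[OF path_component_borel[OF base]]) auto
next
  case (step n)
  note [measurable] = step.prems
  have "(\<integral>\<^sup>+w. u (w (Suc n)) \<partial>stationary (Suc n)) = (\<integral>\<^sup>+w. \<integral>\<^sup>+y. u y \<partial>P (w n) \<partial>stationary n)"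
    by (subst chain.nn_integral_chain_Suc[OF step.hyps(1) path_component_borel[OF step.prems]]) auto
  also have "\<dots> = (\<integral>\<^sup>+x. \<integral>\<^sup>+y. u y \<partial>P x \<partial>\<pi>)"
    by (rule step.IH) measurable
  finally show ?case by (simp add: invariant_nn)
qed

lemma nn_marginal:
  assumes u: "u \<in> borel_measurable \<pi>" and i: "1 \<le> i" "i \<le> n"
  shows "(\<integral>\<^sup>+w. u (w i) \<partial>stationary n) = (\<integral>\<^sup>+x. u x \<partial>\<pi>)"
  using i(2)
proof (induction n rule: dec_induct)
  case base
  show ?case by (rule nn_marginal_last[OF u i(1)])
next
  case (step n)
  have n: "1 \<le> n" using step i by simp
  have "(\<integral>\<^sup>+w. u (w i) \<partial>stationary (Suc n)) = (\<integral>\<^sup>+w. \<integral>\<^sup>+y. u ((w(Suc n := y)) i) \<partial>P (w n) \<partial>stationary n)"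
    by (rule chain.nn_integral_chain_Suc[OF n path_component_borel[OF u i(1)]]) (use step in simp)
  also have "\<dots> = (\<integral>\<^sup>+w. u (w i) \<partial>stationary n)"
  proof (rule nn_integral_cong)
    fix w assume "w \<in> space (stationary n)"
    then have "w n \<in> space \<pi>" using n chain.path_in_space[of w n n] by (simp add: chain.space_chain_law)
    then show "(\<integral>\<^sup>+y. u ((w(Suc n := y)) i) \<partial>P (w n)) = u (w i)"
      using step by (simp add: P_prob prob_space.emeasure_space_1)
  qed
  finally show ?case using step.IH by simp
qed

lemma marginal: "1 \<le> i \<Longrightarrow> i \<le> n \<Longrightarrow> distr (stationary n) \<pi> (\<lambda>w. w i) = \<pi>"
proof (rule measure_eqI)
  assume i: "1 \<le> i" "i \<le> n"
  show "sets (distr (stationary n) \<pi> (\<lambda>w. w i)) = sets \<pi>" by simp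
  fix A assume "A \<in> sets (distr (stationary n) \<pi> (\<lambda>w. w i))"
  then have [measurable]: "A \<in> sets \<pi>" by simp
  have "emeasure (distr (stationary n) \<pi> (\<lambda>w. w i)) A = (\<integral>\<^sup>+x. indicator A x \<partial>distr (stationary n) \<pi> (\<lambda>w. w i))" by simp
  also have "\<dots> = (\<integral>\<^sup>+w. indicator A (w i) \<partial>stationary n)" by (rule nn_integral_distr[OF stationary_component[OF i]]) simp
  also have "\<dots> = emeasure \<pi> A" by (subst nn_marginal[OF _ i]) auto
  finally show "emeasure (distr (stationary n) \<pi> (\<lambda>w. w i)) A = emeasure \<pi> A" .
qed

lemma integrable_marginal: "integrable \<pi> f \<Longrightarrow> 1 \<le> i \<Longrightarrow> i \<le> n \<Longrightarrow> integrable (stationary n) (\<lambda>w. f (w i) :: real)"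
  using integrable_distr[OF stationary_component[of i n], of f] by (simp add: marginal)

lemma integral_marginal: "f \<in> borel_measurable \<pi> \<Longrightarrow> 1 \<le> i \<Longrightarrow> i \<le> n \<Longrightarrow> (\<integral>w. f (w i) \<partial>stationary n) = ((\<integral>x. f x \<partial>\<pi>) :: real)"
  using integral_distr[OF stationary_component[of i n], of f] by (simp add: marginal)

lemma integrable_cross:
  assumes "L2 f" "L2 g" "1 \<le> i" "i \<le> n" "1 \<le> j" "j \<le> n"
  shows "integrable (stationary n) (\<lambda>w. f (w i) * g (w j))"
proof (rule Bochner_Integration.integrable_bound)
  show "integrable (stationary n) (\<lambda>w. (f (w i))\<^sup>2 + (g (w j))\<^sup>2)"
    using integrable_marginal[of "\<lambda>x. (f x)\<^sup>2" i n] integrable_marginal[of "\<lambda>x. (g x)\<^sup>2" j n] assms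
    by (simp add: L2_def)
  have "(\<lambda>w. f (w i)) \<in> borel_measurable (stationary n)" "(\<lambda>w. g (w j)) \<in> borel_measurable (stationary n)"
    by (rule measurable_compose[OF stationary_component]; use assms in \<open>simp add: L2_def\<close>)+
  then show "(\<lambda>w. f (w i) * g (w j)) \<in> borel_measurable (stationary n)"
    by (rule borel_measurable_times)
  show "AE w in stationary n. norm (f (w i) * g (w j)) \<le> norm ((f (w i))\<^sup>2 + (g (w j))\<^sup>2)"
    by (intro AE_I2) (simp add: abs_mult_le_sum_squares)
qed

text \<open>On centred functions the variance is the squared norm, and \<open>markov_op\<close> is a
  contraction.\<close>

definition centred :: "('a \<Rightarrow> real) \<Rightarrow> bool" where
  "centred f \<longleftrightarrow> L2 f \<and> (\<integral>x. f x \<partial>\<pi>) = 0"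

lemma centred_L2: "centred f \<Longrightarrow> L2 f" by (simp add: centred_def)

lemma centred_markov_op: "centred f \<Longrightarrow> centred (markov_op f)"
  using markov_op_contraction(1,2) by (auto simp: centred_def)

lemma centred_iter: "centred f \<Longrightarrow> centred ((markov_op ^^ k) f)"
  by (induction k) (auto intro: centred_markov_op)

definition autocov :: "('a \<Rightarrow> real) \<Rightarrow> nat \<Rightarrow> real" where
  "autocov f k = (\<integral>x. f x * (markov_op ^^ k) f x \<partial>\<pi>)"

lemma inner_iter:
  assumes "centred f"
  shows "autocov f (a + b) = (\<integral>x. (markov_op ^^ a) f x * (markov_op ^^ b) f x \<partial>\<pi>)"
proof (induction a arbitrary: b)
  case 0 then show ?case by (simp add: autocov_def)
next
  case (Suc a)
  have "autocov f (Suc a + b) = (\<integral>x. (markov_op ^^ a) f x * markov_op ((markov_op ^^ b) f) x \<partial>\<pi>)"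
    using Suc[of "Suc b"] by simp
  also have "\<dots> = (\<integral>x. markov_op ((markov_op ^^ a) f) x * (markov_op ^^ b) f x \<partial>\<pi>)"
    by (rule inner_sym) (use assms centred_iter centred_L2 in blast)+
  finally show ?case by simp
qed

text \<open>The weighted inequality \<open>2 a b \<le> c a\<^sup>2 + b\<^sup>2 / c\<close> with
  \<open>c = 1 - \<epsilon>\<close> plays the role of Cauchy-Schwarz, and is sharp for the
  contraction rate \<open>c\<close>.\<close>

lemma inner_markov_op_le:
  assumes "centred g"
  shows "(\<integral>x. g x * markov_op g x \<partial>\<pi>) \<le> (1 - \<epsilon>) * (\<integral>x. (g x)\<^sup>2 \<partial>\<pi>)"
proof -
  define c where "c = 1 - \<epsilon>"
  have c: "0 < c" using eps by (simp add: c_def)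
  have L: "L2 g" "L2 (markov_op g)" using assms centred_markov_op by (auto simp: centred_def)
  have [measurable]: "g \<in> borel_measurable \<pi>" using L by (simp add: L2_def)
  have i: "integrable \<pi> (\<lambda>x. (c * (g x)\<^sup>2 + (markov_op g x)\<^sup>2 / c) / 2)"
    using L by (simp add: L2_def)
  have le: "a * b \<le> (c * a\<^sup>2 + b\<^sup>2 / c) / 2" for a b :: real
  proof -
    have "0 \<le> (c * a - b)\<^sup>2 / c" using c by simp
    also have "\<dots> = c * a\<^sup>2 + b\<^sup>2 / c - 2 * (a * b)"
      using c by (simp add: power2_eq_square field_simps)
    finally show ?thesis by simp
  qed
  have i2: "integrable \<pi> (\<lambda>x. g x * markov_op g x)"
  proof (rule Bochner_Integration.integrable_bound)
    show "integrable \<pi> (\<lambda>x. (g x)\<^sup>2 + (markov_op g x)\<^sup>2)" using L by (simp add: L2_def)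
    show "AE x in \<pi>. norm (g x * markov_op g x) \<le> norm ((g x)\<^sup>2 + (markov_op g x)\<^sup>2)"
      by (intro AE_I2) (simp add: abs_mult_le_sum_squares)
  qed simp
  have "(\<integral>x. g x * markov_op g x \<partial>\<pi>) \<le> (\<integral>x. (c * (g x)\<^sup>2 + (markov_op g x)\<^sup>2 / c) / 2 \<partial>\<pi>)"
    by (rule integral_mono[OF i2 i]) (rule le)
  also have "\<dots> = (c * (\<integral>x. (g x)\<^sup>2 \<partial>\<pi>) + (\<integral>x. (markov_op g x)\<^sup>2 \<partial>\<pi>) / c) / 2"
    using L by (simp add: L2_def)
  also have "\<dots> \<le> (c * (\<integral>x. (g x)\<^sup>2 \<partial>\<pi>) + (c\<^sup>2 * (\<integral>x. (g x)\<^sup>2 \<partial>\<pi>)) / c) / 2"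
    using markov_op_contraction(3)[of g] assms c
    by (intro divide_right_mono add_left_mono) (auto simp: centred_def c_def)
  also have "\<dots> = c * (\<integral>x. (g x)\<^sup>2 \<partial>\<pi>)" using c by (simp add: power2_eq_square)
  finally show ?thesis by (simp add: c_def)
qed

lemma norm_iter_le:
  assumes "centred f"
  shows "(\<integral>x. ((markov_op ^^ j) f x)\<^sup>2 \<partial>\<pi>) \<le> (1 - \<epsilon>) ^ (2 * j) * (\<integral>x. (f x)\<^sup>2 \<partial>\<pi>)"
proof (induction j)
  case (Suc j)
  have "(\<integral>x. (markov_op ((markov_op ^^ j) f) x)\<^sup>2 \<partial>\<pi>) \<le> (1 - \<epsilon>)\<^sup>2 * (\<integral>x. ((markov_op ^^ j) f x)\<^sup>2 \<partial>\<pi>)"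
    using centred_iter[OF assms, of j] by (intro markov_op_contraction(3)) (auto simp: centred_def)
  also have "\<dots> \<le> (1 - \<epsilon>)\<^sup>2 * ((1 - \<epsilon>) ^ (2 * j) * (\<integral>x. (f x)\<^sup>2 \<partial>\<pi>))"
    using Suc by (intro mult_left_mono) auto
  finally show ?case by (simp add: power_add power2_eq_square mult_ac)
qed simp

lemma autocov_even: "centred f \<Longrightarrow> autocov f (2 * j) = (\<integral>x. ((markov_op ^^ j) f x)\<^sup>2 \<partial>\<pi>)"
  using inner_iter[of f j j] by (simp add: mult_2 power2_eq_square)

lemma autocov_odd: "centred f \<Longrightarrow> autocov f (Suc (2 * j)) = (\<integral>x. (markov_op ^^ j) f x * markov_op ((markov_op ^^ j) f) x \<partial>\<pi>)"
  using inner_iter[of f j "Suc j"] by (simp add: mult_2)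

lemma autocov_0: "autocov f 0 = (\<integral>x. (f x)\<^sup>2 \<partial>\<pi>)" by (simp add: autocov_def power2_eq_square)

text \<open>By symmetry an even autocovariance is a squared norm \<open>\<parallel>P\<^sup>j
  f\<parallel>\<^sup>2\<close>, and an odd one is \<open>\<langle>h, P h\<rangle>\<close> with
  \<open>h = P\<^sup>j f\<close>. The first is trivially nonnegative; the second is the only place
  where positivity of \<open>P\<close> is used.\<close>

lemma autocov_bounds:
  assumes f: "centred f"
  shows "0 \<le> autocov f k" "autocov f k \<le> (1 - \<epsilon>) ^ k * autocov f 0"
proof -
  have "0 \<le> autocov f k \<and> autocov f k \<le> (1 - \<epsilon>) ^ k * autocov f 0"
  proof (cases "even k")
    case True
    then obtain j where k: "k = 2 * j" by blast
    then show ?thesis using norm_iter_le[OF f, of j] unfolding k autocov_even[OF f] autocov_0 by simp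
  next
    case False
    then obtain j where k: "k = Suc (2 * j)" using oddE by fastforce
    let ?g = "(markov_op ^^ j) f"
    have g: "centred ?g" by (rule centred_iter[OF f])
    have "(\<integral>x. ?g x * markov_op ?g x \<partial>\<pi>) \<le> (1 - \<epsilon>) * (\<integral>x. (?g x)\<^sup>2 \<partial>\<pi>)" by (rule inner_markov_op_le[OF g])
    also have "\<dots> \<le> (1 - \<epsilon>) * ((1 - \<epsilon>) ^ (2 * j) * (\<integral>x. (f x)\<^sup>2 \<partial>\<pi>))"
      using norm_iter_le[OF f, of j] eps by (intro mult_left_mono) auto
    finally show ?thesis
      using inner_nonneg[OF centred_L2[OF g]] unfolding k autocov_odd[OF f] autocov_0 by (simp add: mult.assoc)
  qed
  then show "0 \<le> autocov f k" "autocov f k \<le> (1 - \<epsilon>) ^ k * autocov f 0" by auto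
qed

lemma integral_stationary_cross:
  assumes f: "L2 f" and g: "L2 g" and i: "1 \<le> i" "i \<le> n"
  shows "(\<integral>w. f (w i) * g (w (Suc n)) \<partial>stationary (Suc n)) = (\<integral>w. f (w i) * markov_op g (w n) \<partial>stationary n)"
proof -
  have "(\<integral>w. f (w i) * g (w (Suc n)) \<partial>stationary (Suc n)) =
      (\<integral>w. \<integral>y. f ((w(Suc n := y)) i) * g ((w(Suc n := y)) (Suc n)) \<partial>P (w n) \<partial>stationary n)"
    by (rule chain.integral_chain_Suc) (use i integrable_cross[OF f g, of i "Suc n" "Suc n"] in auto)
  also have "\<dots> = (\<integral>w. f (w i) * markov_op g (w n) \<partial>stationary n)"
    using i by (intro Bochner_Integration.integral_cong refl) (simp add: markov_op_def)
  finally show ?thesis .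
qed

text \<open>Conditioning on all but the last state moves one application of \<open>P\<close> onto
  \<open>g\<close> and shortens the path by one.\<close>

lemma autocovariance:
  assumes f: "centred f" and g: "centred g" and i: "1 \<le> i" "i \<le> n"
  shows "(\<integral>w. f (w i) * g (w n) \<partial>stationary n) = (\<integral>x. f x * (markov_op ^^ (n - i)) g x \<partial>\<pi>)"
  using i(2) g
proof (induction n arbitrary: g rule: dec_induct)
  case base
  have [measurable]: "f \<in> borel_measurable \<pi>" "g \<in> borel_measurable \<pi>"
    using f base by (auto simp: centred_def L2_def)
  show ?case using integral_marginal[of "\<lambda>x. f x * g x" i i] i by simp
next
  case (step n)
  have "(\<integral>w. f (w i) * g (w (Suc n)) \<partial>stationary (Suc n)) = (\<integral>w. f (w i) * markov_op g (w n) \<partial>stationary n)"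
    by (rule integral_stationary_cross) (use step f i centred_L2 in auto)
  also have "\<dots> = (\<integral>x. f x * (markov_op ^^ (n - i)) (markov_op g) x \<partial>\<pi>)"
    by (rule step.IH[OF centred_markov_op[OF step.prems]])
  also have "(markov_op ^^ (n - i)) (markov_op g) = (markov_op ^^ (Suc n - i)) g"
    using step.hyps by (simp add: Suc_diff_le funpow_swap1)
  finally show ?case .
qed

lemma integral_stationary_prefix:
  assumes n: "1 \<le> n" and int: "integrable (stationary (Suc n)) F" and F: "\<And>w y. F (w(Suc n := y)) = (F w :: real)"
  shows "(\<integral>w. F w \<partial>stationary (Suc n)) = (\<integral>w. F w \<partial>stationary n)"
proof -
  have "(\<integral>w. F w \<partial>stationary (Suc n)) = (\<integral>w. \<integral>y. F (w(Suc n := y)) \<partial>P (w n) \<partial>stationary n)"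
    by (rule chain.integral_chain_Suc[OF n int])
  also have "\<dots> = (\<integral>w. F w \<partial>stationary n)"
  proof (rule Bochner_Integration.integral_cong[OF refl])
    fix w assume "w \<in> space (stationary n)"
    then have "w n \<in> space \<pi>" using n chain.path_in_space[of w n n] by (simp add: chain.space_chain_law)
    then show "(\<integral>y. F (w(Suc n := y)) \<partial>P (w n)) = F w"
      unfolding F by (simp add: prob_space.prob_space[OF P_prob])
  qed
  finally show ?thesis .
qed

definition sum_var :: "('a \<Rightarrow> real) \<Rightarrow> nat \<Rightarrow> real" where
  "sum_var f n = (\<integral>w. (\<Sum>i=1..n. f (w i))\<^sup>2 \<partial>stationary n)"

lemma integral_marginal_sq:
  "L2 f \<Longrightarrow> 1 \<le> i \<Longrightarrow> i \<le> n \<Longrightarrow> (\<integral>w. (f (w i))\<^sup>2 \<partial>stationary n) = (\<integral>x. (f x)\<^sup>2 \<partial>\<pi>)"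
  by (rule integral_marginal[of "\<lambda>x. (f x)\<^sup>2"]) (auto simp: L2_def)

lemma sum_var_1: "centred f \<Longrightarrow> sum_var f 1 = autocov f 0"
  unfolding sum_var_def autocov_0 using integral_marginal_sq[of f 1 1] by (simp add: centred_def)

lemma integrable_sum_squared:
  assumes f: "L2 f" and n: "m \<le> n"
  shows "integrable (stationary n) (\<lambda>w. (\<Sum>i=1..m. f (w i))\<^sup>2)"
  unfolding power2_eq_square sum_product
  by (intro Bochner_Integration.integrable_sum integrable_cross f) (use n in auto)

text \<open>The increment is the variance of the new term plus its covariances with the earlier
  ones, and by stationarity these depend on the lag only.\<close>

lemma sum_var_Suc:
  assumes f: "centred f" and n: "1 \<le> n"
  shows "sum_var f (Suc n) = sum_var f n + (autocov f 0 + 2 * (\<Sum>k=1..n. autocov f k))"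
proof -
  let ?s = "\<lambda>w :: nat \<Rightarrow> 'a. \<Sum>i=1..n. f (w i)"
  note L = centred_L2[OF f]
  have i1: "integrable (stationary (Suc n)) (\<lambda>w. (?s w)\<^sup>2)" by (rule integrable_sum_squared[OF L]) simp
  have i2: "integrable (stationary (Suc n)) (\<lambda>w. f (w i) * f (w (Suc n)))" if "i \<in> {1..n}" for i
    by (rule integrable_cross[OF L L]) (use that in auto)
  have i3: "integrable (stationary (Suc n)) (\<lambda>w. (f (w (Suc n)))\<^sup>2)"
    unfolding power2_eq_square by (rule integrable_cross[OF L L]) auto
  have i4: "integrable (stationary (Suc n)) (\<lambda>w. \<Sum>i=1..n. f (w i) * f (w (Suc n)))"
    by (rule Bochner_Integration.integrable_sum[OF i2])
  have isum: "(\<integral>w. (\<Sum>i=1..n. f (w i) * f (w (Suc n))) \<partial>stationary (Suc n)) = (\<Sum>i=1..n. \<integral>w. f (w i) * f (w (Suc n)) \<partial>stationary (Suc n))"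
    by (rule Bochner_Integration.integral_sum[OF i2])
  have e: "(\<Sum>i=1..Suc n. f (w i))\<^sup>2 = (?s w)\<^sup>2 + 2 * (\<Sum>i=1..n. f (w i) * f (w (Suc n))) + (f (w (Suc n)))\<^sup>2" for w
    by (simp add: power2_eq_square algebra_simps sum_distrib_right[symmetric])
  have "sum_var f (Suc n) = (\<integral>w. (?s w)\<^sup>2 \<partial>stationary (Suc n)) + 2 * (\<Sum>i=1..n. \<integral>w. f (w i) * f (w (Suc n)) \<partial>stationary (Suc n))
      + (\<integral>w. (f (w (Suc n)))\<^sup>2 \<partial>stationary (Suc n))"
    unfolding sum_var_def e isum[symmetric] using i1 i3 i4 by (simp del: One_nat_def)
  also have "(\<integral>w. (?s w)\<^sup>2 \<partial>stationary (Suc n)) = sum_var f n"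
    unfolding sum_var_def by (rule integral_stationary_prefix[OF n i1]) simp
  also have "(\<Sum>i=1..n. \<integral>w. f (w i) * f (w (Suc n)) \<partial>stationary (Suc n)) = (\<Sum>i=1..n. autocov f (Suc n - i))"
    unfolding autocov_def by (intro sum.cong refl autocovariance f) auto
  also have "(\<Sum>i=1..n. autocov f (Suc n - i)) = (\<Sum>k=1..n. autocov f k)"
    by (rule sum.reindex_bij_witness[of _ "\<lambda>k. Suc n - k" "\<lambda>k. Suc n - k"]) auto
  also have "(\<integral>w. (f (w (Suc n)))\<^sup>2 \<partial>stationary (Suc n)) = autocov f 0"
    unfolding autocov_0 by (rule integral_marginal_sq[OF L]) auto
  finally show ?thesis by simp
qed

lemma sum_var_eq_sum:
  assumes f: "centred f" and n: "1 \<le> n"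
  shows "sum_var f n = (\<Sum>m<n. autocov f 0 + 2 * (\<Sum>k=1..m. autocov f k))"
  using n
proof (induction n rule: dec_induct)
  case base then show ?case using sum_var_1[OF f] by simp
next
  case (step n) then show ?case using sum_var_Suc[OF f, of n] by simp
qed

lemma avg_var_eq_sum_var:
  assumes f: "f \<in> borel_measurable \<pi>" "integrable \<pi> (\<lambda>x. (f x)\<^sup>2)" and n: "1 \<le> n"
  defines "f0 \<equiv> \<lambda>x. f x - (\<integral>x. f x \<partial>\<pi>)"
  shows "centred f0" "avg_var \<pi> P f n = sum_var f0 n / n" "autocov f0 0 = var \<pi> f"
proof -
  have L: "L2 f" using f by (simp add: L2_def)
  have i: "integrable \<pi> f" by (rule L2_integrable[OF L])
  have [measurable]: "f \<in> borel_measurable \<pi>" by (rule f)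
  have e: "(f0 x)\<^sup>2 = (f x)\<^sup>2 - 2 * (\<integral>x. f x \<partial>\<pi>) * f x + (\<integral>x. f x \<partial>\<pi>)\<^sup>2" for x
    by (simp add: f0_def power2_eq_square algebra_simps)
  have L0: "L2 f0" unfolding L2_def e using f i by (simp add: f0_def)
  show c: "centred f0" using L0 i by (simp add: centred_def f0_def prob_space)
  show "autocov f0 0 = var \<pi> f"
    unfolding autocov_0 e var_def using f i by (simp add: prob_space power2_eq_square)
  have s: "(\<Sum>i=1..n. f (\<xi> i) - (\<integral>x. f x \<partial>\<pi>)) = (\<Sum>i=1..n. f0 (\<xi> i))" for \<xi> by (simp add: f0_def)
  have "(\<integral>w. (\<Sum>i=1..n. f0 (w i)) / sqrt (real n) \<partial>stationary n) = 0"
  proof -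
    have "(\<integral>w. (\<Sum>i=1..n. f0 (w i)) \<partial>stationary n) = (\<Sum>i=1..n. \<integral>w. f0 (w i) \<partial>stationary n)"
      by (rule Bochner_Integration.integral_sum) (use integrable_marginal L2_integrable[OF L0] in auto)
    also have "\<dots> = 0"
    proof (rule sum.neutral, rule)
      fix i assume "i \<in> {1..n}"
      then have "(\<integral>w. f0 (w i) \<partial>stationary n) = (\<integral>x. f0 x \<partial>\<pi>)"
        by (intro integral_marginal) (use L0 in \<open>auto simp: L2_def\<close>)
      then show "(\<integral>w. f0 (w i) \<partial>stationary n) = 0" using c by (simp add: centred_def)
    qed
    finally show ?thesis by simp
  qed
  then show "avg_var \<pi> P f n = sum_var f0 n / n"
    unfolding avg_var_def var_def s sum_var_def using n by (simp add: power_divide)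
qed

text \<open>The variance of the normalised sum of \<open>n\<close> terms is the average of the
  increments \<open>d\<^sub>0, \<dots>, d\<^bsub>n-1\<^esub>\<close> with \<open>d\<^sub>m =
  r\<^sub>0 + 2 (r\<^sub>1 + \<dots> + r\<^sub>m)\<close>, where \<open>r\<^sub>k\<close> is the
  autocovariance at lag \<open>k\<close>. As \<open>r\<^sub>k \<ge> 0\<close>, the
  \<open>d\<^sub>m\<close> increase from \<open>d\<^sub>0 = var(f)\<close>, so the averages increase
  and converge; as \<open>r\<^sub>k \<le> (1 - \<epsilon>)\<^sup>k r\<^sub>0\<close>, they never
  exceed \<open>(2 / \<epsilon> - 1) var(f)\<close>.\<close>

lemma asymptotic_variance:
  assumes f: "f \<in> borel_measurable \<pi>" "integrable \<pi> (\<lambda>x. (f x)\<^sup>2)"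
  shows "convergent (avg_var \<pi> P f)" "var \<pi> f \<le> asym_var \<pi> P f"
    "asym_var \<pi> P f \<le> (2 / \<epsilon> - 1) * var \<pi> f"
proof -
  define f0 where "f0 = (\<lambda>x. f x - (\<integral>x. f x \<partial>\<pi>))"
  note * = avg_var_eq_sum_var[OF f, folded f0_def]
  have c: "centred f0" using *(1)[of 1] by simp
  define d where "d = (\<lambda>m. autocov f0 0 + 2 * (\<Sum>k=1..m. autocov f0 k))"
  have dmono: "d m \<le> d n" if "m \<le> n" for m n
    unfolding d_def using autocov_bounds[OF c] that by (intro add_left_mono mult_left_mono sum_mono2) auto
  have var0: "0 \<le> autocov f0 0" by (rule autocov_bounds[OF c])
  have dub: "d m \<le> (2 / \<epsilon> - 1) * autocov f0 0" for m
  proof -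
    have "(\<Sum>k=1..m. (1 - \<epsilon>) ^ k) \<le> 1 / \<epsilon> - 1"
    proof -
      have split_first: "(\<Sum>k<Suc m. (1 - \<epsilon>) ^ k) = 1 + (\<Sum>k=1..m. (1 - \<epsilon>) ^ k)"
        by (induction m) auto
      have "(\<Sum>k<Suc m. (1 - \<epsilon>) ^ k) = (1 - (1 - \<epsilon>) ^ Suc m) / \<epsilon>"
        using eps by (subst sum_gp_strict) auto
      also have "\<dots> \<le> 1 / \<epsilon>" using eps by (intro divide_right_mono) auto
      finally show ?thesis unfolding split_first by simp
    qed
    then have "(\<Sum>k=1..m. (1 - \<epsilon>) ^ k) * autocov f0 0 \<le> (1 / \<epsilon> - 1) * autocov f0 0"
      using var0 by (rule mult_right_mono)
    moreover have "(\<Sum>k=1..m. autocov f0 k) \<le> (\<Sum>k=1..m. (1 - \<epsilon>) ^ k) * autocov f0 0"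
      unfolding sum_distrib_right by (intro sum_mono autocov_bounds[OF c])
    ultimately show ?thesis unfolding d_def by (simp add: algebra_simps)
  qed
  have a: "avg_var \<pi> P f (Suc n) = (\<Sum>m<Suc n. d m) / real (Suc n)" for n
    using *(2)[of "Suc n"] sum_var_eq_sum[OF c, of "Suc n"] by (simp add: d_def)
  have d0: "d 0 = autocov f0 0" by (simp add: d_def)
  have lb: "autocov f0 0 \<le> avg_var \<pi> P f (Suc n)" for n
  proof -
    have "real (Suc n) * autocov f0 0 = (\<Sum>m<Suc n. d 0)" by (simp add: d0)
    also have "\<dots> \<le> (\<Sum>m<Suc n. d m)" by (intro sum_mono dmono) simp
    finally show ?thesis unfolding a by (simp add: field_simps)
  qed
  have ub: "avg_var \<pi> P f (Suc n) \<le> (2 / \<epsilon> - 1) * autocov f0 0" for n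
  proof -
    have "(\<Sum>m<Suc n. d m) \<le> (\<Sum>m<Suc n. (2 / \<epsilon> - 1) * autocov f0 0)" by (intro sum_mono dub)
    also have "\<dots> = real (Suc n) * ((2 / \<epsilon> - 1) * autocov f0 0)" by simp
    finally show ?thesis unfolding a by (simp add: pos_divide_le_eq mult.commute)
  qed
  have "incseq (\<lambda>n. avg_var \<pi> P f (Suc n))"
  proof (rule incseq_SucI)
    fix n
    have "(\<Sum>m<Suc n. d m) \<le> (\<Sum>m<Suc n. d (Suc n))" by (intro sum_mono dmono) simp
    then have "(\<Sum>m<Suc n. d m) \<le> real (Suc n) * d (Suc n)" by simp
    then have "(\<Sum>m<Suc n. d m) * real (Suc (Suc n)) \<le> (\<Sum>m<Suc (Suc n). d m) * real (Suc n)"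
      by (simp add: algebra_simps)
    then show "avg_var \<pi> P f (Suc n) \<le> avg_var \<pi> P f (Suc (Suc n))"
      unfolding a by (subst frac_le_eq) (auto simp: divide_le_0_iff mult_ac)
  qed
  then obtain L where L: "(\<lambda>n. avg_var \<pi> P f (Suc n)) \<longlonglongrightarrow> L"
    using incseq_convergent[of "\<lambda>n. avg_var \<pi> P f (Suc n)"] ub by metis
  then have L': "avg_var \<pi> P f \<longlonglongrightarrow> L" by (rule LIMSEQ_imp_Suc)
  then show "convergent (avg_var \<pi> P f)" by (rule convergentI)
  have "asym_var \<pi> P f = L" unfolding asym_var_def by (rule limI[OF L'])
  moreover have "autocov f0 0 \<le> L" by (rule LIMSEQ_le_const[OF L]) (use lb in auto)
  moreover have "L \<le> (2 / \<epsilon> - 1) * autocov f0 0" by (rule LIMSEQ_le_const2[OF L]) (use ub in auto)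
  ultimately show "var \<pi> f \<le> asym_var \<pi> P f" "asym_var \<pi> P f \<le> (2 / \<epsilon> - 1) * var \<pi> f"
    using *(3)[of 1] by simp_all
qed

end

section \<open>Feynman-Kac semigroups\<close>

locale feynman_kac = markov_chain_model S M1 M
  for S M1 :: "'z measure" and M :: "nat \<Rightarrow> 'z \<Rightarrow> 'z measure" +
  fixes G :: "nat \<Rightarrow> 'z \<Rightarrow> real"
  assumes G_measurable: "\<And>t. 1 \<le> t \<Longrightarrow> G t \<in> borel_measurable S"
    and G_nonneg: "\<And>t z. 1 \<le> t \<Longrightarrow> z \<in> space S \<Longrightarrow> 0 \<le> G t z"
    and gam_pos: "\<And>T. 1 \<le> T \<Longrightarrow> 0 < gam S M1 M G T"
    and gam_fin: "\<And>T. 1 \<le> T \<Longrightarrow> gam S M1 M G T < \<infinity>"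
begin

definition g :: "nat \<Rightarrow> 'z \<Rightarrow> ennreal" where "g t z = ennreal (G t z)"

text \<open>The one-step operator \<open>Q\<^bsub>t,t+1\<^esub>\<close>.\<close>

definition fk_op :: "nat \<Rightarrow> ('z \<Rightarrow> ennreal) \<Rightarrow> 'z \<Rightarrow> ennreal" where
  "fk_op t f z = g t z * (\<integral>\<^sup>+y. f y \<partial>M (Suc t) z)"

abbreviation "QQ \<equiv> Q S M G"
abbreviation "\<Gamma> \<equiv> Q0 S M1 M G"
abbreviation "\<gamma> \<equiv> gam S M1 M G"
abbreviation "chain \<equiv> chain_law S M1 M"
abbreviation "tgt \<equiv> target S M1 M G"
abbreviation "ker \<equiv> icsmc S M1 M G"
abbreviation "histories \<equiv> csmc_space S"
abbreviation "hist \<equiv> csmc_hist S M1 M G"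
abbreviation "transition \<equiv> csmc_step S M G"

lemma g_measurable[measurable]: "1 \<le> t \<Longrightarrow> g t \<in> borel_measurable S"
  unfolding g_def using G_measurable by simp

lemma M_measurable: "1 \<le> t \<Longrightarrow> M (Suc t) \<in> S \<rightarrow>\<^sub>M subprob_algebra S"
  by (rule measurable_prob_algebraD[OF K]) simp

lemma nn_M_measurable: "1 \<le> t \<Longrightarrow> f \<in> borel_measurable S \<Longrightarrow> (\<lambda>z. \<integral>\<^sup>+y. f y \<partial>M (Suc t) z) \<in> borel_measurable S"
  by (rule measurable_compose[OF M_measurable nn_integral_measurable_subprob_algebra])

lemma fk_op_measurable: "1 \<le> t \<Longrightarrow> f \<in> borel_measurable S \<Longrightarrow> fk_op t f \<in> borel_measurable S"
  unfolding fk_op_def by (intro borel_measurable_times_ennreal g_measurable nn_M_measurable)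

lemma fk_op_cong:
  assumes "1 \<le> t" "z \<in> space S" "\<And>y. y \<in> space S \<Longrightarrow> f y = h y"
  shows "fk_op t f z = fk_op t h z"
proof -
  have "space (M (Suc t) z) = space S" using sets_K[of "Suc t" z] assms(1,2) by (intro sets_eq_imp_space_eq) simp
  then show ?thesis unfolding fk_op_def using assms(3) by (intro arg_cong2[where f="(*)"] nn_integral_cong) auto
qed

lemma fk_op_one: "1 \<le> t \<Longrightarrow> z \<in> space S \<Longrightarrow> fk_op t (\<lambda>_. 1) z = g t z"
  using prob_space.emeasure_space_1[OF prob_K[of "Suc t" z]] by (simp add: fk_op_def)

lemma Q_integrand_measurable:
  assumes p: "1 \<le> p" and f: "f \<in> borel_measurable S"
  shows "(\<lambda>w. f (w (p + n)) * (\<Prod>k\<in>{p..<p + n}. ennreal (G k (w k)))) \<in> borel_measurable (\<Pi>\<^sub>M t\<in>{p..p + n}. S)"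
proof (intro borel_measurable_times_ennreal borel_measurable_prod_ennreal)
  show "(\<lambda>w. f (w (p + n))) \<in> borel_measurable (\<Pi>\<^sub>M t\<in>{p..p + n}. S)"
    by (rule measurable_compose[of "\<lambda>w. w (p + n)" _ S, OF measurable_component_singleton f]) simp
  fix k assume k: "k \<in> {p..<p + n}"
  show "(\<lambda>w. ennreal (G k (w k))) \<in> borel_measurable (\<Pi>\<^sub>M t\<in>{p..p + n}. S)"
    by (rule measurable_compose[of "\<lambda>w. w k" _ S, OF measurable_component_singleton g_measurable[of k, unfolded g_def]])
      (use k p in auto)
qed

lemma Q_refl:
  assumes p: "1 \<le> p" and f: "f \<in> borel_measurable S" and z: "z \<in> space S"
  shows "QQ p p f z = f z"
  using Q_integrand_measurable[OF p f, of 0] z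
  by (simp add: Q_def, subst nn_integral_return) (auto simp: space_PiM)

lemma Q_Suc:
  assumes p: "1 \<le> p" "p \<le> q" and f: "f \<in> borel_measurable S" and z: "z \<in> space S"
  shows "QQ p (Suc q) f z = QQ p q (fk_op q f) z"
proof -
  obtain n where q: "q = p + n" using p(2) le_Suc_ex by blast
  have c: "chain_from S M p z n \<in> space (prob_algebra (\<Pi>\<^sub>M t\<in>{p..p + n}. S))" by (rule chain_from_prob[OF p(1) z])
  have s: "sets (chain_from S M p z n) = sets (\<Pi>\<^sub>M t\<in>{p..p + n}. S)" using c by (simp add: space_prob_algebra)
  have "QQ p (Suc q) f z = (\<integral>\<^sup>+w. f (w (p + Suc n)) * (\<Prod>k\<in>{p..<p + Suc n}. ennreal (G k (w k))) \<partial>chain_from S M p z (Suc n))"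
    by (simp add: Q_def q del: chain_from.simps)
  also have "\<dots> = (\<integral>\<^sup>+w. \<integral>\<^sup>+y. f y * (\<Prod>k\<in>{p..<Suc q}. ennreal (G k (w k))) \<partial>M (Suc q) (w q) \<partial>chain_from S M p z n)"
    unfolding nn_integral_chain_from_Suc[OF p(1) z Q_integrand_measurable[OF p(1) f]]
    by (simp add: q cong: prod.cong_simp)
  also have "\<dots> = (\<integral>\<^sup>+w. fk_op q f (w q) * (\<Prod>k\<in>{p..<q}. ennreal (G k (w k))) \<partial>chain_from S M p z n)"
  proof (rule nn_integral_cong)
    fix w assume "w \<in> space (chain_from S M p z n)"
    then have w: "w q \<in> space S" by (auto simp: sets_eq_imp_space_eq[OF s] space_PiM q)
    have s': "sets (M (Suc q) (w q)) = sets S" by (rule sets_K) (use p w in auto)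
    have m: "f \<in> borel_measurable (M (Suc q) (w q))"
      unfolding measurable_cong_sets[OF s' refl] by (rule f)
    show "(\<integral>\<^sup>+y. f y * (\<Prod>k\<in>{p..<Suc q}. ennreal (G k (w k))) \<partial>M (Suc q) (w q)) = fk_op q f (w q) * (\<Prod>k\<in>{p..<q}. ennreal (G k (w k)))"
      using p by (simp add: nn_integral_multc[OF m] fk_op_def g_def mult_ac)
  qed
  finally show ?thesis by (simp add: Q_def q)
qed

lemma Q_cong:
  assumes p: "1 \<le> p" "p \<le> q" and z: "z \<in> space S" and fh: "\<And>y. y \<in> space S \<Longrightarrow> f y = h y"
  shows "QQ p q f z = QQ p q h z"
proof -
  have c: "chain_from S M p z (q - p) \<in> space (prob_algebra (\<Pi>\<^sub>M t\<in>{p..p + (q - p)}. S))" by (rule chain_from_prob[OF p(1) z])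
  then have "sets (chain_from S M p z (q - p)) = sets (\<Pi>\<^sub>M t\<in>{p..q}. S)" using p by (simp add: space_prob_algebra)
  then have "w q \<in> space S" if "w \<in> space (chain_from S M p z (q - p))" for w
    using that p by (auto simp: space_PiM PiE_iff dest!: sets_eq_imp_space_eq)
  then show ?thesis unfolding Q_def by (intro nn_integral_cong) (simp add: fh)
qed

lemma Q_mono:
  assumes p: "1 \<le> p" "p \<le> q" and z: "z \<in> space S" and fh: "\<And>y. y \<in> space S \<Longrightarrow> f y \<le> h y"
  shows "QQ p q f z \<le> QQ p q h z"
proof -
  have c: "chain_from S M p z (q - p) \<in> space (prob_algebra (\<Pi>\<^sub>M t\<in>{p..p + (q - p)}. S))" by (rule chain_from_prob[OF p(1) z])
  then have "sets (chain_from S M p z (q - p)) = sets (\<Pi>\<^sub>M t\<in>{p..q}. S)" using p by (simp add: space_prob_algebra)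
  then have "w q \<in> space S" if "w \<in> space (chain_from S M p z (q - p))" for w
    using that p by (auto simp: space_PiM PiE_iff dest!: sets_eq_imp_space_eq)
  then show ?thesis unfolding Q_def by (intro nn_integral_mono mult_right_mono) (simp_all add: fh)
qed

lemma Q_integrand_measurable':
  assumes p: "1 \<le> p" "p \<le> q" and f: "f \<in> borel_measurable S" and z: "z \<in> space S"
  shows "(\<lambda>w. f (w q) * (\<Prod>k\<in>{p..<q}. ennreal (G k (w k)))) \<in> borel_measurable (chain_from S M p z (q - p))"
proof -
  have c: "chain_from S M p z (q - p) \<in> space (prob_algebra (\<Pi>\<^sub>M t\<in>{p..p + (q - p)}. S))" by (rule chain_from_prob[OF p(1) z])
  then have s: "sets (chain_from S M p z (q - p)) = sets (\<Pi>\<^sub>M t\<in>{p..p + (q - p)}. S)" by (simp add: space_prob_algebra)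
  show ?thesis
    unfolding measurable_cong_sets[OF s refl] using Q_integrand_measurable[OF p(1) f, of "q - p"] p by simp
qed

lemma Q_add:
  assumes p: "1 \<le> p" "p \<le> q" and f: "f \<in> borel_measurable S" "h \<in> borel_measurable S" and z: "z \<in> space S"
  shows "QQ p q (\<lambda>x. f x + h x) z = QQ p q f z + QQ p q h z"
  unfolding Q_def distrib_right
  by (rule nn_integral_add; rule Q_integrand_measurable'[OF p _ z]; fact)

lemma Q_cmult:
  assumes p: "1 \<le> p" "p \<le> q" and f: "f \<in> borel_measurable S" and z: "z \<in> space S"
  shows "QQ p q (\<lambda>x. c * f x) z = c * QQ p q f z"
  unfolding Q_def mult.assoc by (rule nn_integral_cmult[OF Q_integrand_measurable'[OF p f z]])

lemma Q_measurable:
  assumes p: "1 \<le> p" "p \<le> q" and f: "f \<in> borel_measurable S"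
  shows "QQ p q f \<in> borel_measurable S"
proof -
  have "(\<lambda>z. chain_from S M p z (q - p)) \<in> S \<rightarrow>\<^sub>M subprob_algebra (\<Pi>\<^sub>M t\<in>{p..p + (q - p)}. S)"
    by (rule measurable_prob_algebraD[OF measurable_chain_from[OF p(1)]])
  from measurable_compose[OF this nn_integral_measurable_subprob_algebra[OF Q_integrand_measurable[OF p(1) f]]]
  show ?thesis using p by (simp add: Q_def[abs_def])
qed

text \<open>The recursion in the lower index, obtained from the one in the upper index by
  induction.\<close>

lemma Q_first_step:
  assumes p: "1 \<le> p" "p < q" and f: "f \<in> borel_measurable S" and z: "z \<in> space S"
  shows "QQ p q f z = fk_op p (QQ (Suc p) q f) z"
proof -
  have "Suc p \<le> q" using p by simp
  then show ?thesis using f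
  proof (induction q arbitrary: f rule: dec_induct)
    case base
    have "QQ p (Suc p) f z = fk_op p f z"
      using p base z by (simp add: Q_Suc Q_refl fk_op_measurable)
    also have "\<dots> = fk_op p (QQ (Suc p) (Suc p) f) z"
      using p base z by (intro fk_op_cong) (auto simp: Q_refl)
    finally show ?case .
  next
    case (step q)
    have "QQ p (Suc q) f z = QQ p q (fk_op q f) z" using p step z by (intro Q_Suc) auto
    also have "\<dots> = fk_op p (QQ (Suc p) q (fk_op q f)) z" using p step by (intro step.IH fk_op_measurable) auto
    also have "\<dots> = fk_op p (QQ (Suc p) (Suc q) f) z"
      using p step z by (intro fk_op_cong) (auto simp: Q_Suc)
    finally show ?case .
  qed
qed

lemma Q_semigroup:
  assumes p: "1 \<le> p" "p \<le> q" "q \<le> r" and f: "f \<in> borel_measurable S" and z: "z \<in> space S"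
  shows "QQ p r f z = QQ p q (QQ q r f) z"
  using p(3) f
proof (induction r arbitrary: f rule: dec_induct)
  case base
  show ?case using p base z by (intro Q_cong) (auto simp: Q_refl)
next
  case (step r)
  have "QQ p (Suc r) f z = QQ p r (fk_op r f) z" using p step z by (intro Q_Suc) auto
  also have "\<dots> = QQ p q (QQ q r (fk_op r f)) z" using p step by (intro step.IH fk_op_measurable) auto
  also have "\<dots> = QQ p q (QQ q (Suc r) f) z"
    using p step z by (intro Q_cong) (auto simp: Q_Suc)
  finally show ?case .
qed

lemma M1_measurable_iff: "borel_measurable M1 = borel_measurable S"
  by (rule measurable_cong_sets[OF sets_\<mu> refl])

lemma \<Gamma>_Suc: "1 \<le> t \<Longrightarrow> f \<in> borel_measurable S \<Longrightarrow> \<Gamma> (Suc t) f = \<Gamma> t (fk_op t f)"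
  unfolding Q0_def by (rule nn_integral_cong) (simp add: Q_Suc space_\<mu>)

lemma \<Gamma>_1: "f \<in> borel_measurable S \<Longrightarrow> \<Gamma> 1 f = (\<integral>\<^sup>+z. f z \<partial>M1)"
  unfolding Q0_def by (rule nn_integral_cong) (simp add: Q_refl space_\<mu> del: One_nat_def)

lemma \<Gamma>_cong: "1 \<le> t \<Longrightarrow> (\<And>y. y \<in> space S \<Longrightarrow> f y = h y) \<Longrightarrow> \<Gamma> t f = \<Gamma> t h"
  unfolding Q0_def by (intro nn_integral_cong Q_cong) (auto simp: space_\<mu>)

lemma \<Gamma>_mono: "1 \<le> t \<Longrightarrow> (\<And>y. y \<in> space S \<Longrightarrow> f y \<le> h y) \<Longrightarrow> \<Gamma> t f \<le> \<Gamma> t h"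
  unfolding Q0_def by (intro nn_integral_mono Q_mono) (auto simp: space_\<mu>)

lemma \<Gamma>_add:
  assumes "1 \<le> t" "f \<in> borel_measurable S" "h \<in> borel_measurable S"
  shows "\<Gamma> t (\<lambda>x. f x + h x) = \<Gamma> t f + \<Gamma> t h"
proof -
  have "\<Gamma> t (\<lambda>x. f x + h x) = (\<integral>\<^sup>+z. QQ 1 t f z + QQ 1 t h z \<partial>M1)"
    unfolding Q0_def by (rule nn_integral_cong) (use assms in \<open>simp add: Q_add space_\<mu> del: One_nat_def\<close>)
  also have "\<dots> = \<Gamma> t f + \<Gamma> t h"
    unfolding Q0_def by (rule nn_integral_add) (use assms in \<open>auto simp: M1_measurable_iff intro: Q_measurable\<close>)
  finally show ?thesis .
qed

lemma \<Gamma>_cmult: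
  assumes "1 \<le> t" "f \<in> borel_measurable S"
  shows "\<Gamma> t (\<lambda>x. c * f x) = c * \<Gamma> t f"
proof -
  have "\<Gamma> t (\<lambda>x. c * f x) = (\<integral>\<^sup>+z. c * QQ 1 t f z \<partial>M1)"
    unfolding Q0_def by (rule nn_integral_cong) (use assms in \<open>simp add: Q_cmult space_\<mu> del: One_nat_def\<close>)
  also have "\<dots> = c * \<Gamma> t f"
    unfolding Q0_def by (rule nn_integral_cmult) (use assms in \<open>auto simp: M1_measurable_iff intro: Q_measurable\<close>)
  finally show ?thesis .
qed

lemma \<Gamma>_Q:
  assumes p: "1 \<le> p" "p \<le> q" and f: "f \<in> borel_measurable S"
  shows "\<Gamma> p (QQ p q f) = \<Gamma> q f"
  unfolding Q0_def
  by (rule nn_integral_cong) (rule Q_semigroup[symmetric], use p f in \<open>auto simp: space_\<mu>\<close>)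

lemma \<Gamma>_g: "1 \<le> t \<Longrightarrow> \<Gamma> t (g t) = \<Gamma> (Suc t) (\<lambda>_. 1)"
  using \<Gamma>_Suc[of t "\<lambda>_. 1"] \<Gamma>_cong[of t "fk_op t (\<lambda>_. 1)" "g t"] by (simp add: fk_op_one)

lemma gam_eq_\<Gamma>: assumes T: "1 \<le> T" shows "\<gamma> T = \<Gamma> T (g T)"
proof -
  have m: "(\<lambda>z. chain_from S M 1 z (T - 1)) \<in> M1 \<rightarrow>\<^sub>M subprob_algebra (\<Pi>\<^sub>M t\<in>{1..1 + (T - 1)}. S)"
    unfolding measurable_cong_sets[OF sets_\<mu> refl]
    by (rule measurable_prob_algebraD[OF measurable_chain_from]) simp
  have pr: "(\<Prod>t=1..T. ennreal (G t (w t))) = g T (w (1 + (T - 1))) * (\<Prod>k\<in>{1..<1 + (T - 1)}. ennreal (G k (w k)))" for w :: "nat \<Rightarrow> 'z"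
  proof -
    obtain n where n: "T = Suc n" using T by (cases T) auto
    show ?thesis by (simp add: n g_def atLeastLessThanSuc_atLeastAtMost mult.commute)
  qed
  show ?thesis
    unfolding gam_def chain_law_def pr Q0_def Q_def
    by (subst nn_integral_bind[OF Q_integrand_measurable m]) (use T in auto)
qed

text \<open>\<open>\<Gamma>\<^sub>t(1)\<close> is 1 for \<open>t = 1\<close> and
  \<open>\<gamma>\<^bsub>t-1\<^esub>\<close> afterwards.\<close>

lemma \<Gamma>_one_pos_fin: "1 \<le> t \<Longrightarrow> 0 < \<Gamma> t (\<lambda>_. 1) \<and> \<Gamma> t (\<lambda>_. 1) < \<infinity>"
proof (cases "t = 1")
  case True
  then show ?thesis using \<Gamma>_1[of "\<lambda>_. 1"] prob_space.emeasure_space_1[OF prob_\<mu>] by simp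
next
  case False
  assume "1 \<le> t"
  then obtain n where n: "t = Suc n" "1 \<le> n" using False by (cases t) auto
  then show ?thesis using gam_pos[of n] gam_fin[of n] gam_eq_\<Gamma>[of n] \<Gamma>_g[of n] by simp
qed

section \<open>Uniform domination of potentials\<close>

text \<open>Assumption (A1) cleared of denominators, so that no division by 0 or
  \<open>\<infinity>\<close> occurs.\<close>

definition stable :: "ennreal \<Rightarrow> bool" where
  "stable \<alpha> \<longleftrightarrow> (\<forall>p\<ge>1. \<forall>q>p. \<forall>z\<in>space S. QQ p q (\<lambda>_. 1) z * \<Gamma> p (\<lambda>_. 1) \<le> \<alpha> * \<Gamma> q (\<lambda>_. 1))"

text \<open>A function \<open>f\<close> of the state at time \<open>t\<close> is dominated if its
  expected unnormalised value, seen from any state at any time \<open>p \<le> t\<close>, is at most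
  \<open>\<alpha>\<close> times the value seen from the law \<open>\<eta>\<^sub>p\<close>. These
  functions form a convex cone that is mapped into itself by the backward operators
  \<open>fk_op\<close>; stability says that it contains the potentials.\<close>

definition dominated :: "ennreal \<Rightarrow> nat \<Rightarrow> ('z \<Rightarrow> ennreal) \<Rightarrow> bool" where
  "dominated \<alpha> t f \<longleftrightarrow> f \<in> borel_measurable S \<and>
     (\<forall>p\<in>{1..t}. \<forall>z\<in>space S. QQ p t f z * \<Gamma> p (\<lambda>_. 1) \<le> \<alpha> * \<Gamma> t f)"

text \<open>The case \<open>p = t\<close> of domination: the supremum of \<open>f\<close> is at most
  \<open>\<alpha>\<close> times its mean under \<open>\<eta>\<^sub>t\<close>.\<close>

lemma dominated_bound:
  assumes "1 \<le> t" "dominated \<alpha> t f" "z \<in> space S"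
  shows "f z \<le> \<alpha> * \<Gamma> t f / \<Gamma> t (\<lambda>_. 1)"
proof -
  have "f z * \<Gamma> t (\<lambda>_. 1) \<le> \<alpha> * \<Gamma> t f"
    using assms by (force simp: dominated_def Q_refl)
  then show ?thesis using \<Gamma>_one_pos_fin[OF assms(1)]
    by (metis ennreal_mult_divide_eq divide_right_mono_ennreal infinity_ennreal_def less_irrefl)
qed

lemma dominated_g:
  assumes "stable \<alpha>" "1 \<le> t"
  shows "dominated \<alpha> t (g t)"
proof -
  have "QQ p t (g t) z = QQ p (Suc t) (\<lambda>_. 1) z" if "p \<in> {1..t}" "z \<in> space S" for p z
    using that Q_Suc[of p t "\<lambda>_. 1" z] Q_cong[of p t z "fk_op t (\<lambda>_. 1)" "g t"] by (simp add: fk_op_one)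
  then show ?thesis using assms by (auto simp: dominated_def stable_def \<Gamma>_g)
qed

lemma dominated_fk_op:
  assumes "dominated \<alpha> (Suc t) f" "1 \<le> t"
  shows "dominated \<alpha> t (fk_op t f)"
proof -
  have f: "f \<in> borel_measurable S" using assms by (simp add: dominated_def)
  have "QQ p t (fk_op t f) z = QQ p (Suc t) f z" if "p \<in> {1..t}" "z \<in> space S" for p z
    using that f by (simp add: Q_Suc)
  then show ?thesis using assms f by (auto simp: dominated_def \<Gamma>_Suc intro: fk_op_measurable)
qed

lemma dominated_add:
  assumes "dominated \<alpha> t f" "dominated \<alpha> t h" "1 \<le> t"
  shows "dominated \<alpha> t (\<lambda>x. f x + h x)"
  using assms by (auto simp: dominated_def Q_add \<Gamma>_add distrib_left distrib_right intro!: add_mono)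

lemma dominated_cmult:
  assumes "dominated \<alpha> t f" "1 \<le> t"
  shows "dominated \<alpha> t (\<lambda>x. c * f x)"
  using assms by (auto simp: dominated_def Q_cmult \<Gamma>_cmult mult.left_commute[of \<alpha>] mult.assoc intro!: mult_left_mono)

lemma stable_A1:
  assumes A1: "\<forall>p\<ge>1. \<forall>k\<ge>1. (SUP z\<in>space S. QQ p (p + k) (\<lambda>_. 1) z
             / eta S M1 M G p (QQ p (p + k) (\<lambda>_. 1))) \<le> \<alpha>"
  shows "stable \<alpha>"
  unfolding stable_def
proof (intro allI impI ballI)
  fix p q :: nat and z assume p: "1 \<le> p" "p < q" and z: "z \<in> space S"
  then obtain k where q: "q = p + k" and k: "1 \<le> k" using less_imp_add_positive[of p q] by auto
  let ?a = "QQ p q (\<lambda>_. 1) z" and ?b = "\<Gamma> p (\<lambda>_. 1)" and ?c = "\<Gamma> q (\<lambda>_. 1)"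
  have b: "0 < ?b" "?b < \<infinity>" and c: "0 < ?c" "?c < \<infinity>" using \<Gamma>_one_pos_fin[of p] \<Gamma>_one_pos_fin[of q] p by auto
  have "?a / (?c / ?b) \<le> \<alpha>"
    using A1[rule_format, OF p(1) k] z p unfolding q[symmetric] eta_def
    by (simp add: \<Gamma>_Q SUP_le_iff)
  then have "?a / (?c / ?b) * (?c / ?b) * ?b \<le> \<alpha> * (?c / ?b) * ?b" by (intro mult_right_mono) auto
  moreover have "?c / ?b * ?b = ?c" using b by (simp add: ennreal_divide_times)
  moreover have "?a / (?c / ?b) * (?c / ?b) = ?a"
  proof -
    have "?c / ?b \<noteq> 0" "?c / ?b < top"
      using b c by (auto simp: ennreal_divide_eq_0_iff less_top[symmetric] ennreal_divide_eq_top_iff)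
    then show ?thesis by (simp add: ennreal_divide_times)
  qed
  ultimately show "?a * ?b \<le> \<alpha> * ?c" by (simp add: mult.assoc)
qed

text \<open>If \<open>Q\<^bsub>p,q\<^esub>(1)\<close> at one state is at most
  \<open>\<alpha>\<close> times its value at any other, then it is at most \<open>\<alpha>\<close>
  times any of its averages.\<close>

lemma stable_ratio:
  assumes "\<And>p q z z'. 1 \<le> p \<Longrightarrow> p < q \<Longrightarrow> z \<in> space S \<Longrightarrow> z' \<in> space S \<Longrightarrow>
    QQ p q (\<lambda>_. 1) z \<le> \<alpha> * QQ p q (\<lambda>_. 1) z'"
  shows "stable \<alpha>"
  unfolding stable_def
proof (intro allI impI ballI)
  fix p q :: nat and z assume p: "1 \<le> p" "p < q" and z: "z \<in> space S"
  have "QQ p q (\<lambda>_. 1) z * \<Gamma> p (\<lambda>_. 1) = \<Gamma> p (\<lambda>x. QQ p q (\<lambda>_. 1) z * 1)"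
    using p by (subst \<Gamma>_cmult) auto
  also have "\<dots> \<le> \<Gamma> p (\<lambda>x. \<alpha> * QQ p q (\<lambda>_. 1) x)"
    using p z assms by (intro \<Gamma>_mono) auto
  also have "\<dots> = \<alpha> * \<Gamma> q (\<lambda>_. 1)"
    using p by (subst \<Gamma>_cmult) (auto simp: \<Gamma>_Q intro: Q_measurable)
  finally show "QQ p q (\<lambda>_. 1) z * \<Gamma> p (\<lambda>_. 1) \<le> \<alpha> * \<Gamma> q (\<lambda>_. 1)" .
qed

lemma Mbar_measurable: "1 \<le> n \<Longrightarrow> 1 \<le> p \<Longrightarrow> Mbar M n p \<in> S \<rightarrow>\<^sub>M prob_algebra S"
proof (induction n arbitrary: p rule: dec_induct)
  case base then show ?case using K[of "Suc p"] by simp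
next
  case (step n)
  have "(\<lambda>z. bind (M (Suc p) z) (Mbar M n (Suc p))) \<in> S \<rightarrow>\<^sub>M prob_algebra S"
    by (rule measurable_bind_prob_space[OF K step.IH]) (use step in auto)
  then show ?case using step by simp
qed

lemma Mbar_Suc_nn:
  assumes "1 \<le> n" "1 \<le> p" "z \<in> space S" "f \<in> borel_measurable S"
  shows "(\<integral>\<^sup>+y. f y \<partial>Mbar M (Suc n) p z) = (\<integral>\<^sup>+x. \<integral>\<^sup>+y. f y \<partial>Mbar M n (Suc p) x \<partial>M (Suc p) z)"
proof -
  have s: "sets (M (Suc p) z) = sets S" using assms by (intro sets_K) auto
  have "Mbar M n (Suc p) \<in> M (Suc p) z \<rightarrow>\<^sub>M subprob_algebra S"
    unfolding measurable_cong_sets[OF s refl] by (rule measurable_prob_algebraD[OF Mbar_measurable]) (use assms in auto)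
  from nn_integral_bind[OF assms(4) this] show ?thesis using assms(1) by simp
qed

text \<open>Replacing each of the \<open>n\<close> potentials by its value at a fixed reference
  state changes it by a factor of at most \<open>d\<close> in either direction, and the semigroup
  without potentials is the \<open>n\<close>-step kernel. The constant \<open>c\<close> is the
  product of the reference values; it depends on neither \<open>f\<close> nor
  \<open>z\<close>.\<close>

lemma Q_compare_Mbar:
  assumes d: "\<And>p z z'. 1 \<le> p \<Longrightarrow> z \<in> space S \<Longrightarrow> z' \<in> space S \<Longrightarrow> g p z \<le> d * g p z'"
    and n: "1 \<le> n" and p: "1 \<le> p"
  shows "\<exists>c. \<forall>f\<in>borel_measurable S. \<forall>z\<in>space S.
    QQ p (p + n) f z \<le> d ^ n * (c * (\<integral>\<^sup>+y. f y \<partial>Mbar M n p z)) \<and>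
    c * (\<integral>\<^sup>+y. f y \<partial>Mbar M n p z) \<le> d ^ n * QQ p (p + n) f z"
  using n p
proof (induction n arbitrary: p rule: dec_induct)
  case base
  obtain y0 where y0: "y0 \<in> space S" using ne_S by blast
  have "QQ p (p + 1) f z = g p z * (\<integral>\<^sup>+y. f y \<partial>M (Suc p) z)" if "f \<in> borel_measurable S" "z \<in> space S" for f z
    using that base by (simp add: Q_Suc Q_refl fk_op_measurable) (simp add: fk_op_def)
  then show ?case using d[OF base _ y0] d[OF base y0]
    by (intro exI[of _ "g p y0"]) (auto simp: mult.assoc[symmetric] intro!: mult_right_mono)
next
  case (step n)
  obtain y0 where y0: "y0 \<in> space S" using ne_S by blast
  obtain c where c: "\<And>f z. f \<in> borel_measurable S \<Longrightarrow> z \<in> space S \<Longrightarrow>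
    QQ (Suc p) (Suc p + n) f z \<le> d ^ n * (c * (\<integral>\<^sup>+y. f y \<partial>Mbar M n (Suc p) z)) \<and>
    c * (\<integral>\<^sup>+y. f y \<partial>Mbar M n (Suc p) z) \<le> d ^ n * QQ (Suc p) (Suc p + n) f z"
    using step.IH[of "Suc p"] by (meson le_SucI le_numeral_extra(4) step.prems)
  show ?case
  proof (intro exI[of _ "g p y0 * c"] ballI)
    fix f :: "'z \<Rightarrow> ennreal" and z assume f: "f \<in> borel_measurable S" and z: "z \<in> space S"
    have s: "sets (M (Suc p) z) = sets S" using step z by (intro sets_K) auto
    note sp = sets_eq_imp_space_eq[OF s]
    have q: "QQ p (p + Suc n) f z = g p z * (\<integral>\<^sup>+y. QQ (Suc p) (Suc p + n) f y \<partial>M (Suc p) z)"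
      using Q_first_step[of p "p + Suc n" f z] step f z by (simp add: fk_op_def)
    have m: "(\<integral>\<^sup>+y. f y \<partial>Mbar M (Suc n) p z) = (\<integral>\<^sup>+x. \<integral>\<^sup>+y. f y \<partial>Mbar M n (Suc p) x \<partial>M (Suc p) z)"
      by (rule Mbar_Suc_nn) (use step f z in auto)
    have mm: "(\<lambda>x. \<integral>\<^sup>+y. f y \<partial>Mbar M n (Suc p) x) \<in> borel_measurable (M (Suc p) z)"
      unfolding measurable_cong_sets[OF s refl]
      by (rule measurable_compose[OF measurable_prob_algebraD[OF Mbar_measurable] nn_integral_measurable_subprob_algebra[OF f]])
        (use step in auto)
    have qm: "QQ (Suc p) (Suc p + n) f \<in> borel_measurable (M (Suc p) z)"
      unfolding measurable_cong_sets[OF s refl] by (rule Q_measurable) (use f in auto)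
    have "(\<integral>\<^sup>+y. QQ (Suc p) (Suc p + n) f y \<partial>M (Suc p) z) \<le> (\<integral>\<^sup>+x. d ^ n * (c * (\<integral>\<^sup>+y. f y \<partial>Mbar M n (Suc p) x)) \<partial>M (Suc p) z)"
      using c[OF f] by (intro nn_integral_mono) (auto simp: sp)
    also have "\<dots> = d ^ n * (c * (\<integral>\<^sup>+y. f y \<partial>Mbar M (Suc n) p z))"
      unfolding m using mm by (subst nn_integral_cmult, simp)+ simp
    finally have u: "(\<integral>\<^sup>+y. QQ (Suc p) (Suc p + n) f y \<partial>M (Suc p) z) \<le> d ^ n * (c * (\<integral>\<^sup>+y. f y \<partial>Mbar M (Suc n) p z))" .
    have "c * (\<integral>\<^sup>+y. f y \<partial>Mbar M (Suc n) p z) = (\<integral>\<^sup>+x. c * (\<integral>\<^sup>+y. f y \<partial>Mbar M n (Suc p) x) \<partial>M (Suc p) z)"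
      unfolding m using mm by (rule nn_integral_cmult[symmetric])
    also have "\<dots> \<le> (\<integral>\<^sup>+y. d ^ n * QQ (Suc p) (Suc p + n) f y \<partial>M (Suc p) z)"
      using c[OF f] by (intro nn_integral_mono) (auto simp: sp)
    also have "\<dots> = d ^ n * (\<integral>\<^sup>+y. QQ (Suc p) (Suc p + n) f y \<partial>M (Suc p) z)"
      using qm by (rule nn_integral_cmult)
    finally have l: "c * (\<integral>\<^sup>+y. f y \<partial>Mbar M (Suc n) p z) \<le> d ^ n * (\<integral>\<^sup>+y. QQ (Suc p) (Suc p + n) f y \<partial>M (Suc p) z)" .
    have "QQ p (p + Suc n) f z \<le> (d * g p y0) * (d ^ n * (c * (\<integral>\<^sup>+y. f y \<partial>Mbar M (Suc n) p z)))"
      unfolding q by (rule mult_mono[OF d[OF step.prems z y0] u]) auto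
    moreover have "g p y0 * (c * (\<integral>\<^sup>+y. f y \<partial>Mbar M (Suc n) p z)) \<le> (d * g p z) * (d ^ n * (\<integral>\<^sup>+y. QQ (Suc p) (Suc p + n) f y \<partial>M (Suc p) z))"
      by (rule mult_mono[OF d[OF step.prems y0 z] l]) auto
    ultimately show "QQ p (p + Suc n) f z \<le> d ^ Suc n * (g p y0 * c * (\<integral>\<^sup>+y. f y \<partial>Mbar M (Suc n) p z)) \<and>
      g p y0 * c * (\<integral>\<^sup>+y. f y \<partial>Mbar M (Suc n) p z) \<le> d ^ Suc n * QQ p (p + Suc n) f z"
      unfolding q by (simp add: mult_ac)
  qed
qed

text \<open>Two states are compared over \<open>m\<close> steps: freeze the \<open>m\<close>
  potentials (a factor \<open>d\<^sup>m\<close>), exchange the starting states in the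
  \<open>m\<close>-step kernel (a factor \<open>\<beta>\<close>), and restore the potentials (again
  \<open>d\<^sup>m\<close>). After time \<open>p + m\<close> both sides involve the same function
  \<open>Q\<^bsub>p+m,q\<^esub>(1)\<close>. If \<open>q < p + m\<close>, all potentials are frozen
  and the kernel integrates the constant 1.\<close>

lemma stable_A2:
  assumes m: "1 \<le> m" and \<beta>: "1 \<le> \<beta>" and d: "1 \<le> d"
    and mix: "\<And>p z z' A. 1 \<le> p \<Longrightarrow> z \<in> space S \<Longrightarrow> z' \<in> space S \<Longrightarrow> A \<in> sets S \<Longrightarrow>
        measure (Mbar M m p z) A \<le> \<beta> * measure (Mbar M m p z') A"
    and osc: "\<And>p z z'. 1 \<le> p \<Longrightarrow> z \<in> space S \<Longrightarrow> z' \<in> space S \<Longrightarrow> G p z \<le> d * G p z'"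
  shows "stable (ennreal (\<beta> * d ^ (2 * m)))"
proof (rule stable_ratio)
  fix p q :: nat and z z' assume p: "1 \<le> p" "p < q" and z: "z \<in> space S" "z' \<in> space S"
  let ?d = "ennreal d"
  have osc': "g p z \<le> ?d * g p z'" if "1 \<le> p" "z \<in> space S" "z' \<in> space S" for p z z'
    using osc[OF that] G_nonneg that d by (auto simp: g_def ennreal_mult[symmetric] intro!: ennreal_leI)
  have d1: "1 \<le> ?d" and \<beta>1: "1 \<le> ennreal \<beta>" using d \<beta> by (simp_all add: ennreal_1[symmetric] del: ennreal_1)
  have e: "ennreal (\<beta> * d ^ (2 * m)) = ennreal \<beta> * (?d ^ m * ?d ^ m)"
    using d \<beta> by (simp add: ennreal_mult ennreal_power mult_2 power_add)
  show "QQ p q (\<lambda>_. 1) z \<le> ennreal (\<beta> * d ^ (2 * m)) * QQ p q (\<lambda>_. 1) z'"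
  \<comment> \<open>Fewer than \<open>m\<close> steps leave no room for the mixing condition, but also
    nothing after them to compare.\<close>
  proof (cases "q < p + m")
    case True
    define k where "k = q - p"
    have k: "q = p + k" "1 \<le> k" "k \<le> m" using p True by (auto simp: k_def)
    obtain c where c: "\<And>f z. f \<in> borel_measurable S \<Longrightarrow> z \<in> space S \<Longrightarrow>
      QQ p q f z \<le> ?d ^ k * (c * (\<integral>\<^sup>+y. f y \<partial>Mbar M k p z)) \<and>
      c * (\<integral>\<^sup>+y. f y \<partial>Mbar M k p z) \<le> ?d ^ k * QQ p q f z"
      using Q_compare_Mbar[of ?d k p] osc' k p by metis
    have one: "emeasure (Mbar M k p z) (space (Mbar M k p z)) = 1" if "z \<in> space S" for z
      using measurable_space[OF Mbar_measurable[OF k(2) p(1)] that] prob_space.emeasure_space_1[of "Mbar M k p z"]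
      by (simp add: space_prob_algebra)
    have "QQ p q (\<lambda>_. 1) z \<le> ?d ^ k * c" using c[of "\<lambda>_. 1" z] z by (simp add: one)
    also have "\<dots> \<le> ?d ^ k * (?d ^ k * QQ p q (\<lambda>_. 1) z')"
      using c[of "\<lambda>_. 1" z'] z by (intro mult_left_mono) (auto simp: one)
    also have "\<dots> \<le> ennreal \<beta> * (?d ^ m * ?d ^ m) * QQ p q (\<lambda>_. 1) z'"
    proof -
      have "1 * (?d ^ k * ?d ^ k) \<le> ennreal \<beta> * (?d ^ m * ?d ^ m)"
        using d1 \<beta>1 k by (intro mult_mono power_increasing) auto
      then show ?thesis by (metis mult.assoc mult_1 mult_right_mono zero_le)
    qed
    finally show ?thesis by (simp only: e)
  next
    case False
    then have q: "p \<le> p + m" "p + m \<le> q" by auto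
    let ?h = "QQ (p + m) q (\<lambda>_. 1)"
    have h: "?h \<in> borel_measurable S" using p q by (intro Q_measurable) auto
    have Qh: "QQ p q (\<lambda>_. 1) z = QQ p (p + m) ?h z" if "z \<in> space S" for z
      using p q that by (intro Q_semigroup) auto
    obtain c where c: "\<And>f z. f \<in> borel_measurable S \<Longrightarrow> z \<in> space S \<Longrightarrow>
      QQ p (p + m) f z \<le> ?d ^ m * (c * (\<integral>\<^sup>+y. f y \<partial>Mbar M m p z)) \<and>
      c * (\<integral>\<^sup>+y. f y \<partial>Mbar M m p z) \<le> ?d ^ m * QQ p (p + m) f z"
      using Q_compare_Mbar[of ?d m p] osc' m p by metis
    have mb: "Mbar M m p z \<in> space (prob_algebra S)" if "z \<in> space S" for z
      by (rule measurable_space[OF Mbar_measurable[OF m p(1)] that])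
    have mixh: "(\<integral>\<^sup>+y. ?h y \<partial>Mbar M m p z) \<le> ennreal \<beta> * (\<integral>\<^sup>+y. ?h y \<partial>Mbar M m p z')"
    proof -
      have pr: "prob_space (Mbar M m p z)" "prob_space (Mbar M m p z')"
        and s: "sets (Mbar M m p z) = sets S" "sets (Mbar M m p z') = sets S"
        using mb[OF z(1)] mb[OF z(2)] by (simp_all add: space_prob_algebra)
      have "?h \<in> borel_measurable (Mbar M m p z')" unfolding measurable_cong_sets[OF s(2) refl] by (rule h)
      then show ?thesis
        using cmult_nn_integral_le_cmult[OF pr, of \<beta> 1 ?h] mix \<open>1 \<le> p\<close> z \<beta> s by simp
    qed
    have "QQ p q (\<lambda>_. 1) z \<le> ?d ^ m * (c * (ennreal \<beta> * (\<integral>\<^sup>+y. ?h y \<partial>Mbar M m p z')))"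
      unfolding Qh[OF z(1)] using c[OF h z(1)] mixh
      by (meson mult_left_mono order_trans zero_le)
    also have "\<dots> = ?d ^ m * ennreal \<beta> * (c * (\<integral>\<^sup>+y. ?h y \<partial>Mbar M m p z'))" by (simp add: mult_ac)
    also have "\<dots> \<le> ?d ^ m * ennreal \<beta> * (?d ^ m * QQ p (p + m) ?h z')"
      using c[OF h z(2)] by (intro mult_left_mono) auto
    also have "\<dots> = ennreal \<beta> * (?d ^ m * ?d ^ m) * QQ p q (\<lambda>_. 1) z'"
      unfolding Qh[OF z(2)] by (simp add: mult_ac)
    finally show ?thesis by (simp only: e)
  qed
qed

end

section \<open>Independent samples with one tagged component\<close>

text \<open>Jensen's inequality for \<open>y \<mapsto> 1 / y\<close> on \<open>[0,
  \<infinity>]\<close>, by integrating the tangent line of \<open>1 / y\<close> at the mean.\<close>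

lemma (in prob_space) inverse_nn_integral_le:
  assumes b[measurable]: "b \<in> borel_measurable M"
  shows "inverse (\<integral>\<^sup>+x. b x \<partial>M) \<le> (\<integral>\<^sup>+x. inverse (b x) \<partial>M)"
proof -
  define m where "m = (\<integral>\<^sup>+x. b x \<partial>M)"
  consider "m = 0" | "m = \<infinity>" | r where "m = ennreal r" "0 < r"
    by (cases m) (auto simp: less_le)
  then show ?thesis
  proof cases
    case 1
    then have ae: "AE x in M. b x = 0" using nn_integral_0_iff_AE[OF b] by (simp add: m_def)
    have "(\<integral>\<^sup>+x. inverse (b x) \<partial>M) = (\<integral>\<^sup>+x. \<infinity> \<partial>M)"
      by (intro nn_integral_cong_AE) (use ae in \<open>eventually_elim, simp\<close>)
    then show ?thesis by (simp add: emeasure_space_1)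
  next
    case 2
    then show ?thesis by (simp add: m_def)
  next
    case (3 r)
    \<comment> \<open>The tangent to \<open>1 / y\<close> at \<open>y = r\<close>, with its negative
      slope moved to the other side.\<close>
    have tangent: "ennreal (2 / r) \<le> inverse y + ennreal (1 / r\<^sup>2) * y" for y :: ennreal
    proof (cases y)
      case (real t)
      show ?thesis
      proof (cases "t = 0")
        case False
        then have t: "0 < t" using real by simp
        have "0 \<le> (t - r)\<^sup>2 / (t * r\<^sup>2)" using t 3 by simp
        also have "\<dots> = 1 / t + 1 / r\<^sup>2 * t - 2 / r"
          using t 3 by (simp add: power2_eq_square field_simps)
        finally have "2 / r \<le> 1 / t + 1 / r\<^sup>2 * t" by simp
        then have "ennreal (2 / r) \<le> ennreal (1 / t + 1 / r\<^sup>2 * t)" by (rule ennreal_leI)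
        also have "\<dots> = inverse y + ennreal (1 / r\<^sup>2) * y"
          using real t 3 by (simp add: inverse_ennreal ennreal_mult[symmetric] inverse_eq_divide flip: ennreal_plus)
        finally show ?thesis .
      qed (simp add: real)
    qed (use 3 in \<open>simp add: ennreal_mult_top\<close>)
    have "ennreal (2 / r) = (\<integral>\<^sup>+x. ennreal (2 / r) \<partial>M)" by (simp add: emeasure_space_1)
    also have "\<dots> \<le> (\<integral>\<^sup>+x. inverse (b x) + ennreal (1 / r\<^sup>2) * b x \<partial>M)"
      by (intro nn_integral_mono tangent)
    also have "\<dots> = (\<integral>\<^sup>+x. inverse (b x) \<partial>M) + ennreal (1 / r\<^sup>2) * m"
      by (simp add: nn_integral_add nn_integral_cmult m_def)
    also have "ennreal (1 / r\<^sup>2) * m = ennreal (1 / r)"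
      using 3 by (simp add: ennreal_mult[symmetric] power2_eq_square)
    finally have "ennreal (1 / r) + ennreal (1 / r) \<le> (\<integral>\<^sup>+x. inverse (b x) \<partial>M) + ennreal (1 / r)"
      using 3 by (simp flip: ennreal_plus)
    then have "ennreal (1 / r) + ennreal (1 / r) \<le> ennreal (1 / r) + (\<integral>\<^sup>+x. inverse (b x) \<partial>M)"
      by (simp only: add.commute)
    then have "ennreal (1 / r) \<le> (\<integral>\<^sup>+x. inverse (b x) \<partial>M)"
      by (simp only: ennreal_add_left_cancel_le) auto
    then show ?thesis using 3 by (simp add: m_def[symmetric] inverse_ennreal inverse_eq_divide)
  qed
qed

lemma ennreal_inverse_antimono: "a \<le> b \<Longrightarrow> inverse b \<le> inverse (a :: ennreal)"
proof (cases "a = 0 \<or> b = top")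
  case False
  assume "a \<le> b"
  then obtain r q where "a = ennreal r" "b = ennreal q" "0 < r" "r \<le> q"
    using False by (cases a; cases b) (auto simp: less_le top_unique)
  then show ?thesis by (simp add: inverse_ennreal le_imp_inverse_le)
qed auto

text \<open>A finite product of kernels is a kernel; measurability need only be checked on boxes,
  where the product measure is a product of values of the factors.\<close>

lemma measurable_PiM_kernel:
  assumes I: "finite I" and \<kappa>: "\<And>i. i \<in> I \<Longrightarrow> \<kappa> i \<in> M \<rightarrow>\<^sub>M prob_algebra (N i)"
  shows "(\<lambda>x. \<Pi>\<^sub>M i\<in>I. \<kappa> i x) \<in> M \<rightarrow>\<^sub>M prob_algebra (\<Pi>\<^sub>M i\<in>I. N i)"
proof (rule measurable_prob_algebra_generated[OF sets_PiM Int_stable_prod_algebra prod_algebra_sets_into_space])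
  have k: "prob_space (\<kappa> i x) \<and> sets (\<kappa> i x) = sets (N i)" if "i \<in> I" "x \<in> space M" for i x
    using measurable_space[OF \<kappa>[OF that(1)] that(2)] by (simp add: space_prob_algebra)
  show "prob_space (\<Pi>\<^sub>M i\<in>I. \<kappa> i x)" if "x \<in> space M" for x
    using k that by (intro prob_space_PiM) auto
  show "sets (\<Pi>\<^sub>M i\<in>I. \<kappa> i x) = sets (\<Pi>\<^sub>M i\<in>I. N i)" if "x \<in> space M" for x
    using k that by (intro sets_PiM_cong) auto
  fix A assume "A \<in> prod_algebra I N"
  then obtain J X where A: "A = prod_emb I N J (Pi\<^sub>E J X)" "finite J" "J \<subseteq> I" "\<And>i. i \<in> J \<Longrightarrow> X i \<in> sets (N i)"
    using I by (auto elim!: prod_algebraE)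
  have "emeasure (\<Pi>\<^sub>M i\<in>I. \<kappa> i x) A = (\<Prod>i\<in>J. emeasure (\<kappa> i x) (X i))" if x: "x \<in> space M" for x
  proof -
    have "A = prod_emb I (\<lambda>i. \<kappa> i x) J (Pi\<^sub>E J X)"
      unfolding A(1) prod_emb_def using k[OF _ x] by (auto dest!: sets_eq_imp_space_eq cong: PiE_cong)
    then show ?thesis using A k x by (subst emeasure_PiM_emb[symmetric]) auto
  qed
  moreover have "(\<lambda>x. \<Prod>i\<in>J. emeasure (\<kappa> i x) (X i)) \<in> borel_measurable M"
  proof (rule borel_measurable_prod_ennreal)
    fix i assume i: "i \<in> J"
    show "(\<lambda>x. emeasure (\<kappa> i x) (X i)) \<in> borel_measurable M"
      by (rule measurable_compose[OF measurable_prob_algebraD[OF \<kappa>] measurable_emeasure_subprob_algebra])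
        (use A i in auto)
  qed
  ultimately show "(\<lambda>x. emeasure (\<Pi>\<^sub>M i\<in>I. \<kappa> i x) A) \<in> borel_measurable M"
    by (simp cong: measurable_cong)
qed

text \<open>The law of one generation of particles given the previous one: component 1 is the
  reference, the others are a sample from the selection-mutation law.\<close>

definition tagged_iid :: "nat \<Rightarrow> 'a measure \<Rightarrow> 'a measure \<Rightarrow> (nat \<Rightarrow> 'a) measure" where
  "tagged_iid N \<rho> \<nu> = (\<Pi>\<^sub>M i\<in>{1..N}. if i = 1 then \<rho> else \<nu>)"

lemma tagged_iid_prob:
  assumes "\<rho> \<in> space (prob_algebra E)" "\<nu> \<in> space (prob_algebra E)"
  shows "tagged_iid N \<rho> \<nu> \<in> space (prob_algebra (\<Pi>\<^sub>M i\<in>{1..N}. E))"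
proof -
  have "prob_space (tagged_iid N \<rho> \<nu>)" unfolding tagged_iid_def using assms by (intro prob_space_PiM) (auto simp: space_prob_algebra)
  moreover have "sets (tagged_iid N \<rho> \<nu>) = sets (\<Pi>\<^sub>M i\<in>{1..N}. E)" unfolding tagged_iid_def
    using assms by (intro sets_PiM_cong) (auto simp: space_prob_algebra)
  ultimately show ?thesis by (simp add: space_prob_algebra)
qed

lemma tagged_iid_measurable:
  assumes "\<rho> \<in> X \<rightarrow>\<^sub>M prob_algebra E" "\<nu> \<in> X \<rightarrow>\<^sub>M prob_algebra E"
  shows "(\<lambda>x. tagged_iid N (\<rho> x) (\<nu> x)) \<in> X \<rightarrow>\<^sub>M prob_algebra (\<Pi>\<^sub>M i\<in>{1..N}. E)"
proof -
  have "(\<lambda>x. \<Pi>\<^sub>M i\<in>{1..N}. (if i = 1 then \<rho> else \<nu>) x) \<in> X \<rightarrow>\<^sub>M prob_algebra (\<Pi>\<^sub>M i\<in>{1..N}. E)"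
    by (rule measurable_PiM_kernel) (use assms in auto)
  moreover have "(\<lambda>x. tagged_iid N (\<rho> x) (\<nu> x)) = (\<lambda>x. \<Pi>\<^sub>M i\<in>{1..N}. (if i = 1 then \<rho> else \<nu>) x)"
    unfolding tagged_iid_def by (intro ext PiM_cong) auto
  ultimately show ?thesis by simp
qed

lemma nn_integral_tagged_iid_split:
  assumes \<rho>: "\<rho> \<in> space (prob_algebra E)" and \<nu>: "\<nu> \<in> space (prob_algebra E)" and i: "i \<in> {1..N}"
    and F: "F \<in> borel_measurable (\<Pi>\<^sub>M i\<in>{1..N}. E)"
  shows "(\<integral>\<^sup>+\<xi>. F \<xi> \<partial>tagged_iid N \<rho> \<nu>) =
    (\<integral>\<^sup>+e. \<integral>\<^sup>+\<xi>. F (\<xi>(i := e)) \<partial>(\<Pi>\<^sub>M i\<in>{1..N} - {i}. if i = 1 then \<rho> else \<nu>) \<partial>(if i = 1 then \<rho> else \<nu>))"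
proof -
  interpret product_sigma_finite "\<lambda>i::nat. if i = 1 then \<rho> else \<nu>"
    by (rule product_sigma_finite.intro)
      (use \<rho> \<nu> in \<open>simp add: space_prob_algebra prob_space_imp_sigma_finite\<close>)
  have ins: "insert i ({1..N} - {i}) = {1..N}" using i by auto
  have s: "sets (\<Pi>\<^sub>M i\<in>{1..N}. if i = 1 then \<rho> else \<nu>) = sets (\<Pi>\<^sub>M i\<in>{1..N}. E)"
    using tagged_iid_prob[OF \<rho> \<nu>, of N] by (simp add: tagged_iid_def space_prob_algebra)
  have F': "F \<in> borel_measurable (Pi\<^sub>M (insert i ({1..N} - {i})) (\<lambda>i. if i = 1 then \<rho> else \<nu>))"
    unfolding ins measurable_cong_sets[OF s refl] by (rule F)
  from product_nn_integral_insert_rev[OF _ _ F'] show ?thesis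
    unfolding ins tagged_iid_def by simp
qed

lemma nn_integral_PiM_component:
  assumes "\<And>i. i \<in> I \<Longrightarrow> prob_space (M i)" "j \<in> I" "f \<in> borel_measurable (M j)"
  shows "(\<integral>\<^sup>+x. f (x j) \<partial>PiM I M) = (\<integral>\<^sup>+e. f e \<partial>M j)"
proof -
  have "(\<integral>\<^sup>+e. f e \<partial>M j) = (\<integral>\<^sup>+e. f e \<partial>distr (PiM I M) (M j) (\<lambda>\<omega>. \<omega> j))"
    by (subst distr_PiM_component[OF assms(1,2)]) auto
  also have "\<dots> = (\<integral>\<^sup>+x. f (x j) \<partial>PiM I M)"
    by (rule nn_integral_distr) (use assms in auto)
  finally show ?thesis by simp
qed

text \<open>Condition on \<open>\<xi>\<^sub>i\<close> and apply Jensen's inequality to the remaining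
  components. The terms \<open>v(\<xi>\<^sub>1)\<close>, whose law is unrelated to
  \<open>\<nu>\<close>, and \<open>v(\<xi>\<^sub>i)\<close>, which is correlated with
  \<open>\<phi>(\<xi>\<^sub>i)\<close>, are replaced by the bound \<open>s\<close>; this accounts
  for \<open>2 s\<close> and \<open>N - 2\<close>.\<close>

lemma weighted_component_lower_bound:
  fixes s :: ennreal
  assumes \<rho>: "\<rho> \<in> space (prob_algebra E)" and \<nu>: "\<nu> \<in> space (prob_algebra E)" and N: "2 \<le> N"
    and \<phi>[measurable]: "\<phi> \<in> borel_measurable E" and v[measurable]: "v \<in> borel_measurable E"
    and vs: "\<And>e. e \<in> space E \<Longrightarrow> v e \<le> s" and i: "i \<in> {2..N}"
  shows "(\<integral>\<^sup>+e. \<phi> e \<partial>\<nu>) * inverse (2 * s + of_nat (N - 2) * (\<integral>\<^sup>+e. v e \<partial>\<nu>))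
    \<le> (\<integral>\<^sup>+\<xi>. \<phi> (\<xi> i) * inverse (\<Sum>j=1..N. v (\<xi> j)) \<partial>tagged_iid N \<rho> \<nu>)"
proof -
  let ?M = "\<lambda>i::nat. if i = 1 then \<rho> else \<nu>" and ?I = "{1..N} - {i}"
  have i': "i \<in> {1..N}" "i \<noteq> 1" using i by auto
  have s\<nu>: "sets \<nu> = sets E" and s\<rho>: "sets \<rho> = sets E" using \<rho> \<nu> by (auto simp: space_prob_algebra)
  have sM: "sets (?M j) = sets E" for j using s\<nu> s\<rho> by simp
  have pM: "prob_space (?M j)" for j using \<rho> \<nu> by (auto simp: space_prob_algebra)
  have vm: "v \<in> borel_measurable (?M j)" for j unfolding measurable_cong_sets[OF sM refl] by (rule v)
  have \<phi>m: "\<phi> \<in> borel_measurable \<nu>" unfolding measurable_cong_sets[OF s\<nu> refl] by (rule \<phi>)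
  interpret PI: prob_space "PiM ?I ?M" by (rule prob_space_PiM) (rule pM)
  have vj: "(\<lambda>\<xi>. v (\<xi> j)) \<in> borel_measurable (PiM ?I ?M)" if "j \<in> ?I" for j
    by (rule measurable_compose[OF measurable_component_singleton[OF that] vm])
  have m: "(\<lambda>\<xi>. \<phi> (\<xi> i) * inverse (\<Sum>j=1..N. v (\<xi> j))) \<in> borel_measurable (\<Pi>\<^sub>M i\<in>{1..N}. E)"
    using i' by measurable
  have "(\<integral>\<^sup>+\<xi>. \<phi> (\<xi> i) * inverse (\<Sum>j=1..N. v (\<xi> j)) \<partial>tagged_iid N \<rho> \<nu>) =
    (\<integral>\<^sup>+e. \<integral>\<^sup>+\<xi>. \<phi> e * inverse (v e + (\<Sum>j\<in>?I. v (\<xi> j))) \<partial>PiM ?I ?M \<partial>\<nu>)"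
  proof -
    have "(\<Sum>j=1..N. v ((\<xi>(i := e)) j)) = v e + (\<Sum>j\<in>?I. v (\<xi> j))" for \<xi> e
      using i' by (subst sum.remove[of _ i]) (auto intro!: sum.cong)
    then show ?thesis unfolding nn_integral_tagged_iid_split[OF \<rho> \<nu> i'(1) m] using i'(2) by simp
  qed
  also have "\<dots> \<ge> (\<integral>\<^sup>+e. \<phi> e * inverse (2 * s + of_nat (N - 2) * (\<integral>\<^sup>+e. v e \<partial>\<nu>)) \<partial>\<nu>)"
  proof (rule nn_integral_mono)
    fix e assume "e \<in> space \<nu>"
    then have e: "e \<in> space E" by (simp add: sets_eq_imp_space_eq[OF s\<nu>])
    have sm: "(\<lambda>\<xi>. \<Sum>j\<in>?I. v (\<xi> j)) \<in> borel_measurable (PiM ?I ?M)"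
      by (rule borel_measurable_sum) (rule vj)
    have bm: "(\<lambda>\<xi>. v e + (\<Sum>j\<in>?I. v (\<xi> j))) \<in> borel_measurable (PiM ?I ?M)"
      using sm by measurable
    have "(\<integral>\<^sup>+\<xi>. v e + (\<Sum>j\<in>?I. v (\<xi> j)) \<partial>PiM ?I ?M) = v e + (\<Sum>j\<in>?I. \<integral>\<^sup>+\<xi>. v (\<xi> j) \<partial>PiM ?I ?M)"
    proof -
      have "(\<integral>\<^sup>+\<xi>. v e + (\<Sum>j\<in>?I. v (\<xi> j)) \<partial>PiM ?I ?M) = (\<integral>\<^sup>+\<xi>. v e \<partial>PiM ?I ?M) + (\<integral>\<^sup>+\<xi>. (\<Sum>j\<in>?I. v (\<xi> j)) \<partial>PiM ?I ?M)"
        by (rule nn_integral_add[OF _ sm]) simp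
      also have "(\<integral>\<^sup>+\<xi>. v e \<partial>PiM ?I ?M) = v e"
        by (simp only: nn_integral_const PI.emeasure_space_1 mult_1_right)
      also have "(\<integral>\<^sup>+\<xi>. (\<Sum>j\<in>?I. v (\<xi> j)) \<partial>PiM ?I ?M) = (\<Sum>j\<in>?I. \<integral>\<^sup>+\<xi>. v (\<xi> j) \<partial>PiM ?I ?M)"
        by (rule nn_integral_sum) (rule vj)
      finally show ?thesis .
    qed
    also have "(\<Sum>j\<in>?I. \<integral>\<^sup>+\<xi>. v (\<xi> j) \<partial>PiM ?I ?M) = (\<Sum>j\<in>?I. \<integral>\<^sup>+e. v e \<partial>?M j)"
      by (intro sum.cong refl nn_integral_PiM_component pM vm) auto
    also have "\<dots> = (\<integral>\<^sup>+e. v e \<partial>\<rho>) + (\<Sum>j\<in>{1..N} - {i} - {1}. \<integral>\<^sup>+e. v e \<partial>\<nu>)"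
      using i' N by (subst sum.remove[of _ 1]) (auto intro!: sum.cong)
    also have "(\<Sum>j\<in>{1..N} - {i} - {1}. \<integral>\<^sup>+e. v e \<partial>\<nu>) = of_nat (N - 2) * (\<integral>\<^sup>+e. v e \<partial>\<nu>)"
      using i' N by (simp add: card_Diff_singleton_if numeral_2_eq_2)
    also have "v e + ((\<integral>\<^sup>+e. v e \<partial>\<rho>) + of_nat (N - 2) * (\<integral>\<^sup>+e. v e \<partial>\<nu>)) \<le> s + (s + of_nat (N - 2) * (\<integral>\<^sup>+e. v e \<partial>\<nu>))"
    proof (intro add_mono order_refl vs[OF e])
      interpret R: prob_space \<rho> using \<rho> by (simp add: space_prob_algebra)
      have "(\<integral>\<^sup>+e. v e \<partial>\<rho>) \<le> (\<integral>\<^sup>+e. s \<partial>\<rho>)"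
        by (rule nn_integral_mono) (use vs in \<open>simp add: sets_eq_imp_space_eq[OF s\<rho>]\<close>)
      then show "(\<integral>\<^sup>+e. v e \<partial>\<rho>) \<le> s" by (simp add: R.emeasure_space_1)
    qed
    also have "\<dots> = 2 * s + of_nat (N - 2) * (\<integral>\<^sup>+e. v e \<partial>\<nu>)" by (simp add: mult_2 add.assoc)
    finally have "inverse (2 * s + of_nat (N - 2) * (\<integral>\<^sup>+e. v e \<partial>\<nu>)) \<le> inverse (\<integral>\<^sup>+\<xi>. v e + (\<Sum>j\<in>?I. v (\<xi> j)) \<partial>PiM ?I ?M)"
      by (rule ennreal_inverse_antimono)
    also have "\<dots> \<le> (\<integral>\<^sup>+\<xi>. inverse (v e + (\<Sum>j\<in>?I. v (\<xi> j))) \<partial>PiM ?I ?M)"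
      by (rule PI.inverse_nn_integral_le[OF bm])
    finally have "\<phi> e * inverse (2 * s + of_nat (N - 2) * (\<integral>\<^sup>+e. v e \<partial>\<nu>))
        \<le> \<phi> e * (\<integral>\<^sup>+\<xi>. inverse (v e + (\<Sum>j\<in>?I. v (\<xi> j))) \<partial>PiM ?I ?M)" by (rule mult_left_mono) simp
    also have "\<dots> = (\<integral>\<^sup>+\<xi>. \<phi> e * inverse (v e + (\<Sum>j\<in>?I. v (\<xi> j))) \<partial>PiM ?I ?M)"
    proof (rule nn_integral_cmult[symmetric])
      show "(\<lambda>\<xi>. inverse (v e + (\<Sum>j\<in>?I. v (\<xi> j)))) \<in> borel_measurable (PiM ?I ?M)" using bm by measurable
    qed
    finally show "\<phi> e * inverse (2 * s + of_nat (N - 2) * (\<integral>\<^sup>+e. v e \<partial>\<nu>))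
        \<le> (\<integral>\<^sup>+\<xi>. \<phi> e * inverse (v e + (\<Sum>j\<in>?I. v (\<xi> j))) \<partial>PiM ?I ?M)" .
  qed
  finally show ?thesis using \<phi>m by (simp add: nn_integral_multc)
qed

lemma nn_integral_tagged_iid_return:
  assumes e: "e \<in> space E" and \<nu>: "\<nu> \<in> space (prob_algebra E)" and N: "1 \<le> N"
    and F: "F \<in> borel_measurable (\<Pi>\<^sub>M i\<in>{1..N}. E)"
  shows "(\<integral>\<^sup>+\<xi>. F \<xi> \<partial>tagged_iid N (return E e) \<nu>) = (\<integral>\<^sup>+\<xi>. F (\<xi>(1 := e)) \<partial>(\<Pi>\<^sub>M i\<in>{1..N} - {1}. \<nu>))"
proof -
  have 1: "1 \<in> {1..N}" using N by auto
  let ?J = "\<lambda>e. \<integral>\<^sup>+\<xi>. F (\<xi>(1 := e)) \<partial>(\<Pi>\<^sub>M i\<in>{1..N} - {1}. \<nu>)"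
  have c: "(\<Pi>\<^sub>M i\<in>{1..N} - {1}. if i = 1 then \<rho>' else \<nu>) = (\<Pi>\<^sub>M i\<in>{1..N} - {1}. \<nu>)" for \<rho>'
    by (rule PiM_cong) auto
  have J: "?J \<in> borel_measurable E"
  proof -
    have s\<nu>: "sets (\<Pi>\<^sub>M i\<in>{1..N} - {1}. \<nu>) = sets (\<Pi>\<^sub>M i\<in>{1..N} - {1}. E)"
      using \<nu> by (intro sets_PiM_cong) (auto simp: space_prob_algebra)
    interpret sigma_finite_measure "\<Pi>\<^sub>M i\<in>{1..N} - {1}. \<nu>"
      by (rule prob_space_imp_sigma_finite, rule prob_space_PiM) (use \<nu> in \<open>auto simp: space_prob_algebra\<close>)
    have "insert 1 ({1..N} - {1}) = {1..N}" using N by auto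
    then have "(\<lambda>(f, y). f(1 := y)) \<in> (\<Pi>\<^sub>M i\<in>{1..N} - {1}. E) \<Otimes>\<^sub>M E \<rightarrow>\<^sub>M (\<Pi>\<^sub>M i\<in>{1..N}. E)"
      using measurable_add_dim[of 1 "{1..N} - {1}" "\<lambda>_. E"] by simp
    from measurable_compose[OF measurable_pair_swap' measurable_compose[OF this F]]
    have m: "(\<lambda>z. F ((snd z)(1 := fst z))) \<in> borel_measurable (E \<Otimes>\<^sub>M (\<Pi>\<^sub>M i\<in>{1..N} - {1}. E))"
      by (simp add: case_prod_beta')
    have sp: "sets (E \<Otimes>\<^sub>M (\<Pi>\<^sub>M i\<in>{1..N} - {1}. \<nu>)) = sets (E \<Otimes>\<^sub>M (\<Pi>\<^sub>M i\<in>{1..N} - {1}. E))"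
      by (rule sets_pair_measure_cong) (use s\<nu> in auto)
    from m have "(\<lambda>(e, \<xi>). F (\<xi>(1 := e))) \<in> borel_measurable (E \<Otimes>\<^sub>M (\<Pi>\<^sub>M i\<in>{1..N} - {1}. \<nu>))"
      unfolding measurable_cong_sets[OF sp refl] by (simp add: case_prod_beta')
    from borel_measurable_nn_integral[OF this] show ?thesis by simp
  qed
  have r: "return E e \<in> space (prob_algebra E)" using e by (simp add: space_prob_algebra prob_space_return)
  show ?thesis unfolding nn_integral_tagged_iid_split[OF r \<nu> 1 F] c
    using nn_integral_return[OF e J] by simp
qed

text \<open>A random reference may be drawn first and the rest of the sample afterwards.\<close>

lemma nn_integral_tagged_iid_mixture:
  assumes \<rho>: "\<rho> \<in> space (prob_algebra E)" and \<nu>: "\<nu> \<in> space (prob_algebra E)" and N: "1 \<le> N"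
    and F: "F \<in> borel_measurable (\<Pi>\<^sub>M i\<in>{1..N}. E)"
  shows "(\<integral>\<^sup>+\<xi>. F \<xi> \<partial>tagged_iid N \<rho> \<nu>) = (\<integral>\<^sup>+e. \<integral>\<^sup>+\<xi>. F \<xi> \<partial>tagged_iid N (return E e) \<nu> \<partial>\<rho>)"
proof -
  have 1: "1 \<in> {1..N}" using N by auto
  have s\<rho>: "sets \<rho> = sets E" using \<rho> by (auto simp: space_prob_algebra)
  have c: "(\<Pi>\<^sub>M i\<in>{1..N} - {1}. if i = 1 then \<rho> else \<nu>) = (\<Pi>\<^sub>M i\<in>{1..N} - {1}. \<nu>)"
    by (rule PiM_cong) auto
  have "(\<integral>\<^sup>+e. \<integral>\<^sup>+\<xi>. F \<xi> \<partial>tagged_iid N (return E e) \<nu> \<partial>\<rho>) = (\<integral>\<^sup>+e. \<integral>\<^sup>+\<xi>. F (\<xi>(1 := e)) \<partial>(\<Pi>\<^sub>M i\<in>{1..N} - {1}. \<nu>) \<partial>\<rho>)"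
    by (rule nn_integral_cong, rule nn_integral_tagged_iid_return[OF _ \<nu> N F]) (simp add: sets_eq_imp_space_eq[OF s\<rho>])
  then show ?thesis unfolding nn_integral_tagged_iid_split[OF \<rho> \<nu> 1 F] c by simp
qed

lemma nn_integral_tagged_iid_return_cong:
  assumes e: "e \<in> space E" and \<nu>: "\<nu> \<in> space (prob_algebra E)" and N: "1 \<le> N"
    and F: "F \<in> borel_measurable (\<Pi>\<^sub>M i\<in>{1..N}. E)" and H: "H \<in> borel_measurable (\<Pi>\<^sub>M i\<in>{1..N}. E)"
    and FH: "\<And>\<xi>. \<xi> 1 = e \<Longrightarrow> F \<xi> = H \<xi>"
  shows "(\<integral>\<^sup>+\<xi>. F \<xi> \<partial>tagged_iid N (return E e) \<nu>) = (\<integral>\<^sup>+\<xi>. H \<xi> \<partial>tagged_iid N (return E e) \<nu>)"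
  unfolding nn_integral_tagged_iid_return[OF e \<nu> N F] nn_integral_tagged_iid_return[OF e \<nu> N H]
  by (rule nn_integral_cong) (simp add: FH)

lemma nn_integral_tagged_iid_return_measurable:
  assumes \<nu>: "\<nu> \<in> space (prob_algebra E)" and F: "F \<in> borel_measurable (\<Pi>\<^sub>M i\<in>{1..N}. E)"
  shows "(\<lambda>e. \<integral>\<^sup>+\<xi>. F \<xi> \<partial>tagged_iid N (return E e) \<nu>) \<in> borel_measurable E"
proof -
  have "(\<lambda>e. tagged_iid N (return E e) \<nu>) \<in> E \<rightarrow>\<^sub>M prob_algebra (\<Pi>\<^sub>M i\<in>{1..N}. E)"
    by (rule tagged_iid_measurable[OF measurable_return_prob_space]) (use \<nu> in simp)
  from measurable_compose[OF measurable_prob_algebraD[OF this] nn_integral_measurable_subprob_algebra[OF F]]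
  show ?thesis .
qed

lemma nn_integral_tagged_iid_permute:
  assumes \<nu>: "\<nu> \<in> space (prob_algebra E)" and \<tau>: "bij_betw \<tau> {1..N} {1..N}"
    and F: "F \<in> borel_measurable (\<Pi>\<^sub>M i\<in>{1..N}. E)"
  shows "(\<integral>\<^sup>+\<xi>. F (\<lambda>i\<in>{1..N}. \<xi> (\<tau> i)) \<partial>tagged_iid N \<nu> \<nu>) = (\<integral>\<^sup>+\<xi>. F \<xi> \<partial>tagged_iid N \<nu> \<nu>)"
proof -
  have s: "sets (\<Pi>\<^sub>M i\<in>{1..N}. \<nu>) = sets (\<Pi>\<^sub>M i\<in>{1..N}. E)"
    using \<nu> by (intro sets_PiM_cong) (auto simp: space_prob_algebra)
  have F': "F \<in> borel_measurable (\<Pi>\<^sub>M i\<in>{1..N}. \<nu>)" unfolding measurable_cong_sets[OF s refl] by (rule F)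
  have "distr (\<Pi>\<^sub>M i\<in>{1..N}. \<nu>) (\<Pi>\<^sub>M i\<in>{1..N}. \<nu>) (\<lambda>\<xi>. \<lambda>i\<in>{1..N}. \<xi> (\<tau> i)) = (\<Pi>\<^sub>M i\<in>{1..N}. \<nu>)"
    by (rule distr_PiM_reindex) (use \<nu> \<tau> in \<open>auto simp: space_prob_algebra bij_betw_def\<close>)
  then have "(\<integral>\<^sup>+\<xi>. F \<xi> \<partial>(\<Pi>\<^sub>M i\<in>{1..N}. \<nu>)) =
     (\<integral>\<^sup>+\<xi>. F \<xi> \<partial>distr (\<Pi>\<^sub>M i\<in>{1..N}. \<nu>) (\<Pi>\<^sub>M i\<in>{1..N}. \<nu>) (\<lambda>\<xi>. \<lambda>i\<in>{1..N}. \<xi> (\<tau> i)))"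
    by (simp only:)
  also have "\<dots> = (\<integral>\<^sup>+\<xi>. F (\<lambda>i\<in>{1..N}. \<xi> (\<tau> i)) \<partial>(\<Pi>\<^sub>M i\<in>{1..N}. \<nu>))"
  proof (rule nn_integral_distr)
    show "(\<lambda>\<xi>. \<lambda>i\<in>{1..N}. \<xi> (\<tau> i)) \<in> (\<Pi>\<^sub>M i\<in>{1..N}. \<nu>) \<rightarrow>\<^sub>M (\<Pi>\<^sub>M i\<in>{1..N}. \<nu>)"
      by (rule measurable_restrict, rule measurable_component_singleton) (use \<tau> in \<open>auto simp: bij_betw_def\<close>)
  qed (use F' in simp)
  finally show ?thesis by (simp add: tagged_iid_def)
qed

lemma tagged_iid_distr:
  assumes \<rho>: "\<rho> \<in> space (prob_algebra E)" and \<nu>: "\<nu> \<in> space (prob_algebra E)"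
    and f: "f \<in> E \<rightarrow>\<^sub>M E'"
  shows "distr (tagged_iid N \<rho> \<nu>) (\<Pi>\<^sub>M i\<in>{1..N}. E') (\<lambda>y. \<lambda>i\<in>{1..N}. f (y i)) = tagged_iid N (distr \<rho> E' f) (distr \<nu> E' f)"
proof -
  let ?M = "\<lambda>i::nat. if i = 1 then \<rho> else \<nu>"
  let ?M' = "\<lambda>i::nat. distr (?M i) E' f"
  have s: "sets \<rho> = sets E" "sets \<nu> = sets E" using \<rho> \<nu> by (auto simp: space_prob_algebra)
  have fm: "f \<in> ?M i \<rightarrow>\<^sub>M E'" for i using f s by (simp add: measurable_cong_sets[OF s(1) refl] measurable_cong_sets[OF s(2) refl])
  have p: "prob_space (?M i)" for i using \<rho> \<nu> by (simp add: space_prob_algebra)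
  have "distr (PiM {1..N} ?M) (PiM {1..N} ?M') (compose {1..N} f) = PiM {1..N} (\<lambda>i. distr (?M i) (?M' i) f)"
  proof (rule distr_PiM_finite_prob_space')
    show "prob_space (?M i)" for i by (rule p)
    show "prob_space (?M' i)" for i by (rule prob_space.prob_space_distr[OF p fm])
    show "f \<in> ?M i \<rightarrow>\<^sub>M ?M' i" for i using fm[of i] by (simp only: measurable_distr_eq2)
  qed simp
  also have "PiM {1..N} (\<lambda>i. distr (?M i) (?M' i) f) = PiM {1..N} ?M'"
    by (rule PiM_cong) (auto intro!: distr_cong)
  also have "\<dots> = tagged_iid N (distr \<rho> E' f) (distr \<nu> E' f)" unfolding tagged_iid_def by (rule PiM_cong) auto
  also have "distr (PiM {1..N} ?M) (PiM {1..N} ?M') (compose {1..N} f) = distr (tagged_iid N \<rho> \<nu>) (\<Pi>\<^sub>M i\<in>{1..N}. E') (\<lambda>y. \<lambda>i\<in>{1..N}. f (y i))"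
    unfolding tagged_iid_def by (rule distr_cong) (auto simp: compose_def intro!: sets_PiM_cong)
  finally show ?thesis .
qed

section \<open>Selection with probability proportional to a weight\<close>

definition select_weight :: "nat \<Rightarrow> (nat \<Rightarrow> real) \<Rightarrow> nat \<Rightarrow> ennreal" where
  "select_weight N w k = ennreal (if (\<Sum>j=1..N. w j) = 0 then (if k = 1 then 1 else 0) else w k / (\<Sum>j=1..N. w j))"

lemma select_eq: "select N w = point_measure {1..N} (select_weight N w)"
  by (simp add: select_def select_weight_def[abs_def])

lemma select_weight_sum:
  assumes "\<And>k. k \<in> {1..N} \<Longrightarrow> 0 \<le> w k" "1 \<le> N"
  shows "(\<Sum>k=1..N. select_weight N w k) = 1"
proof (cases "(\<Sum>j=1..N. w j) = 0")
  case True
  have "(\<Sum>k=1..N. select_weight N w k) = (\<Sum>k=1..N. if k = 1 then 1 else 0)"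
    unfolding select_weight_def using True by (intro sum.cong) auto
  then show ?thesis using assms(2) by simp
next
  case False
  have nn: "0 \<le> (\<Sum>j=1..N. w j)" by (rule sum_nonneg) (use assms in auto)
  have "(\<Sum>k=1..N. select_weight N w k) = ennreal (\<Sum>k=1..N. w k / (\<Sum>j=1..N. w j))"
    unfolding select_weight_def using False assms nn by (subst sum_ennreal) auto
  also have "(\<Sum>k=1..N. w k / (\<Sum>j=1..N. w j)) = 1" using False by (simp add: sum_divide_distrib[symmetric])
  finally show ?thesis by simp
qed

lemma sets_select: "sets (select N w) = sets (count_space {1..N})"
  by (simp add: select_def sets_point_measure)

lemma nn_integral_select: "(\<integral>\<^sup>+k. f k \<partial>select N w) = (\<Sum>k=1..N. select_weight N w k * f k)"
  unfolding select_eq by (rule nn_integral_point_measure_finite) simp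

lemma select_prob:
  assumes "\<And>k. k \<in> {1..N} \<Longrightarrow> 0 \<le> w k" "1 \<le> N"
  shows "select N w \<in> space (prob_algebra (count_space {1..N}))"
proof -
  have "prob_space (select N w)"
    by (rule prob_spaceI)
      (use select_weight_sum[OF assms] in \<open>simp add: select_eq space_point_measure emeasure_point_measure_finite\<close>)
  then show ?thesis by (simp add: space_prob_algebra sets_select)
qed

lemma select_measurable:
  assumes w: "\<And>k. k \<in> {1..N} \<Longrightarrow> (\<lambda>x. w x k) \<in> borel_measurable X"
    and nn: "\<And>x k. x \<in> space X \<Longrightarrow> k \<in> {1..N} \<Longrightarrow> 0 \<le> w x k" and N: "1 \<le> N"
  shows "(\<lambda>x. select N (w x)) \<in> X \<rightarrow>\<^sub>M prob_algebra (count_space {1..N})"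
proof (rule measurable_prob_algebra_generated[of _ "{1..N}" "Pow {1..N}"])
  show "sets (count_space {1..N}) = sigma_sets {1..N} (Pow {1..N})"
    by (simp add: sigma_algebra.sigma_sets_eq[OF sigma_algebra_Pow])
  show "Int_stable (Pow {1..N})" by (auto simp: Int_stable_def)
  show "prob_space (select N (w x))" "sets (select N (w x)) = sets (count_space {1..N})" if "x \<in> space X" for x
    using select_prob[of N "w x"] nn[OF that] N by (auto simp: space_prob_algebra)
  fix A assume A: "A \<in> Pow {1..N}"
  have [measurable]: "(\<lambda>x. \<Sum>j=1..N. w x j) \<in> borel_measurable X" by (rule borel_measurable_sum) (use w in auto)
  have "(\<lambda>x. \<Sum>k\<in>A. select_weight N (w x) k) \<in> borel_measurable X"
  proof (rule borel_measurable_sum)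
    fix k assume "k \<in> A"
    then have [measurable]: "(\<lambda>x. w x k) \<in> borel_measurable X" using A w by auto
    show "(\<lambda>x. select_weight N (w x) k) \<in> borel_measurable X" unfolding select_weight_def by measurable
  qed
  moreover have "emeasure (select N (w x)) A = (\<Sum>k\<in>A. select_weight N (w x) k)" for x
    using A unfolding select_eq by (intro emeasure_point_measure_finite) auto
  ultimately show "(\<lambda>x. emeasure (select N (w x)) A) \<in> borel_measurable X" by simp
qed simp

text \<open>Division by the total weight can be undone even if the total weight is 0, since then
  every single weight is 0.\<close>

lemma select_weight_mult_total:
  assumes "\<And>k. k \<in> {1..N} \<Longrightarrow> 0 \<le> w k" "k \<in> {1..N}"
  shows "select_weight N w k * (\<Sum>j=1..N. ennreal (w j)) = ennreal (w k)"
proof (cases "(\<Sum>j=1..N. w j) = 0")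
  case True
  then have "w j = 0" if "j \<in> {1..N}" for j
    using sum_nonneg_eq_0_iff[of "{1..N}" w] assms(1) that by auto
  then show ?thesis using assms(2) by simp
next
  case False
  have nn: "0 \<le> (\<Sum>j=1..N. w j)" by (rule sum_nonneg) (use assms in auto)
  have "(\<Sum>j=1..N. ennreal (w j)) = ennreal (\<Sum>j=1..N. w j)" by (rule sum_ennreal) (use assms in auto)
  then show ?thesis using False nn assms by (simp add: select_weight_def ennreal_mult[symmetric])
qed

text \<open>Selection commutes with relabelling, except when all weights vanish: then index 1 is
  selected whatever the labelling.\<close>

lemma select_weight_cong_permute:
  assumes \<tau>: "bij_betw \<tau> {1..N} {1..N}" and pos: "(\<Sum>j=1..N. w j) \<noteq> 0"
  shows "select_weight N (\<lambda>k. w (\<tau> k)) k = select_weight N w (\<tau> k)"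
  using pos sum.reindex_bij_betw[OF \<tau>, of w] by (simp add: select_weight_def)

lemma select_weight_cong: "(\<And>k. k \<in> {1..N} \<Longrightarrow> w k = w' k) \<Longrightarrow> k \<in> {1..N} \<Longrightarrow> select_weight N w k = select_weight N w' k"
  unfolding select_weight_def by (simp cong: sum.cong_simp)

lemma select_cong:
  assumes "\<And>k. k \<in> {1..N} \<Longrightarrow> w k = w' k"
  shows "select N w = select N w'"
  unfolding select_eq point_measure_def
  by (rule density_cong) (use select_weight_cong[of N w w'] assms in \<open>auto intro!: AE_I2\<close>)

text \<open>Rewrites a ratio of unnormalised sums as a ratio of means over the selected index, by
  cancelling the total weight. It is an inequality because the first summand of the numerator is
  restored, and because of the case of a vanishing total weight, where the left-hand side is
  0.\<close>

lemma selection_ratio_le: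
  fixes a b :: "nat \<Rightarrow> ennreal" and s c :: ennreal
  assumes w: "\<And>k. k \<in> {1..N} \<Longrightarrow> 0 \<le> w k"
  shows "(\<Sum>k=2..N. ennreal (w k) * a k) * inverse (2 * s * (\<Sum>k=1..N. ennreal (w k)) + c * (\<Sum>k=1..N. ennreal (w k) * b k))
    \<le> (\<Sum>k=1..N. select_weight N w k * a k) * inverse (2 * s + c * (\<Sum>k=1..N. select_weight N w k * b k))"
proof -
  define W where "W = (\<Sum>k=1..N. ennreal (w k))"
  have Wfin: "W < top" by (simp add: W_def)
  have e: "ennreal (w k) = W * select_weight N w k" if "k \<in> {1..N}" for k
    using select_weight_mult_total[OF w that] by (simp add: W_def mult.commute)
  have sumW: "(\<Sum>k=1..N. ennreal (w k) * h k) = W * (\<Sum>k=1..N. select_weight N w k * h k)" for h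
    unfolding sum_distrib_left by (intro sum.cong refl) (simp add: e mult.assoc)
  let ?X = "\<Sum>k=1..N. select_weight N w k * a k" and ?Y = "2 * s + c * (\<Sum>k=1..N. select_weight N w k * b k)"
  have "(\<Sum>k=2..N. ennreal (w k) * a k) \<le> (\<Sum>k=1..N. ennreal (w k) * a k)"
    by (rule sum_mono2) auto
  then have "(\<Sum>k=2..N. ennreal (w k) * a k) \<le> W * ?X" by (simp only: sumW)
  moreover have "2 * s * W + c * (\<Sum>k=1..N. ennreal (w k) * b k) = W * ?Y"
    unfolding sumW by (simp add: distrib_left mult_ac)
  ultimately have "(\<Sum>k=2..N. ennreal (w k) * a k) * inverse (2 * s * W + c * (\<Sum>k=1..N. ennreal (w k) * b k))
      \<le> W * ?X * inverse (W * ?Y)" by (simp only: mult_right_mono zero_le)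
  also have "\<dots> \<le> ?X * inverse ?Y"
  proof (cases "W = 0")
    case False
    have inv: "inverse (W * ?Y) = inverse W * inverse ?Y"
      by (rule ennreal_inverse_mult') (use False Wfin in \<open>auto simp: zero_less_iff_neq_zero\<close>)
    have one: "W * inverse W = 1" using ennreal_divide_self[OF False Wfin] by (simp add: divide_ennreal_def)
    have "W * ?X * inverse (W * ?Y) = (W * inverse W) * (?X * inverse ?Y)" unfolding inv by (simp only: mult_ac)
    then show ?thesis by (simp only: one mult_1_left order_refl)
  qed simp
  finally show ?thesis unfolding W_def .
qed

section \<open>The minorisation constant\<close>

text \<open>Each of the \<open>T\<close> generations contributes one factor, see
  \<open>ratio_mean_lower_bound\<close>.\<close>

definition minor_const :: "real \<Rightarrow> nat \<Rightarrow> nat \<Rightarrow> real" where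
  "minor_const a N T = ((real N - 1) / (2 * a + real N - 2)) ^ T"

text \<open>With \<open>x = (2 a - 1) / (2 a + N - 2)\<close> the constant is \<open>(1 -
  x)\<^sup>T\<close>, and Bernoulli's inequality gives the bound in \<open>1 / N\<close>. With
  \<open>y = (2 a - 1) / (N - 1)\<close> it is \<open>(1 + y)\<^bsup>-T\<^esup>\<close>, and
  \<open>1 + y \<le> e\<^sup>y\<close> gives the exponential bound.\<close>

lemma minor_const_bounds:
  assumes a: "1 \<le> a" and N: "2 \<le> N" and T: "1 \<le> T"
  shows "0 < minor_const a N T" "minor_const a N T < 1"
    "1 - minor_const a N T \<le> real T * (2 * a - 1) / real N"
    "exp (- (real T * (2 * a - 1) / (real N - 1))) \<le> minor_const a N T"
proof -
  define K where "K = 2 * a + real N - 2"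
  have K: "0 < K" "real N \<le> K" using a N by (auto simp: K_def)
  define x where "x = (2 * a - 1) / K"
  have q: "(real N - 1) / K = 1 - x" using K by (simp add: x_def K_def field_simps)
  have x: "0 < x" "x < 1" using a K N by (auto simp: x_def K_def)
  have e: "minor_const a N T = (1 - x) ^ T" unfolding minor_const_def q[symmetric] K_def ..
  show "0 < minor_const a N T" unfolding e using x by simp
  show "minor_const a N T < 1" unfolding e using x T by (intro power_Suc_less_one[of "1 - x" "T - 1", simplified] power_less_one_iff[THEN iffD2]) auto
  have "1 + real T * (- x) \<le> (1 + (- x)) ^ T" by (rule Bernoulli_inequality) (use x in auto)
  then have "1 - minor_const a N T \<le> real T * x" unfolding e by simp
  also have "\<dots> \<le> real T * ((2 * a - 1) / real N)"
    unfolding x_def using a N K by (intro mult_left_mono divide_left_mono) auto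
  finally show "1 - minor_const a N T \<le> real T * (2 * a - 1) / real N" by simp
  define y where "y = (2 * a - 1) / (real N - 1)"
  have y: "0 \<le> y" using a N by (simp add: y_def)
  have inv: "1 - x = inverse (1 + y)"
  proof -
    have "1 - x = (real N - 1) / K" using q by simp
    also have "\<dots> = inverse (1 + y)" using a N by (simp add: y_def K_def field_simps)
    finally show ?thesis .
  qed
  have "exp (- (real T * (2 * a - 1) / (real N - 1))) = inverse (exp y ^ T)"
    by (simp add: exp_minus y_def exp_of_nat_mult[symmetric])
  also have "\<dots> \<le> inverse ((1 + y) ^ T)"
    using y by (intro le_imp_inverse_le power_mono exp_ge_add_one_self) auto
  also have "\<dots> = minor_const a N T" unfolding e inv by (simp add: power_inverse)
  finally show "exp (- (real T * (2 * a - 1) / (real N - 1))) \<le> minor_const a N T" .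
qed

section \<open>The conditional particle system of ancestral paths\<close>

context feynman_kac begin

text \<open>Mutation of a path: its last state moves on and the earlier ones are kept.\<close>

definition grow :: "nat \<Rightarrow> (nat \<Rightarrow> 'z) \<Rightarrow> (nat \<Rightarrow> 'z) measure" where
  "grow t e = distr (M (Suc t) (e t)) (paths S (Suc t)) (\<lambda>y. e(Suc t := y))"

abbreviation systems :: "nat \<Rightarrow> nat \<Rightarrow> (nat \<Rightarrow> nat \<Rightarrow> 'z) measure" where
  "systems N t \<equiv> \<Pi>\<^sub>M i\<in>{1..N}. paths S t"

definition selection :: "nat \<Rightarrow> nat \<Rightarrow> (nat \<Rightarrow> nat \<Rightarrow> 'z) \<Rightarrow> nat measure" where
  "selection N t \<xi> = select N (\<lambda>k. G t (\<xi> k t))"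

abbreviation weight :: "nat \<Rightarrow> nat \<Rightarrow> (nat \<Rightarrow> nat \<Rightarrow> 'z) \<Rightarrow> nat \<Rightarrow> ennreal" where
  "weight N t \<xi> k \<equiv> select_weight N (\<lambda>k. G t (\<xi> k t)) k"

definition newborn :: "nat \<Rightarrow> nat \<Rightarrow> (nat \<Rightarrow> nat \<Rightarrow> 'z) \<Rightarrow> (nat \<Rightarrow> 'z) measure" where
  "newborn N t \<xi> = selection N t \<xi> \<bind> (\<lambda>k. grow t (\<xi> k))"

text \<open>Particle 1 is pinned to the reference path \<open>x\<close> and is its own parent; its
  first \<open>t\<close> states are already stored in \<open>\<xi> 1\<close>.\<close>

definition csmc_kernel :: "nat \<Rightarrow> nat \<Rightarrow> (nat \<Rightarrow> 'z) \<Rightarrow> (nat \<Rightarrow> nat \<Rightarrow> 'z) \<Rightarrow> (nat \<Rightarrow> nat \<Rightarrow> 'z) measure" where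
  "csmc_kernel N t x \<xi> = tagged_iid N (return (paths S (Suc t)) ((\<xi> 1)(Suc t := x (Suc t)))) (newborn N t \<xi>)"

text \<open>At index \<open>n\<close> this is a law of \<open>N\<close> paths of length \<open>n +
  1\<close>, namely of the ancestral paths of the particles at time \<open>n + 1\<close>.\<close>

primrec system_law :: "nat \<Rightarrow> (nat \<Rightarrow> 'z) \<Rightarrow> nat \<Rightarrow> (nat \<Rightarrow> nat \<Rightarrow> 'z) measure" where
  "system_law N x 0 = tagged_iid N (return (paths S 1) (\<lambda>t\<in>{1}. x 1)) (chain 1)"
| "system_law N x (Suc n) = system_law N x n \<bind> csmc_kernel N (Suc n) x"

lemma systems_component: "k \<in> {1..N} \<Longrightarrow> (\<lambda>\<xi>. \<xi> k) \<in> systems N t \<rightarrow>\<^sub>M paths S t"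
  by (rule measurable_component_singleton)

lemma systems_in_paths: "\<xi> \<in> space (systems N t) \<Longrightarrow> k \<in> {1..N} \<Longrightarrow> \<xi> k \<in> space (paths S t)"
  using measurable_space[OF systems_component] .

lemma systems_in_S: "\<xi> \<in> space (systems N t) \<Longrightarrow> k \<in> {1..N} \<Longrightarrow> 1 \<le> t \<Longrightarrow> \<xi> k t \<in> space S"
  using path_in_space[OF systems_in_paths] by blast

lemma last_measurable: "1 \<le> t \<Longrightarrow> f \<in> borel_measurable S \<Longrightarrow> (\<lambda>e. f (e t)) \<in> borel_measurable (paths S t)"
  by (rule measurable_compose[OF measurable_path_component]) auto

lemma systems_last_measurable:
  "1 \<le> t \<Longrightarrow> k \<in> {1..N} \<Longrightarrow> f \<in> borel_measurable S \<Longrightarrow> (\<lambda>\<xi>. f (\<xi> k t)) \<in> borel_measurable (systems N t)"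
  using measurable_compose[OF systems_component last_measurable] .

lemma grow_measurable: "1 \<le> t \<Longrightarrow> grow t \<in> paths S t \<rightarrow>\<^sub>M prob_algebra (paths S (Suc t))"
  unfolding grow_def[abs_def] by (rule measurable_extend_kernel_paths)

lemma grow_prob: "1 \<le> t \<Longrightarrow> e \<in> space (paths S t) \<Longrightarrow> grow t e \<in> space (prob_algebra (paths S (Suc t)))"
  by (rule measurable_space[OF grow_measurable])

lemma nn_integral_grow:
  "1 \<le> t \<Longrightarrow> e \<in> space (paths S t) \<Longrightarrow> F \<in> borel_measurable (paths S (Suc t)) \<Longrightarrow>
    (\<integral>\<^sup>+y. F y \<partial>grow t e) = (\<integral>\<^sup>+y. F (e(Suc t := y)) \<partial>M (Suc t) (e t))"
  unfolding grow_def by (rule nn_integral_extend)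

lemma selection_measurable:
  assumes "1 \<le> t" "1 \<le> N"
  shows "selection N t \<in> systems N t \<rightarrow>\<^sub>M prob_algebra (count_space {1..N})"
  unfolding selection_def[abs_def]
proof (rule select_measurable)
  show "(\<lambda>\<xi>. G t (\<xi> k t)) \<in> borel_measurable (systems N t)" if "k \<in> {1..N}" for k
    by (rule systems_last_measurable[OF assms(1) that G_measurable[OF assms(1)]])
  show "0 \<le> G t (\<xi> k t)" if "\<xi> \<in> space (systems N t)" "k \<in> {1..N}" for \<xi> k
    by (rule G_nonneg[OF assms(1) systems_in_S[OF that assms(1)]])
qed (rule assms)

lemma selected_component_measurable:
  "(\<lambda>(\<xi>, k). \<xi> k) \<in> systems N t \<Otimes>\<^sub>M count_space {1..N} \<rightarrow>\<^sub>M paths S t"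
proof -
  have "(\<lambda>z. fst z (snd z)) \<in> systems N t \<Otimes>\<^sub>M count_space {1..N} \<rightarrow>\<^sub>M paths S t"
    by (rule measurable_compose_countable'[where f="\<lambda>i z. fst z i" and g=snd and I="{1..N}"])
      (auto intro: measurable_compose[OF measurable_fst systems_component] countable_finite)
  then show ?thesis by (simp add: case_prod_beta')
qed

lemma newborn_measurable:
  assumes "1 \<le> t" "1 \<le> N"
  shows "newborn N t \<in> systems N t \<rightarrow>\<^sub>M prob_algebra (paths S (Suc t))"
  unfolding newborn_def[abs_def]
proof (rule measurable_bind_prob_space2[OF selection_measurable[OF assms]])
  show "(\<lambda>(\<xi>, k). grow t (\<xi> k)) \<in> systems N t \<Otimes>\<^sub>M count_space {1..N} \<rightarrow>\<^sub>M prob_algebra (paths S (Suc t))"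
    using measurable_compose[OF selected_component_measurable grow_measurable[OF assms(1)]] by (simp add: case_prod_beta')
qed

lemma newborn_prob: "1 \<le> t \<Longrightarrow> 1 \<le> N \<Longrightarrow> \<xi> \<in> space (systems N t) \<Longrightarrow> newborn N t \<xi> \<in> space (prob_algebra (paths S (Suc t)))"
  by (rule measurable_space[OF newborn_measurable])

lemma nn_integral_newborn:
  assumes t: "1 \<le> t" "1 \<le> N" and \<xi>: "\<xi> \<in> space (systems N t)" and F: "F \<in> borel_measurable (paths S (Suc t))"
  shows "(\<integral>\<^sup>+e. F e \<partial>newborn N t \<xi>) = (\<Sum>k=1..N. weight N t \<xi> k * (\<integral>\<^sup>+e. F e \<partial>grow t (\<xi> k)))"
proof -
  have "(\<lambda>k. grow t (\<xi> k)) \<in> count_space {1..N} \<rightarrow>\<^sub>M subprob_algebra (paths S (Suc t))"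
    using grow_prob[OF t(1) systems_in_paths[OF \<xi>]] by (auto simp: space_prob_algebra space_subprob_algebra prob_space_imp_subprob_space)
  then have "(\<lambda>k. grow t (\<xi> k)) \<in> selection N t \<xi> \<rightarrow>\<^sub>M subprob_algebra (paths S (Suc t))"
    unfolding selection_def measurable_cong_sets[OF sets_select refl] .
  from nn_integral_bind[OF F this] show ?thesis
    unfolding newborn_def by (simp add: selection_def nn_integral_select)
qed

lemma extended_reference_measurable:
  assumes "1 \<le> N" "Suc t \<le> T"
  shows "(\<lambda>(x, \<xi>). (\<xi> 1)(Suc t := x (Suc t))) \<in> paths S T \<Otimes>\<^sub>M systems N t \<rightarrow>\<^sub>M paths S (Suc t)"
proof -
  have "(\<lambda>z. (snd z 1, fst z (Suc t))) \<in> paths S T \<Otimes>\<^sub>M systems N t \<rightarrow>\<^sub>M paths S t \<Otimes>\<^sub>M S"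
    by (intro measurable_Pair measurable_compose[OF measurable_snd systems_component]
        measurable_compose[OF measurable_fst measurable_path_component]) (use assms in auto)
  from measurable_compose[OF this measurable_extend_paths] show ?thesis by (simp add: case_prod_beta')
qed

lemma csmc_kernel_measurable:
  assumes "1 \<le> t" "1 \<le> N" "Suc t \<le> T"
  shows "(\<lambda>(x, \<xi>). csmc_kernel N t x \<xi>) \<in> paths S T \<Otimes>\<^sub>M systems N t \<rightarrow>\<^sub>M prob_algebra (systems N (Suc t))"
proof -
  have "(\<lambda>z. tagged_iid N (return (paths S (Suc t)) ((\<lambda>(x, \<xi>). (\<xi> 1)(Suc t := x (Suc t))) z)) (newborn N t (snd z)))
     \<in> paths S T \<Otimes>\<^sub>M systems N t \<rightarrow>\<^sub>M prob_algebra (systems N (Suc t))"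
    by (rule tagged_iid_measurable[OF measurable_compose[OF extended_reference_measurable[OF assms(2,3)] measurable_return_prob_space]
        measurable_compose[OF measurable_snd newborn_measurable[OF assms(1,2)]]])
  then show ?thesis by (simp add: csmc_kernel_def case_prod_beta')
qed

lemma csmc_kernel_measurable1:
  assumes "1 \<le> t" "1 \<le> N" "Suc t \<le> T" "x \<in> space (paths S T)"
  shows "csmc_kernel N t x \<in> systems N t \<rightarrow>\<^sub>M prob_algebra (systems N (Suc t))"
  using measurable_compose[OF measurable_Pair1'[OF assms(4)] csmc_kernel_measurable[OF assms(1-3)]] by simp

lemma init_measurable: "1 \<le> T \<Longrightarrow> (\<lambda>x. \<lambda>t\<in>{1::nat}. x 1) \<in> paths S T \<rightarrow>\<^sub>M paths S 1"
  using measurable_restrict[of "{1}" "\<lambda>_ x. x 1" "paths S T" "\<lambda>_. S"] measurable_path_component[of 1 T]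
  by (simp add: paths_def)

lemma system_law_measurable:
  assumes "1 \<le> N" "Suc n \<le> T"
  shows "(\<lambda>x. system_law N x n) \<in> paths S T \<rightarrow>\<^sub>M prob_algebra (systems N (Suc n))"
  using assms(2)
proof (induction n)
  case 0
  have c: "(\<lambda>_. chain 1) \<in> paths S T \<rightarrow>\<^sub>M prob_algebra (paths S 1)"
    using chain_law_prob[of 1] by simp
  from tagged_iid_measurable[OF measurable_compose[OF init_measurable measurable_return_prob_space] c] 0
  show ?case by simp
next
  case (Suc n)
  from measurable_bind_prob_space2[OF Suc.IH csmc_kernel_measurable] Suc.prems assms(1) show ?case by simp
qed

lemma system_law_prob: "1 \<le> N \<Longrightarrow> Suc n \<le> T \<Longrightarrow> x \<in> space (paths S T) \<Longrightarrow> system_law N x n \<in> space (prob_algebra (systems N (Suc n)))"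
  by (rule measurable_space[OF system_law_measurable])

lemma nn_integral_system_law_Suc:
  assumes N: "1 \<le> N" and n: "Suc (Suc n) \<le> T" and x: "x \<in> space (paths S T)" and F: "F \<in> borel_measurable (systems N (Suc (Suc n)))"
  shows "(\<integral>\<^sup>+\<xi>. F \<xi> \<partial>system_law N x (Suc n)) = (\<integral>\<^sup>+\<xi>. \<integral>\<^sup>+\<xi>'. F \<xi>' \<partial>csmc_kernel N (Suc n) x \<xi> \<partial>system_law N x n)"
proof -
  have s: "sets (system_law N x n) = sets (systems N (Suc n))" using system_law_prob[of N n T x] N n x by (simp add: space_prob_algebra)
  have "csmc_kernel N (Suc n) x \<in> system_law N x n \<rightarrow>\<^sub>M subprob_algebra (systems N (Suc (Suc n)))"
    unfolding measurable_cong_sets[OF s refl]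
    by (rule measurable_prob_algebraD, rule csmc_kernel_measurable1[where T=T]) (use N n x in auto)
  from nn_integral_bind[OF F this] show ?thesis by simp
qed

lemma space_system_law: "1 \<le> N \<Longrightarrow> Suc n \<le> T \<Longrightarrow> x \<in> space (paths S T) \<Longrightarrow> space (system_law N x n) = space (systems N (Suc n))"
  using system_law_prob[of N n T x] by (auto simp: space_prob_algebra dest: sets_eq_imp_space_eq)

lemma extended_reference_in_space:
  "1 \<le> N \<Longrightarrow> Suc t \<le> T \<Longrightarrow> x \<in> space (paths S T) \<Longrightarrow> \<xi> \<in> space (systems N t) \<Longrightarrow>
    (\<xi> 1)(Suc t := x (Suc t)) \<in> space (paths S (Suc t))"
  using measurable_space[OF extended_reference_measurable, of N t T "(x, \<xi>)"] by (simp add: space_pair_measure)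

text \<open>The analogue of \<open>\<Gamma>\<close> for functions of the path up to time
  \<open>t\<close>. The potential at time \<open>t\<close> is not included, so the target is
  proportional to \<open>\<phi> \<mapsto> \<Gamma>\<^sub>p(g\<^sub>T \<phi>)\<close>.\<close>

definition \<Gamma>p :: "nat \<Rightarrow> ((nat \<Rightarrow> 'z) \<Rightarrow> ennreal) \<Rightarrow> ennreal" where
  "\<Gamma>p t \<phi> = (\<integral>\<^sup>+w. (\<Prod>s\<in>{1..<t}. g s (w s)) * \<phi> w \<partial>chain t)"

definition fk_op_path :: "nat \<Rightarrow> ((nat \<Rightarrow> 'z) \<Rightarrow> ennreal) \<Rightarrow> (nat \<Rightarrow> 'z) \<Rightarrow> ennreal" where
  "fk_op_path t \<phi> e = g t (e t) * (\<integral>\<^sup>+e'. \<phi> e' \<partial>grow t e)"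

lemma fk_op_path_measurable: "1 \<le> t \<Longrightarrow> \<phi> \<in> borel_measurable (paths S (Suc t)) \<Longrightarrow> fk_op_path t \<phi> \<in> borel_measurable (paths S t)"
  unfolding fk_op_path_def[abs_def]
  by (intro borel_measurable_times_ennreal last_measurable g_measurable
      measurable_compose[OF measurable_prob_algebraD[OF grow_measurable] nn_integral_measurable_subprob_algebra])

lemma prod_g_measurable: "(\<lambda>w. \<Prod>s\<in>{1..<t}. g s (w s)) \<in> borel_measurable (paths S t)"
  by (rule borel_measurable_prod_ennreal, rule measurable_compose[OF measurable_path_component g_measurable]) auto

lemma \<Gamma>p_1: "\<phi> \<in> borel_measurable (paths S 1) \<Longrightarrow> \<Gamma>p 1 \<phi> = (\<integral>\<^sup>+w. \<phi> w \<partial>chain 1)"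
  by (simp add: \<Gamma>p_def)

lemma \<Gamma>p_Suc:
  assumes t: "1 \<le> t" and \<phi>: "\<phi> \<in> borel_measurable (paths S (Suc t))"
  shows "\<Gamma>p (Suc t) \<phi> = \<Gamma>p t (fk_op_path t \<phi>)"
proof -
  have m: "(\<lambda>w. (\<Prod>s\<in>{1..<Suc t}. g s (w s)) * \<phi> w) \<in> borel_measurable (paths S (Suc t))"
    by (intro borel_measurable_times_ennreal prod_g_measurable \<phi>)
  show ?thesis
    unfolding \<Gamma>p_def nn_integral_chain_Suc[OF t m]
  proof (rule nn_integral_cong)
    fix w assume "w \<in> space (chain t)"
    then have w: "w \<in> space (paths S t)" by (simp add: space_chain_law[OF t])
    then have wt: "w t \<in> space S" using t by (intro path_in_space[OF w]) auto
    have s: "sets (M (Suc t) (w t)) = sets S" using t wt by (intro sets_K) auto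
    have \<phi>w: "(\<lambda>y. \<phi> (w(Suc t := y))) \<in> borel_measurable (M (Suc t) (w t))"
      unfolding measurable_cong_sets[OF s refl] by (rule measurable_compose[OF measurable_extend_path[OF w] \<phi>])
    have prodeq: "(\<Prod>s\<in>{1..<Suc t}. g s ((w(Suc t := y)) s)) = (\<Prod>s\<in>{1..<t}. g s (w s)) * g t (w t)" for y
    proof -
      have "(\<Prod>s\<in>{1..<Suc t}. g s ((w(Suc t := y)) s)) = (\<Prod>s\<in>{1..<Suc t}. g s (w s))"
        by (rule prod.cong) auto
      then show ?thesis using t by simp
    qed
    show "(\<integral>\<^sup>+y. (\<Prod>s\<in>{1..<Suc t}. g s ((w(Suc t := y)) s)) * \<phi> (w(Suc t := y)) \<partial>M (Suc t) (w t)) =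
      (\<Prod>s\<in>{1..<t}. g s (w s)) * fk_op_path t \<phi> w"
      unfolding prodeq nn_integral_cmult[OF \<phi>w] fk_op_path_def nn_integral_grow[OF t w \<phi>] by (rule mult.assoc)
  qed
qed

lemma nn_integral_chain_1_last: "v \<in> borel_measurable S \<Longrightarrow> (\<integral>\<^sup>+w. v (w 1) \<partial>chain 1) = \<Gamma> 1 v"
proof -
  assume v: "v \<in> borel_measurable S"
  have "(\<integral>\<^sup>+w. v (w 1) \<partial>chain 1) = (\<integral>\<^sup>+z. v ((\<lambda>t\<in>{1::nat}. z) 1) \<partial>M1)"
    by (rule nn_integral_chain_1[OF last_measurable[OF order_refl v]])
  then show ?thesis unfolding \<Gamma>_1[OF v] by simp
qed

lemma \<Gamma>_one_1: "\<Gamma> 1 (\<lambda>_. 1) = 1"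
  using prob_space.emeasure_space_1[OF prob_\<mu>] by (simp add: \<Gamma>_1 del: One_nat_def)

section \<open>A lower bound for selected particles\<close>

text \<open>The sum over \<open>k\<close> starts at 2 since the reference contributes only to the
  normalisation.\<close>

definition ratio_mean :: "nat \<Rightarrow> (nat \<Rightarrow> 'z) \<Rightarrow> nat \<Rightarrow> ((nat \<Rightarrow> 'z) \<Rightarrow> ennreal) \<Rightarrow> ('z \<Rightarrow> ennreal) \<Rightarrow> ennreal" where
  "ratio_mean N x n \<phi> v = (\<integral>\<^sup>+\<xi>. (\<Sum>k=2..N. \<phi> (\<xi> k)) * inverse (\<Sum>j=1..N. v (\<xi> j (Suc n))) \<partial>system_law N x n)"

text \<open>The tagged component is left out of the numerator: it follows the law
  \<open>\<rho>\<close>, about which nothing is assumed.\<close>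

lemma tagged_iid_sum_lower_bound:
  fixes s :: ennreal
  assumes \<rho>: "\<rho> \<in> space (prob_algebra E)" and \<nu>: "\<nu> \<in> space (prob_algebra E)" and N: "2 \<le> N"
    and \<phi>: "\<phi> \<in> borel_measurable E" and v: "v \<in> borel_measurable E"
    and vs: "\<And>e. e \<in> space E \<Longrightarrow> v e \<le> s"
  shows "of_nat (N - 1) * ((\<integral>\<^sup>+e. \<phi> e \<partial>\<nu>) * inverse (2 * s + of_nat (N - 2) * (\<integral>\<^sup>+e. v e \<partial>\<nu>)))
    \<le> (\<integral>\<^sup>+\<xi>. (\<Sum>k=2..N. \<phi> (\<xi> k)) * inverse (\<Sum>j=1..N. v (\<xi> j)) \<partial>tagged_iid N \<rho> \<nu>)"
proof -
  have s: "sets (tagged_iid N \<rho> \<nu>) = sets (\<Pi>\<^sub>M i\<in>{1..N}. E)" using tagged_iid_prob[OF \<rho> \<nu>] by (simp add: space_prob_algebra)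
  have m: "(\<lambda>\<xi>. \<phi> (\<xi> k) * inverse (\<Sum>j=1..N. v (\<xi> j))) \<in> borel_measurable (tagged_iid N \<rho> \<nu>)" if "k \<in> {2..N}" for k
    unfolding measurable_cong_sets[OF s refl]
  proof (rule borel_measurable_times_ennreal)
    show "(\<lambda>\<xi>. \<phi> (\<xi> k)) \<in> borel_measurable (\<Pi>\<^sub>M i\<in>{1..N}. E)"
      by (rule measurable_compose[OF measurable_component_singleton[of _ _ "\<lambda>_. E"] \<phi>]) (use that in auto)
    have "(\<lambda>\<xi>. \<Sum>j=1..N. v (\<xi> j)) \<in> borel_measurable (\<Pi>\<^sub>M i\<in>{1..N}. E)"
      by (rule borel_measurable_sum, rule measurable_compose[OF measurable_component_singleton[of _ _ "\<lambda>_. E"] v])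
    then show "(\<lambda>\<xi>. inverse (\<Sum>j=1..N. v (\<xi> j))) \<in> borel_measurable (\<Pi>\<^sub>M i\<in>{1..N}. E)" by measurable
  qed
  have "of_nat (N - 1) * ((\<integral>\<^sup>+e. \<phi> e \<partial>\<nu>) * inverse (2 * s + of_nat (N - 2) * (\<integral>\<^sup>+e. v e \<partial>\<nu>)))
    = (\<Sum>k=2..N. (\<integral>\<^sup>+e. \<phi> e \<partial>\<nu>) * inverse (2 * s + of_nat (N - 2) * (\<integral>\<^sup>+e. v e \<partial>\<nu>)))"
    by (simp add: numeral_2_eq_2)
  also have "\<dots> \<le> (\<Sum>k=2..N. \<integral>\<^sup>+\<xi>. \<phi> (\<xi> k) * inverse (\<Sum>j=1..N. v (\<xi> j)) \<partial>tagged_iid N \<rho> \<nu>)"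
    by (rule sum_mono, rule weighted_component_lower_bound[OF \<rho> \<nu> N \<phi> v vs])
  also have "\<dots> = (\<integral>\<^sup>+\<xi>. (\<Sum>k=2..N. \<phi> (\<xi> k)) * inverse (\<Sum>j=1..N. v (\<xi> j)) \<partial>tagged_iid N \<rho> \<nu>)"
    unfolding sum_distrib_right using m by (rule nn_integral_sum[symmetric])
  finally show ?thesis .
qed

text \<open>Induction on time, for all numerators \<open>\<phi>\<close> and all dominated
  \<open>v\<close> at once. Given the generation at time \<open>t\<close>, the inequality for tagged
  samples bounds the conditional mean from below by a ratio of means under the newborn law, and
  \<open>selection_ratio_le\<close> turns it into the ratio at time \<open>t\<close> with numerator
  \<open>\<phi>' = Q\<^bsub>t,t+1\<^esub>(\<phi>)\<close> and denominator \<open>v' = 2 s g\<^sub>t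
  + (N - 2) Q\<^bsub>t,t+1\<^esub>(v)\<close>, where \<open>s\<close> bounds \<open>v\<close>. The
  function \<open>v'\<close> is again dominated, and for the choice \<open>s = \<alpha>
  \<Gamma>\<^bsub>t+1\<^esub>(v) / \<Gamma>\<^bsub>t+1\<^esub>(1)\<close> its mass is \<open>(2
  \<alpha> + N - 2) \<Gamma>\<^bsub>t+1\<^esub>(v)\<close>: the constant does not deteriorate with
  time.\<close>

lemma ratio_mean_lower_bound:
  assumes st: "stable \<alpha>" and N: "2 \<le> N" and n: "Suc n \<le> T" and x: "x \<in> space (paths S T)"
    and \<phi>: "\<phi> \<in> borel_measurable (paths S (Suc n))" and v: "dominated \<alpha> (Suc n) v"
  shows "of_nat (N - 1) ^ Suc n * (\<Gamma>p (Suc n) \<phi> * inverse ((2 * \<alpha> + of_nat (N - 2)) ^ Suc n * \<Gamma> (Suc n) v))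
    \<le> ratio_mean N x n \<phi> v"
  using n \<phi> v
proof (induction n arbitrary: \<phi> v)
  case 0
  have N1: "1 \<le> N" using N by simp
  have vm: "v \<in> borel_measurable S" using "0.prems" by (simp add: dominated_def)
  have x1: "(\<lambda>t\<in>{1::nat}. x 1) \<in> space (paths S 1)"
    using measurable_space[OF init_measurable x] n by simp
  have r: "return (paths S 1) (\<lambda>t\<in>{1::nat}. x 1) \<in> space (prob_algebra (paths S 1))"
    using x1 by (simp add: space_prob_algebra prob_space_return)
  have d1: "dominated \<alpha> 1 v" using "0.prems"(3) by simp
  have vs: "v (e 1) \<le> \<alpha> * \<Gamma> 1 v" if "e \<in> space (paths S 1)" for e
    using dominated_bound[OF order_refl d1, of "e 1"] path_in_space[OF that, of 1] \<Gamma>_one_1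
    by (simp add: divide_ennreal_def del: One_nat_def)
  have "of_nat (N - 1) * ((\<integral>\<^sup>+e. \<phi> e \<partial>chain 1) * inverse (2 * (\<alpha> * \<Gamma> 1 v) + of_nat (N - 2) * (\<integral>\<^sup>+e. v (e 1) \<partial>chain 1)))
    \<le> (\<integral>\<^sup>+\<xi>. (\<Sum>k=2..N. \<phi> (\<xi> k)) * inverse (\<Sum>j=1..N. v (\<xi> j 1)) \<partial>system_law N x 0)"
    unfolding system_law.simps
    by (rule tagged_iid_sum_lower_bound[OF r chain_law_prob[OF order_refl] N _ _ vs])
      (use "0.prems" last_measurable[OF order_refl vm] in auto)
  moreover have "(\<integral>\<^sup>+e. v (e 1) \<partial>chain 1) = \<Gamma> 1 v" by (rule nn_integral_chain_1_last[OF vm])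
  moreover have "2 * (\<alpha> * \<Gamma> 1 v) + of_nat (N - 2) * \<Gamma> 1 v = (2 * \<alpha> + of_nat (N - 2)) * \<Gamma> 1 v"
    by (simp add: distrib_right mult.assoc)
  ultimately show ?case using "0.prems" \<Gamma>p_1[of \<phi>] by (simp add: ratio_mean_def)
next
  case (Suc n)
  let ?t = "Suc n" and ?\<phi>' = "fk_op_path (Suc n) \<phi>"
  have N1: "1 \<le> N" using N by simp
  have t: "1 \<le> ?t" by simp
  have vm: "v \<in> borel_measurable S" using Suc.prems by (simp add: dominated_def)
  define s where "s = \<alpha> * \<Gamma> (Suc ?t) v / \<Gamma> (Suc ?t) (\<lambda>_. 1)"
  define v' where "v' = (\<lambda>z. (2 * s) * g ?t z + of_nat (N - 2) * fk_op ?t v z)"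
  note Bvm = fk_op_measurable[OF t vm]
  have dv: "dominated \<alpha> ?t (fk_op ?t v)" by (rule dominated_fk_op) (use Suc.prems in auto)
  have dg: "dominated \<alpha> ?t (\<lambda>z. (2 * s) * g ?t z)" by (rule dominated_cmult[OF dominated_g[OF st t] t])
  have dv': "dominated \<alpha> ?t v'" unfolding v'_def by (rule dominated_add[OF dg dominated_cmult[OF dv t] t])
  have v'm: "v' \<in> borel_measurable S" using dv' by (simp add: dominated_def)
  have \<phi>': "?\<phi>' \<in> borel_measurable (paths S ?t)" by (rule fk_op_path_measurable[OF t Suc.prems(2)])
  have one: "0 < \<Gamma> (Suc ?t) (\<lambda>_. 1)" "\<Gamma> (Suc ?t) (\<lambda>_. 1) < \<infinity>" using \<Gamma>_one_pos_fin[of "Suc ?t"] by auto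
  have \<Gamma>v': "\<Gamma> ?t v' = (2 * \<alpha> + of_nat (N - 2)) * \<Gamma> (Suc ?t) v"
  proof -
    have "\<Gamma> ?t v' = 2 * s * \<Gamma> (Suc ?t) (\<lambda>_. 1) + of_nat (N - 2) * \<Gamma> (Suc ?t) v"
      unfolding v'_def \<Gamma>_Suc[OF t vm] \<Gamma>_g[OF t, symmetric]
      using t Bvm g_measurable[OF t] by (simp add: \<Gamma>_add \<Gamma>_cmult)
    also have "2 * s * \<Gamma> (Suc ?t) (\<lambda>_. 1) = 2 * (\<alpha> * \<Gamma> (Suc ?t) v)"
      using one by (simp add: s_def mult.assoc ennreal_divide_times)
    finally show ?thesis by (simp add: distrib_right mult.assoc)
  qed
  have vs: "v (e (Suc ?t)) \<le> s" if "e \<in> space (paths S (Suc ?t))" for e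
    unfolding s_def by (rule dominated_bound) (use Suc.prems path_in_space[OF that] in auto)
  have vem: "(\<lambda>e. v (e (Suc ?t))) \<in> borel_measurable (paths S (Suc ?t))" by (rule last_measurable[OF _ vm]) simp
  have sD: "sets (system_law N x n) = sets (systems N ?t)" using system_law_prob[of N n T x] N1 Suc.prems x by (simp add: space_prob_algebra)
  have spD: "space (system_law N x n) = space (systems N ?t)" by (rule sets_eq_imp_space_eq[OF sD])
  have sumv: "(\<lambda>\<xi>. inverse (\<Sum>j=1..N. u (\<xi> j t))) \<in> borel_measurable (systems N t)" if "u \<in> borel_measurable S" "1 \<le> t" for u :: "'z \<Rightarrow> ennreal" and t
  proof -
    have "(\<lambda>\<xi>. \<Sum>j=1..N. u (\<xi> j t)) \<in> borel_measurable (systems N t)"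
      by (rule borel_measurable_sum, rule systems_last_measurable) (use that in auto)
    then show ?thesis by measurable
  qed
  have sum\<phi>: "(\<lambda>\<xi>. \<Sum>k=2..N. u (\<xi> k)) \<in> borel_measurable (systems N t)" if "u \<in> borel_measurable (paths S t)" for u :: "(nat \<Rightarrow> 'z) \<Rightarrow> ennreal" and t
    by (rule borel_measurable_sum, rule measurable_compose[OF systems_component that]) auto
  have pointwise: "of_nat (N - 1) * ((\<Sum>k=2..N. ?\<phi>' (\<xi> k)) * inverse (\<Sum>j=1..N. v' (\<xi> j ?t)))
      \<le> (\<integral>\<^sup>+\<xi>'. (\<Sum>k=2..N. \<phi> (\<xi>' k)) * inverse (\<Sum>j=1..N. v (\<xi>' j (Suc ?t))) \<partial>csmc_kernel N ?t x \<xi>)"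
    if \<xi>: "\<xi> \<in> space (systems N ?t)" for \<xi>
  proof -
    let ?a = "\<lambda>k. \<integral>\<^sup>+e. \<phi> e \<partial>grow ?t (\<xi> k)" and ?b = "\<lambda>k. \<integral>\<^sup>+e. v (e (Suc ?t)) \<partial>grow ?t (\<xi> k)"
    have b: "?b k = (\<integral>\<^sup>+y. v y \<partial>M (Suc ?t) (\<xi> k ?t))" if "k \<in> {1..N}" for k
      by (subst nn_integral_grow[OF t systems_in_paths[OF \<xi> that] vem]) simp
    have r: "return (paths S (Suc ?t)) ((\<xi> 1)(Suc ?t := x (Suc ?t))) \<in> space (prob_algebra (paths S (Suc ?t)))"
      using extended_reference_in_space[OF N1 Suc.prems(1) x \<xi>] by (simp add: space_prob_algebra prob_space_return)
    have G0: "0 \<le> G ?t (\<xi> k ?t)" if "k \<in> {1..N}" for k using G_nonneg[OF t systems_in_S[OF \<xi> that t]] .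
    have e1: "(\<Sum>k=2..N. ?\<phi>' (\<xi> k)) = (\<Sum>k=2..N. ennreal (G ?t (\<xi> k ?t)) * ?a k)"
      by (simp add: fk_op_path_def g_def)
    have e2: "(\<Sum>j=1..N. v' (\<xi> j ?t)) = 2 * s * (\<Sum>k=1..N. ennreal (G ?t (\<xi> k ?t))) + of_nat (N - 2) * (\<Sum>k=1..N. ennreal (G ?t (\<xi> k ?t)) * ?b k)"
      unfolding v'_def sum.distrib sum_distrib_left fk_op_def g_def using b by simp
    have "of_nat (N - 1) * ((\<Sum>k=2..N. ?\<phi>' (\<xi> k)) * inverse (\<Sum>j=1..N. v' (\<xi> j ?t)))
      \<le> of_nat (N - 1) * ((\<Sum>k=1..N. weight N ?t \<xi> k * ?a k) * inverse (2 * s + of_nat (N - 2) * (\<Sum>k=1..N. weight N ?t \<xi> k * ?b k)))"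
      unfolding e1 e2 by (intro mult_left_mono selection_ratio_le G0) auto
    also have "\<dots> = of_nat (N - 1) * ((\<integral>\<^sup>+e. \<phi> e \<partial>newborn N ?t \<xi>) * inverse (2 * s + of_nat (N - 2) * (\<integral>\<^sup>+e. v (e (Suc ?t)) \<partial>newborn N ?t \<xi>)))"
      unfolding nn_integral_newborn[OF t N1 \<xi> Suc.prems(2)] nn_integral_newborn[OF t N1 \<xi> vem] ..
    also have "\<dots> \<le> (\<integral>\<^sup>+\<xi>'. (\<Sum>k=2..N. \<phi> (\<xi>' k)) * inverse (\<Sum>j=1..N. v (\<xi>' j (Suc ?t))) \<partial>csmc_kernel N ?t x \<xi>)"
      unfolding csmc_kernel_def by (rule tagged_iid_sum_lower_bound[OF r newborn_prob[OF t N1 \<xi>] N Suc.prems(2) vem]) (rule vs)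
    finally show ?thesis .
  qed
  have "of_nat (N - 1) ^ Suc ?t * (\<Gamma>p (Suc ?t) \<phi> * inverse ((2 * \<alpha> + of_nat (N - 2)) ^ Suc ?t * \<Gamma> (Suc ?t) v))
    = of_nat (N - 1) * (of_nat (N - 1) ^ ?t * (\<Gamma>p ?t ?\<phi>' * inverse ((2 * \<alpha> + of_nat (N - 2)) ^ ?t * \<Gamma> ?t v')))"
    unfolding \<Gamma>v' \<Gamma>p_Suc[OF t Suc.prems(2)] by (simp add: mult_ac)
  also have "\<dots> \<le> of_nat (N - 1) * ratio_mean N x n ?\<phi>' v'"
    using Suc.prems by (intro mult_left_mono Suc.IH \<phi>' dv') auto
  also have "\<dots> = (\<integral>\<^sup>+\<xi>. of_nat (N - 1) * ((\<Sum>k=2..N. ?\<phi>' (\<xi> k)) * inverse (\<Sum>j=1..N. v' (\<xi> j ?t))) \<partial>system_law N x n)"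
    unfolding ratio_mean_def
    by (rule nn_integral_cmult[symmetric], unfold measurable_cong_sets[OF sD refl])
      (rule borel_measurable_times_ennreal[OF sum\<phi>[OF \<phi>'] sumv[OF v'm t]])
  also have "\<dots> \<le> (\<integral>\<^sup>+\<xi>. \<integral>\<^sup>+\<xi>'. (\<Sum>k=2..N. \<phi> (\<xi>' k)) * inverse (\<Sum>j=1..N. v (\<xi>' j (Suc ?t))) \<partial>csmc_kernel N ?t x \<xi> \<partial>system_law N x n)"
    by (rule nn_integral_mono, rule pointwise) (simp add: spD)
  also have "\<dots> = ratio_mean N x ?t \<phi> v"
    unfolding ratio_mean_def
    by (rule nn_integral_system_law_Suc[OF N1 Suc.prems(1) x, symmetric])
      (rule borel_measurable_times_ennreal[OF sum\<phi>[OF Suc.prems(2)] sumv[OF vm]], simp)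
  finally show ?case .
qed

section \<open>Exchangeability under the extended target\<close>

definition permute :: "nat \<Rightarrow> (nat \<Rightarrow> nat) \<Rightarrow> (nat \<Rightarrow> nat \<Rightarrow> 'z) \<Rightarrow> nat \<Rightarrow> nat \<Rightarrow> 'z" where
  "permute N \<tau> \<xi> = (\<lambda>i\<in>{1..N}. \<xi> (\<tau> i))"

text \<open>The unnormalised law of the particle system whose reference path is drawn along with it:
  the tagged particle is weighted by its potential and moves by the chain itself, not by selection.
  The potential at the last time \<open>n + 1\<close> is not included.\<close>

primrec extended_law :: "nat \<Rightarrow> nat \<Rightarrow> (nat \<Rightarrow> nat \<Rightarrow> 'z) measure" where
  "extended_law N 0 = tagged_iid N (chain 1) (chain 1)"
| "extended_law N (Suc n) = density (extended_law N n) (\<lambda>\<xi>. g (Suc n) (\<xi> 1 (Suc n))) \<bind>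
     (\<lambda>\<xi>. tagged_iid N (grow (Suc n) (\<xi> 1)) (newborn N (Suc n) \<xi>))"

definition total_weight :: "nat \<Rightarrow> nat \<Rightarrow> (nat \<Rightarrow> nat \<Rightarrow> 'z) \<Rightarrow> ennreal" where
  "total_weight N t \<xi> = (\<Sum>j=1..N. g t (\<xi> j t))"

lemma tagged_kernel_measurable:
  assumes "1 \<le> t" "1 \<le> N"
  shows "(\<lambda>\<xi>. tagged_iid N (grow t (\<xi> 1)) (newborn N t \<xi>)) \<in> systems N t \<rightarrow>\<^sub>M prob_algebra (systems N (Suc t))"
  by (rule tagged_iid_measurable[OF measurable_compose[OF systems_component grow_measurable] newborn_measurable]) (use assms in auto)

lemma systems_nonempty: "1 \<le> t \<Longrightarrow> space (systems N t) \<noteq> {}"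
proof -
  assume t: "1 \<le> t"
  have "space (paths S t) \<noteq> {}"
    using prob_space.not_empty[OF prob_chain_law[OF t]] by (simp add: space_chain_law[OF t])
  then show ?thesis by (simp add: space_PiM_empty_iff)
qed

lemma sets_extended_law: "1 \<le> N \<Longrightarrow> sets (extended_law N n) = sets (systems N (Suc n))"
proof (induction n)
  case 0
  show ?case using tagged_iid_prob[OF chain_law_prob[of 1] chain_law_prob[of 1], of N] by (simp add: space_prob_algebra)
next
  case (Suc n)
  let ?D = "density (extended_law N n) (\<lambda>\<xi>. g (Suc n) (\<xi> 1 (Suc n)))"
  have s: "sets ?D = sets (systems N (Suc n))" using Suc by simp
  have "(\<lambda>\<xi>. tagged_iid N (grow (Suc n) (\<xi> 1)) (newborn N (Suc n) \<xi>)) \<in> ?D \<rightarrow>\<^sub>M subprob_algebra (systems N (Suc (Suc n)))"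
    unfolding measurable_cong_sets[OF s refl]
    by (rule measurable_prob_algebraD[OF tagged_kernel_measurable]) (use Suc in auto)
  from sets_bind_measurable[OF this] show ?case
    using systems_nonempty[of "Suc n" N] sets_eq_imp_space_eq[OF s] by simp
qed

lemma space_extended_law: "1 \<le> N \<Longrightarrow> space (extended_law N n) = space (systems N (Suc n))"
  by (rule sets_eq_imp_space_eq[OF sets_extended_law])

lemma extended_law_measurable_iff: "1 \<le> N \<Longrightarrow> borel_measurable (extended_law N n) = borel_measurable (systems N (Suc n))"
  by (rule measurable_cong_sets[OF sets_extended_law refl])

lemma nn_integral_extended_law_Suc:
  assumes N: "1 \<le> N" and F: "F \<in> borel_measurable (systems N (Suc (Suc n)))"
  shows "(\<integral>\<^sup>+\<xi>. F \<xi> \<partial>extended_law N (Suc n)) =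
    (\<integral>\<^sup>+\<xi>. g (Suc n) (\<xi> 1 (Suc n)) * (\<integral>\<^sup>+\<xi>'. F \<xi>' \<partial>tagged_iid N (grow (Suc n) (\<xi> 1)) (newborn N (Suc n) \<xi>)) \<partial>extended_law N n)"
proof -
  let ?D = "density (extended_law N n) (\<lambda>\<xi>. g (Suc n) (\<xi> 1 (Suc n)))"
  have s: "sets ?D = sets (systems N (Suc n))" using sets_extended_law[OF N] by simp
  have k: "(\<lambda>\<xi>. tagged_iid N (grow (Suc n) (\<xi> 1)) (newborn N (Suc n) \<xi>)) \<in> systems N (Suc n) \<rightarrow>\<^sub>M subprob_algebra (systems N (Suc (Suc n)))"
    by (rule measurable_prob_algebraD[OF tagged_kernel_measurable]) (use N in auto)
  then have k': "(\<lambda>\<xi>. tagged_iid N (grow (Suc n) (\<xi> 1)) (newborn N (Suc n) \<xi>)) \<in> ?D \<rightarrow>\<^sub>M subprob_algebra (systems N (Suc (Suc n)))"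
    unfolding measurable_cong_sets[OF s refl] .
  show ?thesis
    unfolding extended_law.simps nn_integral_bind[OF F k']
  proof (rule nn_integral_density)
    show "(\<lambda>\<xi>. g (Suc n) (\<xi> 1 (Suc n))) \<in> borel_measurable (extended_law N n)"
      unfolding extended_law_measurable_iff[OF N] by (rule systems_last_measurable) (use N in auto)
    show "(\<lambda>\<xi>. \<integral>\<^sup>+\<xi>'. F \<xi>' \<partial>tagged_iid N (grow (Suc n) (\<xi> 1)) (newborn N (Suc n) \<xi>)) \<in> borel_measurable (extended_law N n)"
      unfolding extended_law_measurable_iff[OF N] by (rule measurable_compose[OF k nn_integral_measurable_subprob_algebra[OF F]])
  qed
qed

lemma permute_measurable: "bij_betw \<tau> {1..N} {1..N} \<Longrightarrow> permute N \<tau> \<in> systems N t \<rightarrow>\<^sub>M systems N t"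
  unfolding permute_def by (rule measurable_restrict, rule systems_component) (auto simp: bij_betw_def)

lemma permute_in_space: "bij_betw \<tau> {1..N} {1..N} \<Longrightarrow> \<xi> \<in> space (systems N t) \<Longrightarrow> permute N \<tau> \<xi> \<in> space (systems N t)"
  by (rule measurable_space[OF permute_measurable])

lemma total_weight_eq_0_iff: "\<xi> \<in> space (systems N t) \<Longrightarrow> 1 \<le> t \<Longrightarrow> total_weight N t \<xi> = 0 \<longleftrightarrow> (\<Sum>j=1..N. G t (\<xi> j t)) = 0"
proof -
  assume \<xi>: "\<xi> \<in> space (systems N t)" and t: "1 \<le> t"
  have nn: "0 \<le> G t (\<xi> j t)" if "j \<in> {1..N}" for j by (rule G_nonneg[OF t systems_in_S[OF \<xi> that t]])
  have "total_weight N t \<xi> = ennreal (\<Sum>j=1..N. G t (\<xi> j t))"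
    unfolding total_weight_def g_def by (rule sum_ennreal) (use nn in auto)
  moreover have "0 \<le> (\<Sum>j=1..N. G t (\<xi> j t))" by (rule sum_nonneg) (use nn in auto)
  ultimately show ?thesis by (simp add: ennreal_eq_0_iff)
qed

lemma g_eq_total_mult_weight: "\<xi> \<in> space (systems N t) \<Longrightarrow> 1 \<le> t \<Longrightarrow> k \<in> {1..N} \<Longrightarrow> g t (\<xi> k t) = total_weight N t \<xi> * weight N t \<xi> k"
proof -
  assume \<xi>: "\<xi> \<in> space (systems N t)" and t: "1 \<le> t" and k: "k \<in> {1..N}"
  have nn: "0 \<le> G t (\<xi> j t)" if "j \<in> {1..N}" for j by (rule G_nonneg[OF t systems_in_S[OF \<xi> that t]])
  show ?thesis using select_weight_mult_total[of N "\<lambda>k. G t (\<xi> k t)" k, OF nn k] by (simp add: total_weight_def g_def mult.commute)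
qed

lemma weight_permute:
  assumes \<tau>: "bij_betw \<tau> {1..N} {1..N}" and \<xi>: "\<xi> \<in> space (systems N t)" and t: "1 \<le> t"
    and pos: "total_weight N t \<xi> \<noteq> 0" and k: "k \<in> {1..N}"
  shows "weight N t (permute N \<tau> \<xi>) k = weight N t \<xi> (\<tau> k)"
proof -
  have "weight N t (permute N \<tau> \<xi>) k = select_weight N (\<lambda>k. G t (\<xi> (\<tau> k) t)) k"
    by (rule select_weight_cong[OF _ k]) (simp add: permute_def)
  also have "\<dots> = weight N t \<xi> (\<tau> k)"
    by (rule select_weight_cong_permute[OF \<tau>, of "\<lambda>k. G t (\<xi> k t)"]) (use pos total_weight_eq_0_iff[OF \<xi> t] in simp)
  finally show ?thesis .
qed

lemma selection_mean_permute:
  assumes \<tau>: "bij_betw \<tau> {1..N} {1..N}" and \<xi>: "\<xi> \<in> space (systems N t)" and t: "1 \<le> t"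
    and pos: "total_weight N t \<xi> \<noteq> 0"
  shows "(\<Sum>k=1..N. weight N t (permute N \<tau> \<xi>) k * f (permute N \<tau> \<xi> k)) = (\<Sum>k=1..N. weight N t \<xi> k * f (\<xi> k))"
proof -
  have "(\<Sum>k=1..N. weight N t (permute N \<tau> \<xi>) k * f (permute N \<tau> \<xi> k)) = (\<Sum>k=1..N. weight N t \<xi> (\<tau> k) * f (\<xi> (\<tau> k)))"
  proof (rule sum.cong[OF refl])
    fix k assume k: "k \<in> {1..N}"
    then have "permute N \<tau> \<xi> k = \<xi> (\<tau> k)" by (simp add: permute_def)
    then show "weight N t (permute N \<tau> \<xi>) k * f (permute N \<tau> \<xi> k) = weight N t \<xi> (\<tau> k) * f (\<xi> (\<tau> k))"
      by (simp only: weight_permute[OF \<tau> \<xi> t pos k])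
  qed
  also have "\<dots> = (\<Sum>k=1..N. weight N t \<xi> k * f (\<xi> k))"
    by (rule sum.reindex_bij_betw[OF \<tau>])
  finally show ?thesis .
qed

lemma newborn_permute:
  assumes \<tau>: "bij_betw \<tau> {1..N} {1..N}" and \<xi>: "\<xi> \<in> space (systems N t)" and t: "1 \<le> t" and N: "1 \<le> N"
    and pos: "total_weight N t \<xi> \<noteq> 0"
  shows "newborn N t (permute N \<tau> \<xi>) = newborn N t \<xi>"
proof (rule measure_eqI)
  note p = permute_in_space[OF \<tau> \<xi>]
  have s: "sets (newborn N t (permute N \<tau> \<xi>)) = sets (paths S (Suc t))" "sets (newborn N t \<xi>) = sets (paths S (Suc t))"
    using newborn_prob[OF t N p] newborn_prob[OF t N \<xi>] by (auto simp: space_prob_algebra)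
  then show "sets (newborn N t (permute N \<tau> \<xi>)) = sets (newborn N t \<xi>)" by simp
  fix X assume X: "X \<in> sets (newborn N t (permute N \<tau> \<xi>))"
  then have X': "X \<in> sets (paths S (Suc t))" by (simp add: s)
  have m: "indicator X \<in> borel_measurable (paths S (Suc t))" using X' by simp
  have "emeasure (newborn N t (permute N \<tau> \<xi>)) X = (\<integral>\<^sup>+e. indicator X e \<partial>newborn N t (permute N \<tau> \<xi>))" using X by simp
  also have "\<dots> = (\<integral>\<^sup>+e. indicator X e \<partial>newborn N t \<xi>)"
    unfolding nn_integral_newborn[OF t N p m] nn_integral_newborn[OF t N \<xi> m]
    by (rule selection_mean_permute[OF \<tau> \<xi> t pos])
  also have "\<dots> = emeasure (newborn N t \<xi>) X" using X' by (simp add: s)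
  finally show "emeasure (newborn N t (permute N \<tau> \<xi>)) X = emeasure (newborn N t \<xi>) X" .
qed

definition exchangeable :: "nat \<Rightarrow> nat \<Rightarrow> bool" where
  "exchangeable N n \<longleftrightarrow> (\<forall>\<tau> F. bij_betw \<tau> {1..N} {1..N} \<longrightarrow> F \<in> borel_measurable (systems N (Suc n)) \<longrightarrow>
     (\<integral>\<^sup>+\<xi>. F (permute N \<tau> \<xi>) \<partial>extended_law N n) = (\<integral>\<^sup>+\<xi>. F \<xi> \<partial>extended_law N n))"

lemma exchangeableD:
  "exchangeable N n \<Longrightarrow> bij_betw \<tau> {1..N} {1..N} \<Longrightarrow> F \<in> borel_measurable (systems N (Suc n)) \<Longrightarrow>
    (\<integral>\<^sup>+\<xi>. F (permute N \<tau> \<xi>) \<partial>extended_law N n) = (\<integral>\<^sup>+\<xi>. F \<xi> \<partial>extended_law N n)"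
  by (simp add: exchangeable_def)

text \<open>By exchangeability any particle may take the place of particle 1; averaging over them
  turns the factor \<open>g(\<xi>\<^sub>1)\<close> into \<open>N\<^sup>-\<^sup>1\<close> times the
  total weight times a selection of the tagged particle. Configurations of zero total weight
  contribute 0 to both sides, so invariance of \<open>h\<close> is needed only off them.\<close>

lemma symmetrise:
  fixes h :: "(nat \<Rightarrow> 'z) \<Rightarrow> (nat \<Rightarrow> nat \<Rightarrow> 'z) \<Rightarrow> ennreal"
  assumes ex: "exchangeable N n" and N: "1 \<le> N"
    and hm: "\<And>k. k \<in> {1..N} \<Longrightarrow> (\<lambda>\<xi>. h (\<xi> k) \<xi>) \<in> borel_measurable (systems N (Suc n))"
    and inv: "\<And>\<tau> \<xi> e. bij_betw \<tau> {1..N} {1..N} \<Longrightarrow> \<xi> \<in> space (systems N (Suc n)) \<Longrightarrow> total_weight N (Suc n) \<xi> \<noteq> 0 \<Longrightarrow>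
      h e (permute N \<tau> \<xi>) = h e \<xi>"
  shows "(\<integral>\<^sup>+\<xi>. g (Suc n) (\<xi> 1 (Suc n)) * h (\<xi> 1) \<xi> \<partial>extended_law N n) =
    inverse (of_nat N) * (\<integral>\<^sup>+\<xi>. total_weight N (Suc n) \<xi> * (\<Sum>k=1..N. weight N (Suc n) \<xi> k * h (\<xi> k) \<xi>) \<partial>extended_law N n)"
proof -
  let ?t = "Suc n"
  let ?I = "\<integral>\<^sup>+\<xi>. g ?t (\<xi> 1 ?t) * h (\<xi> 1) \<xi> \<partial>extended_law N n"
  have gm: "(\<lambda>\<xi>. g ?t (\<xi> k ?t) * h (\<xi> k) \<xi>) \<in> borel_measurable (systems N ?t)" if "k \<in> {1..N}" for k
    by (intro borel_measurable_times_ennreal hm systems_last_measurable g_measurable that) auto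
  have one: "?I = (\<integral>\<^sup>+\<xi>. g ?t (\<xi> k ?t) * h (\<xi> k) \<xi> \<partial>extended_law N n)" if k: "k \<in> {1..N}" for k
  proof -
    \<comment> \<open>Swapping the labels 1 and \<open>k\<close> brings particle \<open>k\<close> into
      the tagged position.\<close>
    define \<tau> where "\<tau> = Transposition.transpose 1 k"
    have \<tau>: "bij_betw \<tau> {1..N} {1..N}"
      unfolding \<tau>_def using k N
      by (intro bij_betw_byWitness[where f'="Transposition.transpose 1 k"]) (auto simp: Transposition.transpose_def)
    have 1: "1 \<in> {1..N}" using N by simp
    have "?I = (\<integral>\<^sup>+\<xi>. g ?t (permute N \<tau> \<xi> 1 ?t) * h (permute N \<tau> \<xi> 1) (permute N \<tau> \<xi>) \<partial>extended_law N n)"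
      by (rule exchangeableD[OF ex \<tau> gm[OF 1], symmetric])
    also have "\<dots> = (\<integral>\<^sup>+\<xi>. g ?t (\<xi> k ?t) * h (\<xi> k) \<xi> \<partial>extended_law N n)"
    proof (rule nn_integral_cong)
      fix \<xi> assume "\<xi> \<in> space (extended_law N n)"
      then have \<xi>: "\<xi> \<in> space (systems N ?t)" by (simp add: space_extended_law[OF N])
      have p1: "permute N \<tau> \<xi> 1 = \<xi> k" using N by (simp add: permute_def \<tau>_def)
      show "g ?t (permute N \<tau> \<xi> 1 ?t) * h (permute N \<tau> \<xi> 1) (permute N \<tau> \<xi>) = g ?t (\<xi> k ?t) * h (\<xi> k) \<xi>"
      proof (cases "total_weight N ?t \<xi> = 0")
        case True
        then have "g ?t (\<xi> k ?t) = 0" using g_eq_total_mult_weight[OF \<xi> _ k] by simp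
        then show ?thesis unfolding p1 by simp
      next
        case False
        show ?thesis unfolding p1 inv[OF \<tau> \<xi> False] ..
      qed
    qed
    finally show ?thesis .
  qed
  have "of_nat N * ?I = (\<Sum>k=1..N. ?I)" by simp
  also have "\<dots> = (\<Sum>k=1..N. \<integral>\<^sup>+\<xi>. g ?t (\<xi> k ?t) * h (\<xi> k) \<xi> \<partial>extended_law N n)"
    by (rule sum.cong[OF refl one])
  also have "\<dots> = (\<integral>\<^sup>+\<xi>. (\<Sum>k=1..N. g ?t (\<xi> k ?t) * h (\<xi> k) \<xi>) \<partial>extended_law N n)"
    by (rule nn_integral_sum[symmetric], unfold extended_law_measurable_iff[OF N], rule gm)
  also have "\<dots> = (\<integral>\<^sup>+\<xi>. total_weight N ?t \<xi> * (\<Sum>k=1..N. weight N ?t \<xi> k * h (\<xi> k) \<xi>) \<partial>extended_law N n)"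
    unfolding sum_distrib_left
    by (intro nn_integral_cong sum.cong refl) (simp add: space_extended_law[OF N] g_eq_total_mult_weight mult.assoc)
  finally have e: "of_nat N * ?I = (\<integral>\<^sup>+\<xi>. total_weight N ?t \<xi> * (\<Sum>k=1..N. weight N ?t \<xi> k * h (\<xi> k) \<xi>) \<partial>extended_law N n)" .
  have "(of_nat N :: ennreal) \<noteq> 0" "(of_nat N :: ennreal) < top"
    using N by (auto simp: ennreal_of_nat_eq_real_of_nat ennreal_eq_0_iff)
  then have "inverse (of_nat N) * of_nat N = (1 :: ennreal)"
    using ennreal_divide_self[of "of_nat N"] by (simp add: divide_ennreal_def mult.commute)
  then have "?I = inverse (of_nat N) * (of_nat N * ?I)" by (simp only: mult.assoc[symmetric] mult_1_left)
  then show ?thesis unfolding e .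
qed

text \<open>After symmetrisation the tagged particle descends from a selected parent, exactly like
  the \<open>N - 1\<close> others: the new generation is an independent sample from the newborn
  law.\<close>

lemma nn_integral_extended_law_Suc_sym:
  assumes ex: "exchangeable N n" and N: "1 \<le> N" and F: "F \<in> borel_measurable (systems N (Suc (Suc n)))"
  shows "(\<integral>\<^sup>+\<xi>. F \<xi> \<partial>extended_law N (Suc n)) =
    inverse (of_nat N) * (\<integral>\<^sup>+\<xi>. total_weight N (Suc n) \<xi> * (\<integral>\<^sup>+\<xi>'. F \<xi>' \<partial>tagged_iid N (newborn N (Suc n) \<xi>) (newborn N (Suc n) \<xi>)) \<partial>extended_law N n)"
proof -
  let ?t = "Suc n"
  have t: "1 \<le> ?t" by simp
  let ?h = "\<lambda>e \<xi>. \<integral>\<^sup>+\<xi>'. F \<xi>' \<partial>tagged_iid N (grow ?t e) (newborn N ?t \<xi>)"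
  have "(\<integral>\<^sup>+\<xi>. g ?t (\<xi> 1 ?t) * ?h (\<xi> 1) \<xi> \<partial>extended_law N n) =
    inverse (of_nat N) * (\<integral>\<^sup>+\<xi>. total_weight N ?t \<xi> * (\<Sum>k=1..N. weight N ?t \<xi> k * ?h (\<xi> k) \<xi>) \<partial>extended_law N n)"
  proof (rule symmetrise[OF ex N])
    show "(\<lambda>\<xi>. ?h (\<xi> k) \<xi>) \<in> borel_measurable (systems N ?t)" if "k \<in> {1..N}" for k
      by (rule measurable_compose[OF measurable_prob_algebraD[OF tagged_iid_measurable[OF
            measurable_compose[OF systems_component[OF that] grow_measurable[OF t]] newborn_measurable[OF t N]]]
            nn_integral_measurable_subprob_algebra[OF F]])
    show "?h e (permute N \<tau> \<xi>) = ?h e \<xi>"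
      if "bij_betw \<tau> {1..N} {1..N}" "\<xi> \<in> space (systems N ?t)" "total_weight N ?t \<xi> \<noteq> 0" for \<tau> \<xi> e
      unfolding newborn_permute[OF that(1,2) t N that(3)] ..
  qed
  also have "(\<integral>\<^sup>+\<xi>. total_weight N ?t \<xi> * (\<Sum>k=1..N. weight N ?t \<xi> k * ?h (\<xi> k) \<xi>) \<partial>extended_law N n) =
    (\<integral>\<^sup>+\<xi>. total_weight N ?t \<xi> * (\<integral>\<^sup>+\<xi>'. F \<xi>' \<partial>tagged_iid N (newborn N ?t \<xi>) (newborn N ?t \<xi>)) \<partial>extended_law N n)"
  proof (rule nn_integral_cong)
    fix \<xi> assume "\<xi> \<in> space (extended_law N n)"
    then have \<xi>: "\<xi> \<in> space (systems N ?t)" by (simp add: space_extended_law[OF N])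
    note mp = newborn_prob[OF t N \<xi>]
    have "(\<Sum>k=1..N. weight N ?t \<xi> k * ?h (\<xi> k) \<xi>) =
       (\<Sum>k=1..N. weight N ?t \<xi> k * (\<integral>\<^sup>+e. \<integral>\<^sup>+\<xi>'. F \<xi>' \<partial>tagged_iid N (return (paths S (Suc ?t)) e) (newborn N ?t \<xi>) \<partial>grow ?t (\<xi> k)))"
    proof (rule sum.cong[OF refl])
      fix k assume k: "k \<in> {1..N}"
      show "weight N ?t \<xi> k * ?h (\<xi> k) \<xi> = weight N ?t \<xi> k * (\<integral>\<^sup>+e. \<integral>\<^sup>+\<xi>'. F \<xi>' \<partial>tagged_iid N (return (paths S (Suc ?t)) e) (newborn N ?t \<xi>) \<partial>grow ?t (\<xi> k))"
        unfolding nn_integral_tagged_iid_mixture[OF grow_prob[OF t systems_in_paths[OF \<xi> k]] mp N F] ..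
    qed
    also have "\<dots> = (\<integral>\<^sup>+e. \<integral>\<^sup>+\<xi>'. F \<xi>' \<partial>tagged_iid N (return (paths S (Suc ?t)) e) (newborn N ?t \<xi>) \<partial>newborn N ?t \<xi>)"
      by (rule nn_integral_newborn[OF t N \<xi> nn_integral_tagged_iid_return_measurable[OF mp F], symmetric])
    also have "\<dots> = (\<integral>\<^sup>+\<xi>'. F \<xi>' \<partial>tagged_iid N (newborn N ?t \<xi>) (newborn N ?t \<xi>))"
      by (rule nn_integral_tagged_iid_mixture[OF mp mp N F, symmetric])
    finally show "total_weight N ?t \<xi> * (\<Sum>k=1..N. weight N ?t \<xi> k * ?h (\<xi> k) \<xi>) = total_weight N ?t \<xi> * (\<integral>\<^sup>+\<xi>'. F \<xi>' \<partial>tagged_iid N (newborn N ?t \<xi>) (newborn N ?t \<xi>))"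
      by simp
  qed
  finally show ?thesis unfolding nn_integral_extended_law_Suc[OF N F] .
qed

lemma extended_law_exchangeable: "1 \<le> N \<Longrightarrow> exchangeable N n"
proof (induction n)
  case 0
  note c = chain_law_prob[of 1, OF order_refl]
  show ?case unfolding exchangeable_def
  proof (intro allI impI)
    fix \<tau> and F :: "(nat \<Rightarrow> nat \<Rightarrow> 'z) \<Rightarrow> ennreal"
    assume \<tau>: "bij_betw \<tau> {1..N} {1..N}" and F: "F \<in> borel_measurable (systems N (Suc 0))"
    show "(\<integral>\<^sup>+\<xi>. F (permute N \<tau> \<xi>) \<partial>extended_law N 0) = (\<integral>\<^sup>+\<xi>. F \<xi> \<partial>extended_law N 0)"
      using nn_integral_tagged_iid_permute[OF c \<tau>, of F] F by (simp add: permute_def)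
  qed
next
  case (Suc n)
  have ex: "exchangeable N n" and N: "1 \<le> N" using Suc by auto
  show ?case unfolding exchangeable_def
  proof (intro allI impI)
    fix \<tau> and F :: "(nat \<Rightarrow> nat \<Rightarrow> 'z) \<Rightarrow> ennreal"
    assume \<tau>: "bij_betw \<tau> {1..N} {1..N}" and F: "F \<in> borel_measurable (systems N (Suc (Suc n)))"
    have Fp: "(\<lambda>\<xi>. F (permute N \<tau> \<xi>)) \<in> borel_measurable (systems N (Suc (Suc n)))"
      by (rule measurable_compose[OF permute_measurable[OF \<tau>] F])
    have "(\<integral>\<^sup>+\<xi>. total_weight N (Suc n) \<xi> * (\<integral>\<^sup>+\<xi>'. F (permute N \<tau> \<xi>') \<partial>tagged_iid N (newborn N (Suc n) \<xi>) (newborn N (Suc n) \<xi>)) \<partial>extended_law N n) =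
      (\<integral>\<^sup>+\<xi>. total_weight N (Suc n) \<xi> * (\<integral>\<^sup>+\<xi>'. F \<xi>' \<partial>tagged_iid N (newborn N (Suc n) \<xi>) (newborn N (Suc n) \<xi>)) \<partial>extended_law N n)"
    proof (rule nn_integral_cong)
      fix \<xi> assume "\<xi> \<in> space (extended_law N n)"
      then have \<xi>: "\<xi> \<in> space (systems N (Suc n))" by (simp add: space_extended_law[OF N])
      have mp: "newborn N (Suc n) \<xi> \<in> space (prob_algebra (paths S (Suc (Suc n))))" by (rule newborn_prob[OF _ N \<xi>]) simp
      show "total_weight N (Suc n) \<xi> * (\<integral>\<^sup>+\<xi>'. F (permute N \<tau> \<xi>') \<partial>tagged_iid N (newborn N (Suc n) \<xi>) (newborn N (Suc n) \<xi>)) =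
        total_weight N (Suc n) \<xi> * (\<integral>\<^sup>+\<xi>'. F \<xi>' \<partial>tagged_iid N (newborn N (Suc n) \<xi>) (newborn N (Suc n) \<xi>))"
        unfolding permute_def nn_integral_tagged_iid_permute[OF mp \<tau> F] ..
    qed
    then show "(\<integral>\<^sup>+\<xi>. F (permute N \<tau> \<xi>) \<partial>extended_law N (Suc n)) = (\<integral>\<^sup>+\<xi>. F \<xi> \<partial>extended_law N (Suc n))"
      unfolding nn_integral_extended_law_Suc_sym[OF ex N F] nn_integral_extended_law_Suc_sym[OF ex N Fp] by simp
  qed
qed

lemma path1_restrict: "w \<in> space (paths S 1) \<Longrightarrow> (\<lambda>t\<in>{1::nat}. w 1) = w"
  by (auto simp: paths_def space_PiM PiE_def extensional_def fun_eq_iff)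

lemma system_law_cong:
  "(\<And>t. t \<in> {1..Suc n} \<Longrightarrow> x t = x' t) \<Longrightarrow> system_law N x n = system_law N x' n"
proof (induction n)
  case 0 then show ?case by simp
next
  case (Suc n)
  have "system_law N x n = system_law N x' n" by (rule Suc.IH) (use Suc.prems in auto)
  moreover have "csmc_kernel N (Suc n) x = csmc_kernel N (Suc n) x'"
    unfolding csmc_kernel_def using Suc.prems[of "Suc (Suc n)"] by auto
  ultimately show ?case by simp
qed

lemma \<Gamma>p_cong:
  "1 \<le> t \<Longrightarrow> (\<And>w. w \<in> space (paths S t) \<Longrightarrow> \<phi> w = \<psi> w) \<Longrightarrow> \<Gamma>p t \<phi> = \<Gamma>p t \<psi>"
  unfolding \<Gamma>p_def by (rule nn_integral_cong) (simp add: space_chain_law)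

lemma nn_integral_grow_cong:
  assumes t: "1 \<le> t" and e: "e \<in> space (paths S t)"
    and F: "F \<in> borel_measurable (paths S (Suc t))" and H: "H \<in> borel_measurable (paths S (Suc t))"
    and FH: "\<And>y. y \<in> space S \<Longrightarrow> F (e(Suc t := y)) = H (e(Suc t := y))"
  shows "(\<integral>\<^sup>+y. F y \<partial>grow t e) = (\<integral>\<^sup>+y. H y \<partial>grow t e)"
proof -
  have "space (M (Suc t) (e t)) = space S"
    by (rule sets_eq_imp_space_eq, rule sets_K) (use t path_in_space[OF e] in auto)
  then show ?thesis
    unfolding nn_integral_grow[OF t e F] nn_integral_grow[OF t e H] by (intro nn_integral_cong FH) simp
qed

lemma system_law_kernel_measurable: "1 \<le> N \<Longrightarrow> (\<lambda>w. system_law N w n) \<in> paths S (Suc n) \<rightarrow>\<^sub>M prob_algebra (systems N (Suc n))"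
  by (rule system_law_measurable) auto

lemma nn_integral_system_law_measurable:
  assumes N: "1 \<le> N" and \<Phi>: "(\<lambda>(w, \<xi>). \<Phi> w \<xi>) \<in> borel_measurable (paths S (Suc n) \<Otimes>\<^sub>M systems N (Suc n))"
  shows "(\<lambda>w. \<integral>\<^sup>+\<xi>. \<Phi> w \<xi> \<partial>system_law N w n) \<in> borel_measurable (paths S (Suc n))"
  by (rule nn_integral_measurable_subprob_algebra2[OF \<Phi> measurable_prob_algebraD[OF system_law_kernel_measurable[OF N]]])

lemma diagonal_measurable:
  assumes N: "1 \<le> N" and \<Phi>: "(\<lambda>(w, \<xi>). \<Phi> w \<xi>) \<in> borel_measurable (paths S t \<Otimes>\<^sub>M systems N t)"
  shows "(\<lambda>\<xi>. \<Phi> (\<xi> 1) \<xi>) \<in> borel_measurable (systems N t)"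
  using measurable_compose[OF measurable_Pair[OF systems_component[of 1 N] measurable_ident_sets[OF refl]] \<Phi>] N by simp

lemma section_measurable:
  assumes \<Phi>: "(\<lambda>(w, \<xi>). \<Phi> w \<xi>) \<in> borel_measurable (X \<Otimes>\<^sub>M Y)" and w: "w \<in> space X"
  shows "\<Phi> w \<in> borel_measurable Y"
  using measurable_compose[OF measurable_Pair1'[OF w] \<Phi>] by simp

lemma section_measurable':
  assumes \<Phi>: "(\<lambda>(w, \<xi>). \<Phi> w \<xi>) \<in> borel_measurable (X \<Otimes>\<^sub>M Y)" and y: "y \<in> space Y"
  shows "(\<lambda>w. \<Phi> w y) \<in> borel_measurable X"
  using measurable_compose[OF measurable_Pair2'[OF y] \<Phi>] by simp

text \<open>Induction on time. The law of the system up to time \<open>n + 1\<close> depends on the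
  reference only up to that time, so the extension of the reference by one state can be exchanged
  with the integration over the earlier system.\<close>

lemma joint_law:
  assumes N: "1 \<le> N" and \<Phi>: "(\<lambda>(w, \<xi>). \<Phi> w \<xi>) \<in> borel_measurable (paths S (Suc n) \<Otimes>\<^sub>M systems N (Suc n))"
  shows "\<Gamma>p (Suc n) (\<lambda>w. \<integral>\<^sup>+\<xi>. \<Phi> w \<xi> \<partial>system_law N w n) = (\<integral>\<^sup>+\<xi>. \<Phi> (\<xi> 1) \<xi> \<partial>extended_law N n)"
  using \<Phi>
proof (induction n arbitrary: \<Phi>)
  case 0
  let ?c = "chain 1"
  note c = chain_law_prob[of 1, OF order_refl]
  have \<Phi>: "(\<lambda>(w, \<xi>). \<Phi> w \<xi>) \<in> borel_measurable (paths S 1 \<Otimes>\<^sub>M systems N 1)" using 0 by simp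
  note dm = diagonal_measurable[OF N \<Phi>]
  have m: "(\<lambda>w. \<integral>\<^sup>+\<xi>. \<Phi> w \<xi> \<partial>system_law N w 0) \<in> borel_measurable (paths S 1)"
    using nn_integral_system_law_measurable[OF N 0] by simp
  have "\<Gamma>p 1 (\<lambda>w. \<integral>\<^sup>+\<xi>. \<Phi> w \<xi> \<partial>system_law N w 0) = (\<integral>\<^sup>+w. \<integral>\<^sup>+\<xi>. \<Phi> w \<xi> \<partial>system_law N w 0 \<partial>?c)"
    by (rule \<Gamma>p_1[OF m])
  also have "\<dots> = (\<integral>\<^sup>+w. \<integral>\<^sup>+\<xi>. \<Phi> (\<xi> 1) \<xi> \<partial>tagged_iid N (return (paths S 1) w) ?c \<partial>?c)"
  proof (rule nn_integral_cong)
    fix w assume "w \<in> space ?c"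
    then have w: "w \<in> space (paths S 1)" by (simp add: space_chain_law del: One_nat_def)
    show "(\<integral>\<^sup>+\<xi>. \<Phi> w \<xi> \<partial>system_law N w 0) = (\<integral>\<^sup>+\<xi>. \<Phi> (\<xi> 1) \<xi> \<partial>tagged_iid N (return (paths S 1) w) ?c)"
      unfolding system_law.simps path1_restrict[OF w]
      by (rule nn_integral_tagged_iid_return_cong[OF w c N section_measurable[OF \<Phi> w] dm]) simp
  qed
  also have "\<dots> = (\<integral>\<^sup>+\<xi>. \<Phi> (\<xi> 1) \<xi> \<partial>tagged_iid N ?c ?c)"
    by (rule nn_integral_tagged_iid_mixture[OF c c N dm, symmetric])
  finally show ?case by simp
next
  case (Suc n)
  let ?t = "Suc n"
  have t: "1 \<le> ?t" by simp
  define R where "R = (\<lambda>e' \<xi>. \<integral>\<^sup>+\<xi>'. \<Phi> e' \<xi>' \<partial>csmc_kernel N ?t e' \<xi>)"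
  define \<Phi>' where "\<Phi>' = (\<lambda>e \<xi>. g ?t (e ?t) * (\<integral>\<^sup>+e'. R e' \<xi> \<partial>grow ?t e))"
  have Rm: "(\<lambda>(e', \<xi>). R e' \<xi>) \<in> borel_measurable (paths S (Suc ?t) \<Otimes>\<^sub>M systems N ?t)"
  proof -
    have "(\<lambda>(z, \<xi>'). \<Phi> (fst z) \<xi>') \<in> borel_measurable ((paths S (Suc ?t) \<Otimes>\<^sub>M systems N ?t) \<Otimes>\<^sub>M systems N (Suc ?t))"
      using measurable_compose[OF measurable_Pair[OF measurable_compose[OF measurable_fst measurable_fst] measurable_snd] Suc.prems]
      by (simp add: case_prod_beta')
    from nn_integral_measurable_subprob_algebra2[OF this measurable_prob_algebraD[OF csmc_kernel_measurable[OF t N order_refl]]]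
    show ?thesis by (simp add: R_def case_prod_beta')
  qed
  have \<Phi>'m: "(\<lambda>(e, \<xi>). \<Phi>' e \<xi>) \<in> borel_measurable (paths S ?t \<Otimes>\<^sub>M systems N ?t)"
  proof -
    have "(\<lambda>(z, e'). R e' (snd z)) \<in> borel_measurable ((paths S ?t \<Otimes>\<^sub>M systems N ?t) \<Otimes>\<^sub>M paths S (Suc ?t))"
      using measurable_compose[OF measurable_Pair[OF measurable_snd measurable_compose[OF measurable_fst measurable_snd]] Rm]
      by (simp add: case_prod_beta')
    from nn_integral_measurable_subprob_algebra2[OF this
        measurable_prob_algebraD[OF measurable_compose[OF measurable_fst grow_measurable[OF t]]]]
    have "(\<lambda>z. \<integral>\<^sup>+e'. R e' (snd z) \<partial>grow ?t (fst z)) \<in> borel_measurable (paths S ?t \<Otimes>\<^sub>M systems N ?t)" by simp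
    moreover have "(\<lambda>z. g ?t (fst z ?t)) \<in> borel_measurable (paths S ?t \<Otimes>\<^sub>M systems N ?t)"
      by (rule measurable_compose[OF measurable_fst last_measurable[OF t g_measurable[OF t]]])
    ultimately show ?thesis unfolding \<Phi>'_def by (simp add: case_prod_beta' borel_measurable_times_ennreal)
  qed
  have \<phi>m: "(\<lambda>w. \<integral>\<^sup>+\<xi>. \<Phi> w \<xi> \<partial>system_law N w (Suc n)) \<in> borel_measurable (paths S (Suc ?t))"
    by (rule nn_integral_system_law_measurable[OF N Suc.prems])
  have Dn: "(\<lambda>w. system_law N w n) \<in> paths S (Suc ?t) \<rightarrow>\<^sub>M subprob_algebra (systems N ?t)"
    by (rule measurable_prob_algebraD[OF system_law_measurable[OF N]]) simp
  have RD: "(\<lambda>w. \<integral>\<^sup>+\<xi>. R w \<xi> \<partial>system_law N w n) \<in> borel_measurable (paths S (Suc ?t))"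
    by (rule nn_integral_measurable_subprob_algebra2[OF Rm Dn])
  have DR: "(\<integral>\<^sup>+\<xi>. \<Phi> w \<xi> \<partial>system_law N w (Suc n)) = (\<integral>\<^sup>+\<xi>. R w \<xi> \<partial>system_law N w n)" if w: "w \<in> space (paths S (Suc ?t))" for w
    unfolding R_def by (rule nn_integral_system_law_Suc[OF N order_refl w section_measurable[OF Suc.prems w]])
  have fk_op_path_eq: "fk_op_path ?t (\<lambda>w. \<integral>\<^sup>+\<xi>. \<Phi> w \<xi> \<partial>system_law N w (Suc n)) e = (\<integral>\<^sup>+\<xi>. \<Phi>' e \<xi> \<partial>system_law N e n)"
    if e: "e \<in> space (paths S ?t)" for e
  proof -
    have ep: "grow ?t e \<in> space (prob_algebra (paths S (Suc ?t)))" by (rule grow_prob[OF t e])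
    have Dp: "system_law N e n \<in> space (prob_algebra (systems N ?t))" by (rule system_law_prob[OF N order_refl e])
    interpret E: prob_space "grow ?t e" using ep by (simp add: space_prob_algebra)
    interpret D: prob_space "system_law N e n" using Dp by (simp add: space_prob_algebra)
    interpret ED: pair_sigma_finite "system_law N e n" "grow ?t e" ..
    have se: "sets (grow ?t e) = sets (paths S (Suc ?t))" and sd: "sets (system_law N e n) = sets (systems N ?t)"
      using ep Dp by (auto simp: space_prob_algebra)
    have sp: "space (grow ?t e) = space (paths S (Suc ?t))" by (rule sets_eq_imp_space_eq[OF se])
    have RDe: "(\<lambda>w. \<integral>\<^sup>+\<xi>. R w \<xi> \<partial>system_law N e n) \<in> borel_measurable (paths S (Suc ?t))"
      by (rule nn_integral_measurable_subprob_algebra2[OF Rm])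
        (use Dp in \<open>auto simp: space_prob_algebra space_subprob_algebra prob_space_imp_subprob_space\<close>)
    have "(\<integral>\<^sup>+w. \<integral>\<^sup>+\<xi>. \<Phi> w \<xi> \<partial>system_law N w (Suc n) \<partial>grow ?t e) = (\<integral>\<^sup>+w. \<integral>\<^sup>+\<xi>. R w \<xi> \<partial>system_law N w n \<partial>grow ?t e)"
      by (rule nn_integral_cong, rule DR) (simp add: sp)
    also have "\<dots> = (\<integral>\<^sup>+w. \<integral>\<^sup>+\<xi>. R w \<xi> \<partial>system_law N e n \<partial>grow ?t e)"
    proof (rule nn_integral_grow_cong[OF t e RD RDe])
      fix y
      have "system_law N (e(Suc ?t := y)) n = system_law N e n" by (rule system_law_cong) auto
      then show "(\<integral>\<^sup>+\<xi>. R (e(Suc ?t := y)) \<xi> \<partial>system_law N (e(Suc ?t := y)) n) = (\<integral>\<^sup>+\<xi>. R (e(Suc ?t := y)) \<xi> \<partial>system_law N e n)" by simp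
    qed
    also have "\<dots> = (\<integral>\<^sup>+\<xi>. \<integral>\<^sup>+w. R w \<xi> \<partial>grow ?t e \<partial>system_law N e n)"
    proof (rule ED.Fubini'[of "\<lambda>\<xi> w. R w \<xi>"])
      have s: "sets (system_law N e n \<Otimes>\<^sub>M grow ?t e) = sets (systems N ?t \<Otimes>\<^sub>M paths S (Suc ?t))"
        by (rule sets_pair_measure_cong[OF sd se])
      show "(\<lambda>(\<xi>, w). R w \<xi>) \<in> borel_measurable (system_law N e n \<Otimes>\<^sub>M grow ?t e)"
        unfolding measurable_cong_sets[OF s refl]
        using measurable_compose[OF measurable_pair_swap' Rm] by (simp add: case_prod_beta')
    qed
    finally have 1: "(\<integral>\<^sup>+w. \<integral>\<^sup>+\<xi>. \<Phi> w \<xi> \<partial>system_law N w (Suc n) \<partial>grow ?t e) = (\<integral>\<^sup>+\<xi>. \<integral>\<^sup>+w. R w \<xi> \<partial>grow ?t e \<partial>system_law N e n)" .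
    have m: "(\<lambda>\<xi>. \<integral>\<^sup>+w. R w \<xi> \<partial>grow ?t e) \<in> borel_measurable (system_law N e n)"
      unfolding measurable_cong_sets[OF sd refl]
    proof (rule nn_integral_measurable_subprob_algebra2)
      show "(\<lambda>(\<xi>, w). R w \<xi>) \<in> borel_measurable (systems N ?t \<Otimes>\<^sub>M paths S (Suc ?t))"
        using measurable_compose[OF measurable_pair_swap' Rm] by (simp add: case_prod_beta')
      show "(\<lambda>\<xi>. grow ?t e) \<in> systems N ?t \<rightarrow>\<^sub>M subprob_algebra (paths S (Suc ?t))"
        using ep by (auto simp: space_prob_algebra space_subprob_algebra prob_space_imp_subprob_space)
    qed
    show ?thesis unfolding fk_op_path_def 1 \<Phi>'_def by (rule nn_integral_cmult[OF m, symmetric])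
  qed
  have "\<Gamma>p (Suc ?t) (\<lambda>w. \<integral>\<^sup>+\<xi>. \<Phi> w \<xi> \<partial>system_law N w (Suc n)) = \<Gamma>p ?t (fk_op_path ?t (\<lambda>w. \<integral>\<^sup>+\<xi>. \<Phi> w \<xi> \<partial>system_law N w (Suc n)))"
    by (rule \<Gamma>p_Suc[OF t \<phi>m])
  also have "\<dots> = \<Gamma>p ?t (\<lambda>e. \<integral>\<^sup>+\<xi>. \<Phi>' e \<xi> \<partial>system_law N e n)" by (rule \<Gamma>p_cong[OF t fk_op_path_eq])
  also have "\<dots> = (\<integral>\<^sup>+\<xi>. \<Phi>' (\<xi> 1) \<xi> \<partial>extended_law N n)" by (rule Suc.IH[OF \<Phi>'m])
  also have "\<dots> = (\<integral>\<^sup>+\<xi>. g ?t (\<xi> 1 ?t) * (\<integral>\<^sup>+\<xi>'. \<Phi> (\<xi>' 1) \<xi>' \<partial>tagged_iid N (grow ?t (\<xi> 1)) (newborn N ?t \<xi>)) \<partial>extended_law N n)"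
  proof (rule nn_integral_cong)
    fix \<xi> assume "\<xi> \<in> space (extended_law N n)"
    then have \<xi>: "\<xi> \<in> space (systems N ?t)" by (simp add: space_extended_law[OF N])
    have \<xi>1: "\<xi> 1 \<in> space (paths S ?t)" by (rule systems_in_paths[OF \<xi>]) (use N in simp)
    note mp = newborn_prob[OF t N \<xi>] and dm = diagonal_measurable[OF N Suc.prems]
    have "(\<integral>\<^sup>+e'. R e' \<xi> \<partial>grow ?t (\<xi> 1)) =
      (\<integral>\<^sup>+e'. \<integral>\<^sup>+\<xi>'. \<Phi> (\<xi>' 1) \<xi>' \<partial>tagged_iid N (return (paths S (Suc ?t)) e') (newborn N ?t \<xi>) \<partial>grow ?t (\<xi> 1))"
    proof (rule nn_integral_grow_cong[OF t \<xi>1 section_measurable'[OF Rm \<xi>] nn_integral_tagged_iid_return_measurable[OF mp dm]])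
      fix y assume y: "y \<in> space S"
      let ?e = "(\<xi> 1)(Suc ?t := y)"
      have e: "?e \<in> space (paths S (Suc ?t))" using measurable_space[OF measurable_extend_path[OF \<xi>1] y] .
      have st: "csmc_kernel N ?t ?e \<xi> = tagged_iid N (return (paths S (Suc ?t)) ?e) (newborn N ?t \<xi>)" by (simp add: csmc_kernel_def)
      show "R ?e \<xi> = (\<integral>\<^sup>+\<xi>'. \<Phi> (\<xi>' 1) \<xi>' \<partial>tagged_iid N (return (paths S (Suc ?t)) ?e) (newborn N ?t \<xi>))"
        unfolding R_def st
        by (rule nn_integral_tagged_iid_return_cong[OF e mp N section_measurable[OF Suc.prems e] dm]) simp
    qed
    also have "\<dots> = (\<integral>\<^sup>+\<xi>'. \<Phi> (\<xi>' 1) \<xi>' \<partial>tagged_iid N (grow ?t (\<xi> 1)) (newborn N ?t \<xi>))"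
      by (rule nn_integral_tagged_iid_mixture[OF grow_prob[OF t \<xi>1] mp N dm, symmetric])
    finally show "\<Phi>' (\<xi> 1) \<xi> = g ?t (\<xi> 1 ?t) * (\<integral>\<^sup>+\<xi>'. \<Phi> (\<xi>' 1) \<xi>' \<partial>tagged_iid N (grow ?t (\<xi> 1)) (newborn N ?t \<xi>))"
      by (simp add: \<Phi>'_def)
  qed
  also have "\<dots> = (\<integral>\<^sup>+\<xi>. \<Phi> (\<xi> 1) \<xi> \<partial>extended_law N (Suc n))"
    by (rule nn_integral_extended_law_Suc[OF N diagonal_measurable[OF N Suc.prems], symmetric])
  finally show ?case .
qed

definition selected_mean :: "nat \<Rightarrow> nat \<Rightarrow> ((nat \<Rightarrow> 'z) \<Rightarrow> ennreal) \<Rightarrow> (nat \<Rightarrow> nat \<Rightarrow> 'z) \<Rightarrow> ennreal" where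
  "selected_mean N t u \<xi> = (\<Sum>k=1..N. weight N t \<xi> k * u (\<xi> k))"

lemma weight_measurable:
  assumes t: "1 \<le> t" and k: "k \<in> {1..N}"
  shows "(\<lambda>\<xi>. weight N t \<xi> k) \<in> borel_measurable (systems N t)"
proof -
  have [measurable]: "(\<lambda>\<xi>. G t (\<xi> j t)) \<in> borel_measurable (systems N t)" if "j \<in> {1..N}" for j
    by (rule systems_last_measurable[OF t that G_measurable[OF t]])
  have s: "(\<lambda>\<xi>. \<Sum>j=1..N. G t (\<xi> j t)) \<in> borel_measurable (systems N t)"
    by (rule borel_measurable_sum, rule systems_last_measurable[OF t _ G_measurable[OF t]])
  note k' = systems_last_measurable[OF t k G_measurable[OF t]]
  show ?thesis unfolding select_weight_def using s k' by measurable
qed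

lemma selected_mean_measurable:
  assumes t: "1 \<le> t" and u: "u \<in> borel_measurable (paths S t)"
  shows "selected_mean N t u \<in> borel_measurable (systems N t)"
  unfolding selected_mean_def[abs_def]
  by (intro borel_measurable_sum borel_measurable_times_ennreal weight_measurable[OF t]
      measurable_compose[OF systems_component u])

text \<open>Under the extended law the reference is particle 1, and \<open>symmetrise\<close>
  replaces it by the selected particle. The right-hand side is symmetric in \<open>u\<close> and
  \<open>v\<close>, and nonnegative for \<open>u = v\<close>, also for signed functions.\<close>

lemma bilinear_form:
  assumes N: "1 \<le> N" and u: "u \<in> borel_measurable (paths S (Suc n))" and v: "v \<in> borel_measurable (paths S (Suc n))"
  shows "\<Gamma>p (Suc n) (\<lambda>w. g (Suc n) (w (Suc n)) * (u w * (\<integral>\<^sup>+\<xi>. selected_mean N (Suc n) v \<xi> \<partial>system_law N w n))) =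
    inverse (of_nat N) * (\<integral>\<^sup>+\<xi>. total_weight N (Suc n) \<xi> * (selected_mean N (Suc n) u \<xi> * selected_mean N (Suc n) v \<xi>) \<partial>extended_law N n)"
proof -
  let ?t = "Suc n"
  have t: "1 \<le> ?t" by simp
  note gm = last_measurable[OF t g_measurable[OF t]]
  define \<Phi> where "\<Phi> = (\<lambda>w \<xi>. g ?t (w ?t) * (u w * selected_mean N ?t v \<xi>))"
  have \<Phi>: "(\<lambda>(w, \<xi>). \<Phi> w \<xi>) \<in> borel_measurable (paths S ?t \<Otimes>\<^sub>M systems N ?t)"
    unfolding \<Phi>_def case_prod_beta'
    by (intro borel_measurable_times_ennreal measurable_compose[OF measurable_fst gm]
        measurable_compose[OF measurable_fst u] measurable_compose[OF measurable_snd selected_mean_measurable[OF t v]])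
  have "\<Gamma>p ?t (\<lambda>w. g ?t (w ?t) * (u w * (\<integral>\<^sup>+\<xi>. selected_mean N ?t v \<xi> \<partial>system_law N w n))) = \<Gamma>p ?t (\<lambda>w. \<integral>\<^sup>+\<xi>. \<Phi> w \<xi> \<partial>system_law N w n)"
  proof (rule \<Gamma>p_cong[OF t])
    fix w assume w: "w \<in> space (paths S ?t)"
    have sd: "sets (system_law N w n) = sets (systems N ?t)" using system_law_prob[OF N order_refl w] by (simp add: space_prob_algebra)
    have m: "selected_mean N ?t v \<in> borel_measurable (system_law N w n)"
      unfolding measurable_cong_sets[OF sd refl] by (rule selected_mean_measurable[OF t v])
    show "g ?t (w ?t) * (u w * (\<integral>\<^sup>+\<xi>. selected_mean N ?t v \<xi> \<partial>system_law N w n)) = (\<integral>\<^sup>+\<xi>. \<Phi> w \<xi> \<partial>system_law N w n)"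
      unfolding \<Phi>_def mult.assoc[symmetric] by (rule nn_integral_cmult[OF m, symmetric])
  qed
  also have "\<dots> = (\<integral>\<^sup>+\<xi>. g ?t (\<xi> 1 ?t) * (u (\<xi> 1) * selected_mean N ?t v \<xi>) \<partial>extended_law N n)"
    unfolding joint_law[OF N \<Phi>] by (simp add: \<Phi>_def)
  also have "\<dots> = inverse (of_nat N) * (\<integral>\<^sup>+\<xi>. total_weight N ?t \<xi> * (\<Sum>k=1..N. weight N ?t \<xi> k * (u (\<xi> k) * selected_mean N ?t v \<xi>)) \<partial>extended_law N n)"
  proof (rule symmetrise[OF extended_law_exchangeable[OF N] N, of "\<lambda>e \<xi>. u e * selected_mean N ?t v \<xi>"])
    show "(\<lambda>\<xi>. u (\<xi> k) * selected_mean N ?t v \<xi>) \<in> borel_measurable (systems N ?t)" if "k \<in> {1..N}" for k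
      by (intro borel_measurable_times_ennreal selected_mean_measurable[OF t v] measurable_compose[OF systems_component[OF that] u])
    show "u e * selected_mean N ?t v (permute N \<tau> \<xi>) = u e * selected_mean N ?t v \<xi>"
      if "bij_betw \<tau> {1..N} {1..N}" "\<xi> \<in> space (systems N ?t)" "total_weight N ?t \<xi> \<noteq> 0" for \<tau> \<xi> e
      unfolding selected_mean_def selection_mean_permute[OF that(1,2) t that(3)] ..
  qed
  also have "\<dots> = inverse (of_nat N) * (\<integral>\<^sup>+\<xi>. total_weight N ?t \<xi> * (selected_mean N ?t u \<xi> * selected_mean N ?t v \<xi>) \<partial>extended_law N n)"
    unfolding selected_mean_def[of N ?t u] sum_distrib_right mult.assoc ..
  finally show ?thesis .
qed

section \<open>Ancestral paths of the recorded particle history\<close>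

text \<open>The ancestral paths of the particles at time \<open>n + 1\<close>, read off a history
  \<open>((Z\<^sub>1, \<dots>), (A\<^sub>1, \<dots>))\<close>.\<close>

primrec genealogy :: "nat \<Rightarrow> nat \<Rightarrow> ((nat \<Rightarrow> nat \<Rightarrow> 'z) \<times> (nat \<Rightarrow> nat \<Rightarrow> nat)) \<Rightarrow> nat \<Rightarrow> nat \<Rightarrow> 'z" where
  "genealogy N 0 \<omega> = (\<lambda>i\<in>{1..N}. \<lambda>t\<in>{1}. fst \<omega> 1 i)"
| "genealogy N (Suc n) \<omega> = (\<lambda>i\<in>{1..N}. (genealogy N n \<omega> (snd \<omega> (Suc n) i))(Suc (Suc n) := fst \<omega> (Suc (Suc n)) i))"

abbreviation generation :: "nat \<Rightarrow> (nat \<Rightarrow> 'z) measure" where "generation N \<equiv> \<Pi>\<^sub>M i\<in>{1..N}. S"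
abbreviation tagged_states :: "nat \<Rightarrow> (nat \<times> 'z) measure" where "tagged_states N \<equiv> count_space {1..N} \<Otimes>\<^sub>M S"

lemma genealogy_last: "i \<in> {1..N} \<Longrightarrow> genealogy N n \<omega> i (Suc n) = fst \<omega> (Suc n) i"
  by (cases n) auto

lemma genealogy_cong:
  "(\<And>t. t \<le> Suc n \<Longrightarrow> fst \<omega> t = fst \<omega>' t) \<Longrightarrow> (\<And>t. t \<le> n \<Longrightarrow> snd \<omega> t = snd \<omega>' t) \<Longrightarrow> genealogy N n \<omega> = genealogy N n \<omega>'"
  by (induction n) auto

lemma state_measurable: "1 \<le> t \<Longrightarrow> t \<le> Suc n \<Longrightarrow> (\<lambda>\<omega>. fst \<omega> t) \<in> histories N n \<rightarrow>\<^sub>M generation N"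
  unfolding csmc_space_def
  by (rule measurable_compose[OF measurable_fst, of "\<lambda>Z. Z t" _ "generation N", OF measurable_component_singleton[of t "{1..Suc n}" "\<lambda>_. generation N"]]) simp

lemma ancestor_measurable: "1 \<le> t \<Longrightarrow> t \<le> n \<Longrightarrow> (\<lambda>\<omega>. snd \<omega> t) \<in> histories N n \<rightarrow>\<^sub>M (\<Pi>\<^sub>M i\<in>{1..N}. count_space {1..N})"
  unfolding csmc_space_def
  by (rule measurable_compose[OF measurable_snd, of "\<lambda>Z. Z t" _ "\<Pi>\<^sub>M i\<in>{1..N}. count_space {1..N}",
        OF measurable_component_singleton[of t "{1..n}" "\<lambda>_. \<Pi>\<^sub>M i\<in>{1..N}. count_space {1..N}"]]) simp

lemma genealogy_measurable: "n \<le> m \<Longrightarrow> genealogy N n \<in> histories N m \<rightarrow>\<^sub>M systems N (Suc n)"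
proof (induction n)
  case 0
  have "(\<lambda>\<omega>. \<lambda>t\<in>{1::nat}. fst \<omega> 1 i) \<in> histories N m \<rightarrow>\<^sub>M paths S (Suc 0)" if i: "i \<in> {1..N}" for i
  proof -
    have "(\<lambda>\<omega>. fst \<omega> 1 i) \<in> histories N m \<rightarrow>\<^sub>M S"
      by (rule measurable_compose[OF state_measurable measurable_component_singleton[OF i, of "\<lambda>_. S"]]) auto
    then show ?thesis unfolding paths_def by (simp add: measurable_restrict)
  qed
  then show ?case unfolding genealogy.simps by (intro measurable_restrict) auto
next
  case (Suc n)
  have P: "genealogy N n \<in> histories N m \<rightarrow>\<^sub>M systems N (Suc n)" using Suc by simp
  have "(\<lambda>\<omega>. (genealogy N n \<omega> (snd \<omega> (Suc n) i))(Suc (Suc n) := fst \<omega> (Suc (Suc n)) i)) \<in> histories N m \<rightarrow>\<^sub>M paths S (Suc (Suc n))"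
    if i: "i \<in> {1..N}" for i
  proof -
    have a: "(\<lambda>\<omega>. snd \<omega> (Suc n) i) \<in> histories N m \<rightarrow>\<^sub>M count_space {1..N}"
      by (rule measurable_compose[OF ancestor_measurable measurable_component_singleton[OF i, of "\<lambda>_. count_space {1..N}"]]) (use Suc.prems in auto)
    have z: "(\<lambda>\<omega>. fst \<omega> (Suc (Suc n)) i) \<in> histories N m \<rightarrow>\<^sub>M S"
      by (rule measurable_compose[OF state_measurable measurable_component_singleton[OF i, of "\<lambda>_. S"]]) (use Suc.prems in auto)
    have p: "(\<lambda>\<omega>. genealogy N n \<omega> (snd \<omega> (Suc n) i)) \<in> histories N m \<rightarrow>\<^sub>M paths S (Suc n)"
      using measurable_compose[OF measurable_Pair[OF P a] selected_component_measurable] by simp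
    show ?thesis using measurable_compose[OF measurable_Pair[OF p z] measurable_extend_paths] by simp
  qed
  then show ?case unfolding genealogy.simps by (intro measurable_restrict) auto
qed

lemma lineage_Suc: "lineage anc (Suc T) i (Suc j) = lineage anc T (anc T i) j"
  by (induction j) auto

lemma ancestor_in_range: "\<omega> \<in> space (histories N n) \<Longrightarrow> t \<in> {1..n} \<Longrightarrow> i \<in> {1..N} \<Longrightarrow> snd \<omega> t i \<in> {1..N}"
  unfolding csmc_space_def by (auto simp: space_pair_measure space_PiM PiE_iff)

text \<open>The genealogy is built forwards in time, the lineage is traced backwards; they agree
  because tracing back from time \<open>n + 2\<close> means passing to the parent first.\<close>

lemma genealogy_eq_lineage:
  assumes \<omega>: "\<omega> \<in> space (histories N m)" and n: "n \<le> m" and a: "a \<in> {1..N}"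
  shows "genealogy N n \<omega> a = (\<lambda>t\<in>{1..Suc n}. fst \<omega> t (lineage (snd \<omega>) (Suc n) a (Suc n - t)))"
  using n a
proof (induction n arbitrary: a)
  case 0
  then show ?case by (auto simp: fun_eq_iff)
next
  case (Suc n)
  let ?a = "snd \<omega> (Suc n) a"
  have a': "?a \<in> {1..N}" by (rule ancestor_in_range[OF \<omega>]) (use Suc.prems in auto)
  show ?case
  proof (rule ext)
    fix t
    have "genealogy N (Suc n) \<omega> a t = ((\<lambda>t\<in>{1..Suc n}. fst \<omega> t (lineage (snd \<omega>) (Suc n) ?a (Suc n - t)))(Suc (Suc n) := fst \<omega> (Suc (Suc n)) a)) t"
      using Suc.IH[OF _ a'] Suc.prems by simp
    also have "\<dots> = (\<lambda>t\<in>{1..Suc (Suc n)}. fst \<omega> t (lineage (snd \<omega>) (Suc (Suc n)) a (Suc (Suc n) - t))) t"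
    proof (cases "t \<in> {1..Suc n}")
      case True
      then have j: "Suc (Suc n) - t = Suc (Suc n - t)" by auto
      have "lineage (snd \<omega>) (Suc (Suc n)) a (Suc (Suc n) - t) = lineage (snd \<omega>) (Suc n) ?a (Suc n - t)"
        unfolding j by (rule lineage_Suc)
      then show ?thesis using True by auto
    qed auto
    finally show "genealogy N (Suc n) \<omega> a t = (\<lambda>t\<in>{1..Suc (Suc n)}. fst \<omega> t (lineage (snd \<omega>) (Suc (Suc n)) a (Suc (Suc n) - t))) t" .
  qed
qed

definition newborn_pair :: "nat \<Rightarrow> nat \<Rightarrow> (nat \<Rightarrow> 'z) \<Rightarrow> (nat \<times> 'z) measure" where
  "newborn_pair N t z = bind (select N (\<lambda>k. G t (z k))) (\<lambda>k. distr (M (Suc t) (z k)) (tagged_states N) (Pair k))"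

lemma csmc_step_eq: "transition N x t z = tagged_iid N (return (tagged_states N) (1, x (Suc t))) (newborn_pair N t z)"
  unfolding csmc_step_def tagged_iid_def newborn_pair_def by (rule refl)

lemma select_S_measurable: "1 \<le> t \<Longrightarrow> 1 \<le> N \<Longrightarrow> (\<lambda>z. select N (\<lambda>k. G t (z k))) \<in> generation N \<rightarrow>\<^sub>M prob_algebra (count_space {1..N})"
proof (rule select_measurable)
  assume t: "1 \<le> t"
  show "(\<lambda>z. G t (z k)) \<in> borel_measurable (generation N)" if "k \<in> {1..N}" for k
    by (rule measurable_compose[OF measurable_component_singleton[OF that, of "\<lambda>_. S"] G_measurable[OF t]])
  show "0 \<le> G t (z k)" if "z \<in> space (generation N)" "k \<in> {1..N}" for z k
    using measurable_space[OF measurable_component_singleton[OF that(2), of "\<lambda>_. S"] that(1)] by (rule G_nonneg[OF t])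
qed

lemma newborn_pair_kernel_measurable:
  assumes t: "1 \<le> t"
  shows "(\<lambda>(z, k). distr (M (Suc t) (z k)) (tagged_states N) (Pair k)) \<in> generation N \<Otimes>\<^sub>M count_space {1..N} \<rightarrow>\<^sub>M prob_algebra (tagged_states N)"
proof -
  have zk: "(\<lambda>p. fst p (snd p)) \<in> generation N \<Otimes>\<^sub>M count_space {1..N} \<rightarrow>\<^sub>M S"
  proof (rule measurable_compose_countable'[where f="\<lambda>i p. fst p i" and g=snd and I="{1..N}"])
    show "(\<lambda>p. fst p i) \<in> generation N \<Otimes>\<^sub>M count_space {1..N} \<rightarrow>\<^sub>M S" if "i \<in> {1..N}" for i
      by (rule measurable_compose[OF measurable_fst measurable_component_singleton[OF that, of "\<lambda>_. S"]])
  qed auto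
  have k: "M (Suc t) \<in> S \<rightarrow>\<^sub>M prob_algebra S" by (rule K) (use t in simp)
  have "(\<lambda>p. distr (M (Suc t) (fst p (snd p))) (tagged_states N) (\<lambda>y. (snd p, y))) \<in> generation N \<Otimes>\<^sub>M count_space {1..N} \<rightarrow>\<^sub>M prob_algebra (tagged_states N)"
  proof (rule measurable_distr_prob_space2[OF measurable_compose[OF zk k]])
    have "(\<lambda>q. (snd (fst q), snd q)) \<in> (generation N \<Otimes>\<^sub>M count_space {1..N}) \<Otimes>\<^sub>M S \<rightarrow>\<^sub>M tagged_states N"
      by (rule measurable_Pair[OF measurable_compose[OF measurable_fst measurable_snd] measurable_snd])
    then show "(\<lambda>(p, y). (snd p, y)) \<in> (generation N \<Otimes>\<^sub>M count_space {1..N}) \<Otimes>\<^sub>M S \<rightarrow>\<^sub>M tagged_states N"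
      by (simp add: case_prod_beta')
  qed
  then show ?thesis by (simp add: case_prod_beta')
qed

lemma newborn_pair_measurable: "1 \<le> t \<Longrightarrow> 1 \<le> N \<Longrightarrow> newborn_pair N t \<in> generation N \<rightarrow>\<^sub>M prob_algebra (tagged_states N)"
  unfolding newborn_pair_def[abs_def]
  by (rule measurable_bind_prob_space2[OF select_S_measurable newborn_pair_kernel_measurable])

lemma reference_prob: "1 \<le> N \<Longrightarrow> y \<in> space S \<Longrightarrow> return (tagged_states N) (1, y) \<in> space (prob_algebra (tagged_states N))"
  by (simp add: space_prob_algebra prob_space_return space_pair_measure)

lemma csmc_step_measurable:
  "1 \<le> t \<Longrightarrow> 1 \<le> N \<Longrightarrow> x (Suc t) \<in> space S \<Longrightarrow> transition N x t \<in> generation N \<rightarrow>\<^sub>M prob_algebra (\<Pi>\<^sub>M i\<in>{1..N}. tagged_states N)"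
proof -
  assume a: "1 \<le> t" "1 \<le> N" "x (Suc t) \<in> space S"
  have "(\<lambda>z. tagged_iid N (return (tagged_states N) (1, x (Suc t))) (newborn_pair N t z)) \<in> generation N \<rightarrow>\<^sub>M prob_algebra (\<Pi>\<^sub>M i\<in>{1..N}. tagged_states N)"
    by (rule tagged_iid_measurable[OF _ newborn_pair_measurable[OF a(1,2)]]) (use reference_prob[OF a(2,3)] in simp)
  then show ?thesis unfolding csmc_step_eq[abs_def] .
qed

text \<open>A path and the pair (parent, state) determine the extended path, and pushing a product
  measure forward componentwise pushes each factor forward.\<close>

lemma csmc_step_distr:
  assumes t: "1 \<le> t" and N: "1 \<le> N" and x: "x (Suc t) \<in> space S" and \<xi>: "\<xi> \<in> space (systems N t)"
    and z: "z \<in> space (generation N)" and z\<xi>: "\<And>k. k \<in> {1..N} \<Longrightarrow> \<xi> k t = z k"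
  shows "distr (transition N x t z) (systems N (Suc t)) (\<lambda>y. \<lambda>i\<in>{1..N}. (\<xi> (fst (y i)))(Suc t := snd (y i))) = csmc_kernel N t x \<xi>"
proof -
  let ?f = "\<lambda>p. (\<xi> (fst p))(Suc t := snd p)"
  have f: "?f \<in> tagged_states N \<rightarrow>\<^sub>M paths S (Suc t)"
  proof (rule measurable_compose_countable'[where f="\<lambda>i p. (\<xi> i)(Suc t := snd p)" and g=fst and I="{1..N}"])
    show "(\<lambda>p. (\<xi> i)(Suc t := snd p)) \<in> tagged_states N \<rightarrow>\<^sub>M paths S (Suc t)" if "i \<in> {1..N}" for i
      by (rule measurable_compose[OF measurable_snd measurable_extend_path[OF systems_in_paths[OF \<xi> that]]])
  qed auto
  note op = measurable_space[OF newborn_pair_measurable[OF t N] z]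
  have sel: "select N (\<lambda>k. G t (z k)) = selection N t \<xi>"
    unfolding selection_def by (rule select_cong) (simp add: z\<xi>)
  have kern: "(\<lambda>k. distr (M (Suc t) (z k)) (tagged_states N) (Pair k)) \<in> selection N t \<xi> \<rightarrow>\<^sub>M subprob_algebra (tagged_states N)"
  proof -
    have "(\<lambda>k. distr (M (Suc t) (z k)) (tagged_states N) (Pair k)) \<in> count_space {1..N} \<rightarrow>\<^sub>M prob_algebra (tagged_states N)"
      using measurable_compose[OF measurable_Pair1'[OF z] newborn_pair_kernel_measurable[OF t]] by simp
    from measurable_prob_algebraD[OF this] show ?thesis
      unfolding selection_def measurable_cong_sets[OF sets_select refl] .
  qed
  have sp: "space (selection N t \<xi>) = {1..N}" unfolding selection_def using sets_eq_imp_space_eq[OF sets_select] by simp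
  have "distr (newborn_pair N t z) (paths S (Suc t)) ?f = selection N t \<xi> \<bind> (\<lambda>k. distr (distr (M (Suc t) (z k)) (tagged_states N) (Pair k)) (paths S (Suc t)) ?f)"
    unfolding newborn_pair_def sel by (rule distr_bind[OF kern _ f]) (use sp N in auto)
  also have "\<dots> = newborn N t \<xi>"
    unfolding newborn_def
  proof (rule bind_cong[OF refl])
    fix k assume "k \<in> space (selection N t \<xi>)"
    then have k: "k \<in> {1..N}" by (simp only: sp)
    have zk: "z k \<in> space S" using measurable_space[OF measurable_component_singleton[OF k, of "\<lambda>_. S"] z] .
    have s: "sets (M (Suc t) (z k)) = sets S" using t zk by (intro sets_K) auto
    have pk: "Pair k \<in> M (Suc t) (z k) \<rightarrow>\<^sub>M tagged_states N"
      unfolding measurable_cong_sets[OF s refl] by (rule measurable_Pair1') (use k in simp)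
    show "distr (distr (M (Suc t) (z k)) (tagged_states N) (Pair k)) (paths S (Suc t)) ?f = grow t (\<xi> k)"
      unfolding distr_distr[OF f pk] grow_def z\<xi>[OF k] by (simp add: comp_def)
  qed
  finally have 1: "distr (newborn_pair N t z) (paths S (Suc t)) ?f = newborn N t \<xi>" .
  have "distr (return (tagged_states N) (1, x (Suc t))) (paths S (Suc t)) ?f = return (paths S (Suc t)) (?f (1, x (Suc t)))"
    by (rule distr_return[OF f]) (use N x in \<open>simp add: space_pair_measure\<close>)
  then have 2: "distr (return (tagged_states N) (1, x (Suc t))) (paths S (Suc t)) ?f = return (paths S (Suc t)) ((\<xi> 1)(Suc t := x (Suc t)))" by simp
  show ?thesis
    unfolding csmc_step_eq csmc_kernel_def tagged_iid_distr[OF reference_prob[OF N x] op f] 1 2 ..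
qed

definition append_generation :: "nat \<Rightarrow> nat \<Rightarrow> ((nat \<Rightarrow> nat \<Rightarrow> 'z) \<times> (nat \<Rightarrow> nat \<Rightarrow> nat)) \<Rightarrow> (nat \<Rightarrow> nat \<times> 'z)
    \<Rightarrow> ((nat \<Rightarrow> nat \<Rightarrow> 'z) \<times> (nat \<Rightarrow> nat \<Rightarrow> nat))" where
  "append_generation N n \<omega> y = ((fst \<omega>)(Suc (Suc n) := (\<lambda>i\<in>{1..N}. snd (y i))), (snd \<omega>)(Suc n := (\<lambda>i\<in>{1..N}. fst (y i))))"

lemma csmc_hist_Suc: "hist N x (Suc n) = hist N x n \<bind>
    (\<lambda>\<omega>. distr (transition N x (Suc n) (fst \<omega> (Suc n))) (histories N (Suc n)) (append_generation N n \<omega>))"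
  by (simp add: append_generation_def[abs_def] case_prod_beta')

lemma append_generation_measurable: "(\<lambda>(\<omega>, y). append_generation N n \<omega> y) \<in> histories N n \<Otimes>\<^sub>M (\<Pi>\<^sub>M i\<in>{1..N}. tagged_states N) \<rightarrow>\<^sub>M histories N (Suc n)"
proof -
  let ?X = "histories N n \<Otimes>\<^sub>M (\<Pi>\<^sub>M i\<in>{1..N}. tagged_states N)"
  have yi: "(\<lambda>p. snd p i) \<in> ?X \<rightarrow>\<^sub>M tagged_states N" if "i \<in> {1..N}" for i
    by (rule measurable_compose[OF measurable_snd measurable_component_singleton[OF that, of "\<lambda>_. tagged_states N"]])
  let ?CN = "\<Pi>\<^sub>M i\<in>{1..N}. count_space {1..N}"
  have z2: "(\<lambda>p. \<lambda>i\<in>{1..N}. snd (snd p i)) \<in> ?X \<rightarrow>\<^sub>M generation N"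
    by (rule measurable_restrict) (rule measurable_compose[OF yi measurable_snd])
  have z1: "(\<lambda>p. fst (fst p)) \<in> ?X \<rightarrow>\<^sub>M (\<Pi>\<^sub>M t\<in>{1..Suc n}. generation N)"
    unfolding csmc_space_def by (rule measurable_compose[OF measurable_fst measurable_fst])
  have "insert (Suc (Suc n)) {1..Suc n} = {1..Suc (Suc n)}" by auto
  with measurable_add_dim[of "Suc (Suc n)" "{1..Suc n}" "\<lambda>_. generation N"]
  have zadd: "(\<lambda>(f, y). f(Suc (Suc n) := y)) \<in> (\<Pi>\<^sub>M t\<in>{1..Suc n}. generation N) \<Otimes>\<^sub>M generation N \<rightarrow>\<^sub>M (\<Pi>\<^sub>M t\<in>{1..Suc (Suc n)}. generation N)"
    by (simp only:)
  have z: "(\<lambda>p. (fst (fst p))(Suc (Suc n) := (\<lambda>i\<in>{1..N}. snd (snd p i)))) \<in> ?X \<rightarrow>\<^sub>M (\<Pi>\<^sub>M t\<in>{1..Suc (Suc n)}. generation N)"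
    using measurable_compose[OF measurable_Pair[OF z1 z2] zadd] by (simp only: case_prod_conv)
  have a2: "(\<lambda>p. \<lambda>i\<in>{1..N}. fst (snd p i)) \<in> ?X \<rightarrow>\<^sub>M ?CN"
    by (rule measurable_restrict) (rule measurable_compose[OF yi measurable_fst])
  have a1: "(\<lambda>p. snd (fst p)) \<in> ?X \<rightarrow>\<^sub>M (\<Pi>\<^sub>M t\<in>{1..n}. ?CN)"
    unfolding csmc_space_def by (rule measurable_compose[OF measurable_fst measurable_snd])
  have "insert (Suc n) {1..n} = {1..Suc n}" by auto
  with measurable_add_dim[of "Suc n" "{1..n}" "\<lambda>_. ?CN"]
  have aadd: "(\<lambda>(f, y). f(Suc n := y)) \<in> (\<Pi>\<^sub>M t\<in>{1..n}. ?CN) \<Otimes>\<^sub>M ?CN \<rightarrow>\<^sub>M (\<Pi>\<^sub>M t\<in>{1..Suc n}. ?CN)"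
    by (simp only:)
  have a: "(\<lambda>p. (snd (fst p))(Suc n := (\<lambda>i\<in>{1..N}. fst (snd p i)))) \<in> ?X \<rightarrow>\<^sub>M (\<Pi>\<^sub>M t\<in>{1..Suc n}. ?CN)"
    using measurable_compose[OF measurable_Pair[OF a1 a2] aadd] by (simp only: case_prod_conv)
  show ?thesis using measurable_Pair[OF z a] by (simp add: append_generation_def csmc_space_def case_prod_beta')
qed

lemma csmc_hist_kernel:
  assumes N: "1 \<le> N" and x: "x (Suc (Suc n)) \<in> space S"
  shows "(\<lambda>\<omega>. distr (transition N x (Suc n) (fst \<omega> (Suc n))) (histories N (Suc n)) (append_generation N n \<omega>))
    \<in> histories N n \<rightarrow>\<^sub>M prob_algebra (histories N (Suc n))"
proof (rule measurable_distr_prob_space2)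
  show "(\<lambda>\<omega>. transition N x (Suc n) (fst \<omega> (Suc n))) \<in> histories N n \<rightarrow>\<^sub>M prob_algebra (\<Pi>\<^sub>M i\<in>{1..N}. tagged_states N)"
    by (rule measurable_compose[OF state_measurable csmc_step_measurable]) (use N x in auto)
qed (rule append_generation_measurable)

lemma init_map_measurable:
  "(\<lambda>z. (\<lambda>t\<in>{1::nat}. z, \<lambda>t\<in>{}. undefined)) \<in> generation N \<rightarrow>\<^sub>M histories N 0"
  unfolding csmc_space_def
proof (rule measurable_Pair)
  show "(\<lambda>z. \<lambda>t\<in>{1::nat}. z) \<in> generation N \<rightarrow>\<^sub>M (\<Pi>\<^sub>M t\<in>{1..Suc 0}. generation N)" by (simp add: measurable_restrict)
  show "(\<lambda>z. \<lambda>t\<in>{}. undefined) \<in> generation N \<rightarrow>\<^sub>M (\<Pi>\<^sub>M t\<in>{1..0::nat}. \<Pi>\<^sub>M i\<in>{1..N}. count_space {1..N})"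
    by (rule measurable_const) (auto simp: space_PiM)
qed

lemma csmc_hist_0: "hist N x 0 = distr (tagged_iid N (return S (x 1)) M1) (histories N 0) (\<lambda>z. (\<lambda>t\<in>{1::nat}. z, \<lambda>t\<in>{}. undefined))"
  unfolding csmc_hist.simps tagged_iid_def by (rule refl)

lemma init_tagged_iid_prob: "x 1 \<in> space S \<Longrightarrow> tagged_iid N (return S (x 1)) M1 \<in> space (prob_algebra (generation N))"
  by (rule tagged_iid_prob) (auto simp: space_prob_algebra prob_space_return \<mu>[unfolded space_prob_algebra] sets_\<mu> prob_\<mu>)

lemma csmc_hist_prob:
  assumes N: "1 \<le> N" and x: "\<And>t. 1 \<le> t \<Longrightarrow> t \<le> Suc n \<Longrightarrow> x t \<in> space S"
  shows "hist N x n \<in> space (prob_algebra (histories N n))"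
  using x
proof (induction n)
  case 0
  have p: "tagged_iid N (return S (x 1)) M1 \<in> space (prob_algebra (generation N))" by (rule init_tagged_iid_prob) (use 0 in simp)
  show ?case unfolding csmc_hist_0
    by (rule measurable_space[OF measurable_distr_prob_space[OF init_map_measurable] p])
next
  case (Suc n)
  have h: "hist N x n \<in> space (prob_algebra (histories N n))" by (rule Suc.IH) (use Suc.prems in auto)
  have k: "(\<lambda>\<omega>. distr (transition N x (Suc n) (fst \<omega> (Suc n))) (histories N (Suc n)) (append_generation N n \<omega>))
    \<in> histories N n \<rightarrow>\<^sub>M prob_algebra (histories N (Suc n))"
    by (rule csmc_hist_kernel[OF N]) (use Suc.prems in auto)
  show ?case unfolding csmc_hist_Suc
    using prob_space_bind'[OF h k] sets_bind'[OF h k] by (simp add: space_prob_algebra)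
qed

text \<open>Passing from histories to ancestral paths turns the recorded algorithm into the Markov
  chain of path systems.\<close>

lemma distr_csmc_hist:
  assumes N: "1 \<le> N" and T: "Suc n \<le> T" and x: "x \<in> space (paths S T)"
  shows "distr (hist N x n) (systems N (Suc n)) (genealogy N n) = system_law N x n"
  using T
proof (induction n)
  case 0
  have x1: "x 1 \<in> space S" using path_in_space[OF x] 0 by simp
  have p: "tagged_iid N (return S (x 1)) M1 \<in> space (prob_algebra (generation N))" by (rule init_tagged_iid_prob[where x=x, OF x1])
  have s: "sets (tagged_iid N (return S (x 1)) M1) = sets (generation N)" using p by (simp add: space_prob_algebra)
  have im: "(\<lambda>z. (\<lambda>t\<in>{1::nat}. z, \<lambda>t\<in>{}. undefined)) \<in> tagged_iid N (return S (x 1)) M1 \<rightarrow>\<^sub>M histories N 0"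
    unfolding measurable_cong_sets[OF s refl] by (rule init_map_measurable)
  have f: "(\<lambda>z. \<lambda>t\<in>{1::nat}. z) \<in> S \<rightarrow>\<^sub>M paths S 1" unfolding paths_def by (simp add: measurable_restrict)
  have r: "return S (x 1) \<in> space (prob_algebra S)" using x1 by (simp add: space_prob_algebra prob_space_return)
  have "distr (hist N x 0) (systems N (Suc 0)) (genealogy N 0) =
      distr (tagged_iid N (return S (x 1)) M1) (systems N (Suc 0)) (genealogy N 0 \<circ> (\<lambda>z. (\<lambda>t\<in>{1::nat}. z, \<lambda>t\<in>{}. undefined)))"
    unfolding csmc_hist_0 by (rule distr_distr[OF genealogy_measurable im]) simp
  also have "\<dots> = distr (tagged_iid N (return S (x 1)) M1) (systems N 1) (\<lambda>y. \<lambda>i\<in>{1..N}. (\<lambda>z. \<lambda>t\<in>{1::nat}. z) (y i))"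
    by (rule distr_cong) (auto simp: fun_eq_iff)
  also have "\<dots> = tagged_iid N (distr (return S (x 1)) (paths S 1) (\<lambda>z. \<lambda>t\<in>{1::nat}. z)) (distr M1 (paths S 1) (\<lambda>z. \<lambda>t\<in>{1::nat}. z))"
    by (rule tagged_iid_distr[OF r \<mu> f])
  also have "\<dots> = system_law N x 0"
    unfolding system_law.simps chain_law_1 distr_return[OF f x1] ..
  finally show ?case .
next
  case (Suc n)
  let ?t = "Suc n" and ?h = "hist N x n"
  let ?k = "\<lambda>\<omega>. distr (transition N x ?t (fst \<omega> ?t)) (histories N ?t) (append_generation N n \<omega>)"
  have t: "1 \<le> ?t" by simp
  have xt: "x (Suc ?t) \<in> space S" using path_in_space[OF x] Suc.prems by simp
  have hp: "?h \<in> space (prob_algebra (histories N n))"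
    by (rule csmc_hist_prob[OF N]) (use path_in_space[OF x] Suc.prems in auto)
  have sh: "sets ?h = sets (histories N n)" using hp by (simp add: space_prob_algebra)
  have sph: "space ?h = space (histories N n)" by (rule sets_eq_imp_space_eq[OF sh])
  have ne: "space ?h \<noteq> {}" using hp prob_space.not_empty by (auto simp: space_prob_algebra)
  have kh: "?k \<in> ?h \<rightarrow>\<^sub>M subprob_algebra (histories N ?t)"
    unfolding measurable_cong_sets[OF sh refl]
    by (rule measurable_prob_algebraD[OF csmc_hist_kernel[where x=x, OF N xt]])
  have Pm: "genealogy N n \<in> ?h \<rightarrow>\<^sub>M systems N ?t" unfolding measurable_cong_sets[OF sh refl] by (rule genealogy_measurable) simp
  have "distr (hist N x ?t) (systems N (Suc ?t)) (genealogy N ?t) = ?h \<bind> (\<lambda>\<omega>. distr (?k \<omega>) (systems N (Suc ?t)) (genealogy N ?t))"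
    unfolding csmc_hist_Suc by (rule distr_bind[OF kh ne genealogy_measurable]) simp
  also have "\<dots> = ?h \<bind> (\<lambda>\<omega>. csmc_kernel N ?t x (genealogy N n \<omega>))"
  proof (rule bind_cong[OF refl])
    fix \<omega> assume "\<omega> \<in> space ?h"
    then have \<omega>: "\<omega> \<in> space (histories N n)" by (simp add: sph)
    have z: "fst \<omega> ?t \<in> space (generation N)" by (rule measurable_space[OF state_measurable \<omega>]) auto
    have \<xi>: "genealogy N n \<omega> \<in> space (systems N ?t)" by (rule measurable_space[OF genealogy_measurable \<omega>]) simp
    have "transition N x ?t (fst \<omega> ?t) \<in> space (prob_algebra (\<Pi>\<^sub>M i\<in>{1..N}. tagged_states N))"
      by (rule measurable_space[OF csmc_step_measurable[where x=x, OF t N xt] z])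
    then have s: "sets (transition N x ?t (fst \<omega> ?t)) = sets (\<Pi>\<^sub>M i\<in>{1..N}. tagged_states N)" by (simp add: space_prob_algebra)
    have um: "append_generation N n \<omega> \<in> transition N x ?t (fst \<omega> ?t) \<rightarrow>\<^sub>M histories N ?t"
      unfolding measurable_cong_sets[OF s refl]
      using measurable_compose[OF measurable_Pair1'[OF \<omega>] append_generation_measurable] by simp
    have "distr (?k \<omega>) (systems N (Suc ?t)) (genealogy N ?t) = distr (transition N x ?t (fst \<omega> ?t)) (systems N (Suc ?t)) (genealogy N ?t \<circ> append_generation N n \<omega>)"
      by (rule distr_distr[OF genealogy_measurable um]) simp
    also have "\<dots> = distr (transition N x ?t (fst \<omega> ?t)) (systems N (Suc ?t)) (\<lambda>y. \<lambda>i\<in>{1..N}. (genealogy N n \<omega> (fst (y i)))(Suc ?t := snd (y i)))"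
    proof (rule distr_cong[OF refl refl])
      fix y
      have "genealogy N n (append_generation N n \<omega> y) = genealogy N n \<omega>" by (rule genealogy_cong) (auto simp: append_generation_def)
      then show "(genealogy N ?t \<circ> append_generation N n \<omega>) y = (\<lambda>i\<in>{1..N}. (genealogy N n \<omega> (fst (y i)))(Suc ?t := snd (y i)))"
        by (auto simp: fun_eq_iff append_generation_def)
    qed
    also have "\<dots> = csmc_kernel N ?t x (genealogy N n \<omega>)"
      by (rule csmc_step_distr[where x=x, OF t N xt \<xi> z genealogy_last])
    finally show "distr (?k \<omega>) (systems N (Suc ?t)) (genealogy N ?t) = csmc_kernel N ?t x (genealogy N n \<omega>)" .
  qed
  also have "\<dots> = distr ?h (systems N ?t) (genealogy N n) \<bind> csmc_kernel N ?t x"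
    by (rule bind_distr[OF Pm measurable_prob_algebraD[OF csmc_kernel_measurable1[OF t N Suc.prems x]] ne, symmetric])
  also have "\<dots> = system_law N x ?t" using Suc by simp
  finally show ?case .
qed

lemma icsmc_eq:
  assumes N: "1 \<le> N" and T: "1 \<le> T" and x: "x \<in> space (paths S T)"
  shows "ker N T x = system_law N x (T - 1) \<bind> (\<lambda>\<xi>. distr (selection N T \<xi>) (paths S T) (\<lambda>k. \<xi> k))"
proof -
  obtain n where n: "T = Suc n" using T by (cases T) auto
  let ?h = "hist N x n" and ?C = "histories N n"
  let ?k = "\<lambda>\<omega>. distr (select N (\<lambda>k. G T (fst \<omega> T k))) (?C \<Otimes>\<^sub>M count_space {1..N}) (Pair \<omega>)"
  let ?F = "\<lambda>p. genealogy N n (fst p) (snd p)"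
  have hp: "?h \<in> space (prob_algebra ?C)"
    by (rule csmc_hist_prob[OF N]) (use path_in_space[OF x] n in auto)
  have sh: "sets ?h = sets ?C" using hp by (simp add: space_prob_algebra)
  have sph: "space ?h = space ?C" by (rule sets_eq_imp_space_eq[OF sh])
  have ne: "space ?h \<noteq> {}" using hp prob_space.not_empty by (auto simp: space_prob_algebra)
  have selm: "(\<lambda>\<omega>. select N (\<lambda>k. G T (fst \<omega> T k))) \<in> ?C \<rightarrow>\<^sub>M prob_algebra (count_space {1..N})"
    by (rule measurable_compose[OF state_measurable select_S_measurable]) (use N n in auto)
  have k: "?k \<in> ?C \<rightarrow>\<^sub>M prob_algebra (?C \<Otimes>\<^sub>M count_space {1..N})"
    by (rule measurable_distr_prob_space2[OF selm]) simp
  have Fm: "?F \<in> ?C \<Otimes>\<^sub>M count_space {1..N} \<rightarrow>\<^sub>M paths S T"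
    using measurable_compose[OF measurable_Pair[OF measurable_compose[OF measurable_fst genealogy_measurable[OF order_refl]] measurable_snd] selected_component_measurable]
    by (simp add: n)
  have law: "csmc_law S M1 M G N T x = ?h \<bind> ?k" by (simp add: csmc_law_def n case_prod_beta')
  have kh: "?k \<in> ?h \<rightarrow>\<^sub>M subprob_algebra (?C \<Otimes>\<^sub>M count_space {1..N})"
    unfolding measurable_cong_sets[OF sh refl] by (rule measurable_prob_algebraD[OF k])
  have sl: "space (?h \<bind> ?k) = space (?C \<Otimes>\<^sub>M count_space {1..N})"
    by (rule space_bind_measurable[OF kh ne])
  have "ker N T x = distr (?h \<bind> ?k) (paths S T) ?F"
    unfolding icsmc_def law
  proof (rule distr_cong[OF refl refl], goal_cases)
    case (1 p)
    then have p: "fst p \<in> space ?C" "snd p \<in> {1..N}" unfolding sl by (auto simp: space_pair_measure)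
    show ?case
      unfolding genealogy_eq_lineage[OF p(1) order_refl p(2)] by (simp add: n case_prod_beta')
  qed
  also have "\<dots> = ?h \<bind> (\<lambda>\<omega>. distr (?k \<omega>) (paths S T) ?F)" by (rule distr_bind[OF kh ne Fm])
  also have "\<dots> = ?h \<bind> (\<lambda>\<omega>. distr (selection N T (genealogy N n \<omega>)) (paths S T) (\<lambda>k. genealogy N n \<omega> k))"
  proof (rule bind_cong[OF refl])
    fix \<omega> assume "\<omega> \<in> space ?h"
    then have \<omega>: "\<omega> \<in> space ?C" by (simp add: sph)
    have pm: "Pair \<omega> \<in> select N (\<lambda>k. G T (fst \<omega> T k)) \<rightarrow>\<^sub>M ?C \<Otimes>\<^sub>M count_space {1..N}"
      unfolding measurable_cong_sets[OF sets_select refl] by (rule measurable_Pair1'[OF \<omega>])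
    have "select N (\<lambda>k. G T (fst \<omega> T k)) = selection N T (genealogy N n \<omega>)"
      unfolding selection_def n by (rule select_cong) (simp add: genealogy_last)
    then show "distr (?k \<omega>) (paths S T) ?F = distr (selection N T (genealogy N n \<omega>)) (paths S T) (\<lambda>k. genealogy N n \<omega> k)"
      unfolding distr_distr[OF Fm pm] by (simp add: comp_def)
  qed
  also have "\<dots> = distr ?h (systems N T) (genealogy N n) \<bind> (\<lambda>\<xi>. distr (selection N T \<xi>) (paths S T) (\<lambda>k. \<xi> k))"
  proof (rule bind_distr[symmetric])
    show "genealogy N n \<in> ?h \<rightarrow>\<^sub>M systems N T" unfolding measurable_cong_sets[OF sh refl] n by (rule genealogy_measurable) simp
    show "(\<lambda>\<xi>. distr (selection N T \<xi>) (paths S T) (\<lambda>k. \<xi> k)) \<in> systems N T \<rightarrow>\<^sub>M subprob_algebra (paths S T)"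
      by (rule measurable_prob_algebraD, rule measurable_distr_prob_space2[OF selection_measurable[OF T N] selected_component_measurable])
  qed (rule ne)
  also have "distr ?h (systems N T) (genealogy N n) = system_law N x n"
    unfolding n by (rule distr_csmc_hist[OF N order_refl]) (use x n in simp)
  finally show ?thesis by (simp add: n)
qed

section \<open>The i-cSMC kernel\<close>

lemma stable_mono: "stable \<alpha> \<Longrightarrow> \<alpha> \<le> \<alpha>' \<Longrightarrow> stable \<alpha>'"
  unfolding stable_def by (meson mult_right_mono order_trans zero_le)

lemma prod_g_split: "1 \<le> T \<Longrightarrow> (\<Prod>t=1..T. ennreal (G t (w t))) = (\<Prod>s\<in>{1..<T}. g s (w s)) * g T (w T)"
  by (cases T) (simp_all add: g_def atLeastLessThanSuc_atLeastAtMost)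

lemma gam_\<Gamma>p: "1 \<le> T \<Longrightarrow> \<gamma> T = \<Gamma>p T (\<lambda>w. g T (w T))"
  by (simp only: gam_def \<Gamma>p_def prod_g_split)

lemma sets_target: "1 \<le> T \<Longrightarrow> sets (tgt T) = sets (paths S T)"
  by (simp add: target_def sets_chain_law)

lemma space_target: "1 \<le> T \<Longrightarrow> space (tgt T) = space (paths S T)"
  by (rule sets_eq_imp_space_eq[OF sets_target])

lemma nn_integral_target:
  assumes T: "1 \<le> T" and F: "F \<in> borel_measurable (paths S T)"
  shows "(\<integral>\<^sup>+w. F w \<partial>tgt T) = inverse (\<gamma> T) * \<Gamma>p T (\<lambda>w. g T (w T) * F w)"
proof -
  have s: "sets (chain T) = sets (paths S T)" by (rule sets_chain_law[OF T])
  have pm: "(\<lambda>w. (\<Prod>s\<in>{1..<T}. g s (w s)) * g T (w T)) \<in> borel_measurable (paths S T)"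
    by (intro borel_measurable_times_ennreal prod_g_measurable last_measurable[OF T g_measurable[OF T]])
  have "(\<integral>\<^sup>+w. F w \<partial>tgt T) =
    (\<integral>\<^sup>+w. (\<Prod>s\<in>{1..<T}. g s (w s)) * g T (w T) / \<gamma> T * F w \<partial>chain T)"
    unfolding target_def prod_g_split[OF T]
    by (rule nn_integral_density) (use pm F in \<open>auto simp: measurable_cong_sets[OF s refl]\<close>)
  also have "\<dots> = (\<integral>\<^sup>+w. inverse (\<gamma> T) * ((\<Prod>s\<in>{1..<T}. g s (w s)) * (g T (w T) * F w)) \<partial>chain T)"
    by (rule nn_integral_cong) (simp add: divide_ennreal_def mult_ac)
  also have "\<dots> = inverse (\<gamma> T) * \<Gamma>p T (\<lambda>w. g T (w T) * F w)"
    unfolding \<Gamma>p_def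
  proof (rule nn_integral_cmult, unfold measurable_cong_sets[OF s refl])
    show "(\<lambda>w. (\<Prod>s\<in>{1..<T}. g s (w s)) * (g T (w T) * F w)) \<in> borel_measurable (paths S T)"
      unfolding mult.assoc[symmetric] by (rule borel_measurable_times_ennreal[OF pm F])
  qed
  finally show ?thesis .
qed

lemma gam_inverse: "1 \<le> T \<Longrightarrow> inverse (\<gamma> T) * \<gamma> T = 1"
  using ennreal_divide_self[of "\<gamma> T"] gam_pos[of T] gam_fin[of T]
  by (simp add: divide_ennreal_def mult.commute)

lemma prob_target: assumes T: "1 \<le> T" shows "prob_space (tgt T)"
proof
  have "emeasure (tgt T) (space (tgt T)) = (\<integral>\<^sup>+w. 1 \<partial>tgt T)" by simp
  also have "\<dots> = 1" by (subst nn_integral_target[OF T]) (simp_all add: gam_\<Gamma>p[OF T, symmetric] gam_inverse[OF T])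
  finally show "emeasure (tgt T) (space (tgt T)) = 1" .
qed

lemma selected_path_measurable:
  "1 \<le> T \<Longrightarrow> 1 \<le> N \<Longrightarrow> (\<lambda>\<xi>. distr (selection N T \<xi>) (paths S T) (\<lambda>k. \<xi> k)) \<in> systems N T \<rightarrow>\<^sub>M prob_algebra (paths S T)"
  by (rule measurable_distr_prob_space2[OF selection_measurable selected_component_measurable])

lemma icsmc_measurable:
  assumes N: "1 \<le> N" and T: "1 \<le> T"
  shows "ker N T \<in> paths S T \<rightarrow>\<^sub>M prob_algebra (paths S T)"
proof -
  obtain n where n: "T = Suc n" using T by (cases T) auto
  have D: "(\<lambda>x. system_law N x (T - 1)) \<in> paths S T \<rightarrow>\<^sub>M prob_algebra (systems N T)"
    using system_law_kernel_measurable[OF N, of n] by (simp add: n)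
  have "(\<lambda>x. system_law N x (T - 1) \<bind> (\<lambda>\<xi>. distr (selection N T \<xi>) (paths S T) (\<lambda>k. \<xi> k))) \<in> paths S T \<rightarrow>\<^sub>M prob_algebra (paths S T)"
    by (rule measurable_bind_prob_space[OF D selected_path_measurable[OF T N]])
  then show ?thesis by (subst measurable_cong[OF icsmc_eq[OF N T]])
qed

lemma nn_integral_icsmc:
  assumes N: "1 \<le> N" and x: "x \<in> space (paths S (Suc n))" and F: "F \<in> borel_measurable (paths S (Suc n))"
  shows "(\<integral>\<^sup>+y. F y \<partial>ker N (Suc n) x) = (\<integral>\<^sup>+\<xi>. selected_mean N (Suc n) F \<xi> \<partial>system_law N x n)"
proof -
  let ?T = "Suc n"
  have T: "1 \<le> ?T" by simp
  have s: "sets (system_law N x n) = sets (systems N ?T)" using system_law_prob[OF N order_refl x] by (simp add: space_prob_algebra)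
  have k: "(\<lambda>\<xi>. distr (selection N ?T \<xi>) (paths S ?T) (\<lambda>k. \<xi> k)) \<in> system_law N x n \<rightarrow>\<^sub>M subprob_algebra (paths S ?T)"
    unfolding measurable_cong_sets[OF s refl] by (rule measurable_prob_algebraD[OF selected_path_measurable[OF T N]])
  have "(\<integral>\<^sup>+y. F y \<partial>ker N ?T x) = (\<integral>\<^sup>+\<xi>. \<integral>\<^sup>+y. F y \<partial>distr (selection N ?T \<xi>) (paths S ?T) (\<lambda>k. \<xi> k) \<partial>system_law N x n)"
    unfolding icsmc_eq[OF N T x] using nn_integral_bind[OF F k] by simp
  also have "\<dots> = (\<integral>\<^sup>+\<xi>. selected_mean N ?T F \<xi> \<partial>system_law N x n)"
  proof (rule nn_integral_cong)
    fix \<xi> assume "\<xi> \<in> space (system_law N x n)"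
    then have \<xi>: "\<xi> \<in> space (systems N ?T)" by (simp only: sets_eq_imp_space_eq[OF s])
    have "(\<lambda>k. \<xi> k) \<in> count_space {1..N} \<rightarrow>\<^sub>M paths S ?T"
      using systems_in_paths[OF \<xi>] by auto
    then have m: "(\<lambda>k. \<xi> k) \<in> selection N ?T \<xi> \<rightarrow>\<^sub>M paths S ?T"
      unfolding selection_def measurable_cong_sets[OF sets_select refl] .
    show "(\<integral>\<^sup>+y. F y \<partial>distr (selection N ?T \<xi>) (paths S ?T) (\<lambda>k. \<xi> k)) = selected_mean N ?T F \<xi>"
      by (subst nn_integral_distr[OF m]) (use F in \<open>simp_all add: selection_def nn_integral_select selected_mean_def\<close>)
  qed
  finally show ?thesis .
qed

text \<open>The identity that makes the kernel reversible and positive at the same time.\<close>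

lemma icsmc_form:
  assumes N: "1 \<le> N" and u: "u \<in> borel_measurable (paths S (Suc n))" and v: "v \<in> borel_measurable (paths S (Suc n))"
  shows "(\<integral>\<^sup>+x. u x * (\<integral>\<^sup>+y. v y \<partial>ker N (Suc n) x) \<partial>tgt (Suc n)) =
    inverse (\<gamma> (Suc n)) * (inverse (of_nat N) *
      (\<integral>\<^sup>+\<xi>. total_weight N (Suc n) \<xi> * (selected_mean N (Suc n) u \<xi> * selected_mean N (Suc n) v \<xi>) \<partial>extended_law N n))"
proof -
  let ?T = "Suc n"
  have T: "1 \<le> ?T" by simp
  have m: "(\<lambda>x. u x * (\<integral>\<^sup>+y. v y \<partial>ker N ?T x)) \<in> borel_measurable (paths S ?T)"
    by (rule borel_measurable_times_ennreal[OF u measurable_compose[OF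
          measurable_prob_algebraD[OF icsmc_measurable[OF N T]] nn_integral_measurable_subprob_algebra[OF v]]])
  have "\<Gamma>p ?T (\<lambda>w. g ?T (w ?T) * (u w * (\<integral>\<^sup>+y. v y \<partial>ker N ?T w))) =
     \<Gamma>p ?T (\<lambda>w. g ?T (w ?T) * (u w * (\<integral>\<^sup>+\<xi>. selected_mean N ?T v \<xi> \<partial>system_law N w n)))"
    by (rule \<Gamma>p_cong[OF T]) (simp add: nn_integral_icsmc[OF N _ v])
  then show ?thesis unfolding nn_integral_target[OF T m] bilinear_form[OF N u v, symmetric] by simp
qed

text \<open>Apply \<open>ratio_mean_lower_bound\<close> at the final time with \<open>v =
  g\<^sub>T\<close> and \<open>\<phi> = g\<^sub>T 1\<^sub>X\<close>: the ratio is the probability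
  that one of the particles \<open>2, \<dots>, N\<close> is selected and has its path in
  \<open>X\<close>, and the bound is a multiple of \<open>\<Gamma>\<^sub>p(\<phi>) /
  \<Gamma>\<^sub>T(g\<^sub>T) = \<pi>(X)\<close>.\<close>

lemma icsmc_minorised:
  assumes st: "stable (ennreal a)" and a: "1 \<le> a" and N: "2 \<le> N" and T: "1 \<le> T"
    and x: "x \<in> space (paths S T)" and X: "X \<in> sets (paths S T)"
  shows "minor_const a N T * measure (tgt T) X \<le> measure (ker N T x) X"
proof -
  obtain n where n: "T = Suc n" using T by (cases T) auto
  have N1: "1 \<le> N" using N by simp
  interpret \<pi>: prob_space "tgt T" by (rule prob_target[OF T])
  have ip: "ker N T x \<in> space (prob_algebra (paths S T))"
    by (rule measurable_space[OF icsmc_measurable[OF N1 T] x])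
  interpret P: prob_space "ker N T x" using ip by (simp add: space_prob_algebra)
  have sP: "sets (ker N T x) = sets (paths S T)" using ip by (simp add: space_prob_algebra)
  have Xm: "indicator X \<in> borel_measurable (paths S T)" using X by simp
  define \<phi> where "\<phi> = (\<lambda>e. g T (e T) * indicator X e)"
  have \<phi>: "\<phi> \<in> borel_measurable (paths S T)"
    unfolding \<phi>_def by (intro borel_measurable_times_ennreal last_measurable[OF T g_measurable[OF T]] Xm)
  have sD: "space (system_law N x n) = space (systems N T)" using space_system_law[OF N1, of n T x] x n by simp
  obtain c where c: "\<gamma> T = ennreal c" "0 < c"
    using gam_pos[OF T] gam_fin[OF T] by (cases "\<gamma> T") auto
  have \<Gamma>p\<phi>: "\<Gamma>p T \<phi> = ennreal (c * measure (tgt T) X)"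
  proof -
    have "emeasure (tgt T) X = inverse (\<gamma> T) * \<Gamma>p T \<phi>"
      using nn_integral_target[OF T Xm] X by (simp add: \<phi>_def sets_target[OF T])
    then have "\<gamma> T * emeasure (tgt T) X = \<Gamma>p T \<phi>"
      using gam_inverse[OF T] by (simp add: mult.assoc[symmetric] mult.commute[of "\<gamma> T"])
    then show ?thesis using c by (simp add: \<pi>.emeasure_eq_measure ennreal_mult)
  qed
  define K where "K = 2 * a + real N - 2"
  have K: "0 < K" using a N by (simp add: K_def)
  have Ke: "2 * ennreal a + of_nat (N - 2) = ennreal K"
  proof -
    have "2 * ennreal a + of_nat (N - 2) = ennreal (2 * a) + ennreal (real (N - 2))"
      using a by (simp add: ennreal_mult ennreal_of_nat_eq_real_of_nat)
    also have "\<dots> = ennreal K" using a N by (simp add: K_def of_nat_diff algebra_simps flip: ennreal_plus)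
    finally show ?thesis .
  qed
  have "ennreal (minor_const a N T * measure (tgt T) X) =
    of_nat (N - 1) ^ T * (\<Gamma>p T \<phi> * inverse ((2 * ennreal a + of_nat (N - 2)) ^ T * \<Gamma> T (g T)))"
  proof -
    have "\<Gamma> T (g T) = ennreal c" using gam_eq_\<Gamma>[OF T] c by simp
    then have "of_nat (N - 1) ^ T * (\<Gamma>p T \<phi> * inverse ((2 * ennreal a + of_nat (N - 2)) ^ T * \<Gamma> T (g T))) =
      ennreal (real (N - 1)) ^ T * (ennreal (c * measure (tgt T) X) * inverse (ennreal K ^ T * ennreal c))"
      unfolding \<Gamma>p\<phi> Ke by (simp add: ennreal_of_nat_eq_real_of_nat)
    also have "\<dots> = ennreal (real (N - 1) ^ T * (c * measure (tgt T) X * inverse (K ^ T * c)))"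
      using K c by (simp add: ennreal_power ennreal_mult[symmetric] inverse_ennreal)
    also have "real (N - 1) ^ T * (c * measure (tgt T) X * inverse (K ^ T * c)) = minor_const a N T * measure (tgt T) X"
    proof -
      have "minor_const a N T = (real (N - 1) / K) ^ T"
        unfolding minor_const_def K_def using N by (simp add: of_nat_diff)
      then show ?thesis using K c by (simp add: power_divide field_simps)
    qed
    finally show ?thesis by simp
  qed
  also have "\<dots> \<le> ratio_mean N x n \<phi> (g T)"
    using ratio_mean_lower_bound[OF st N _ x, of n \<phi> "g T"] \<phi> dominated_g[OF st T] n by simp
  also have "\<dots> \<le> (\<integral>\<^sup>+\<xi>. selected_mean N T (indicator X) \<xi> \<partial>system_law N x n)"
    unfolding ratio_mean_def
  proof (rule nn_integral_mono)
    fix \<xi> assume "\<xi> \<in> space (system_law N x n)"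
    then have \<xi>: "\<xi> \<in> space (systems N T)" by (simp only: sD)
    have Wfin: "total_weight N T \<xi> < top" by (simp add: total_weight_def g_def)
    have "(\<Sum>k=2..N. \<phi> (\<xi> k)) \<le> (\<Sum>k=1..N. \<phi> (\<xi> k))" by (rule sum_mono2) auto
    also have "\<dots> = total_weight N T \<xi> * selected_mean N T (indicator X) \<xi>"
      unfolding selected_mean_def sum_distrib_left \<phi>_def by (rule sum.cong) (simp_all add: g_eq_total_mult_weight[OF \<xi> T] mult.assoc)
    finally have "(\<Sum>k=2..N. \<phi> (\<xi> k)) * inverse (total_weight N T \<xi>) \<le> total_weight N T \<xi> * selected_mean N T (indicator X) \<xi> * inverse (total_weight N T \<xi>)"
      by (rule mult_right_mono) simp
    also have "\<dots> \<le> selected_mean N T (indicator X) \<xi>"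
    proof (cases "total_weight N T \<xi> = 0")
      case False
      have "total_weight N T \<xi> * inverse (total_weight N T \<xi>) = 1"
        using ennreal_divide_self[OF False Wfin] by (simp add: divide_ennreal_def)
      then have "total_weight N T \<xi> * selected_mean N T (indicator X) \<xi> * inverse (total_weight N T \<xi>) = selected_mean N T (indicator X) \<xi>"
        by (metis mult.commute mult.left_commute mult_1)
      then show ?thesis by simp
    qed simp
    finally show "(\<Sum>k=2..N. \<phi> (\<xi> k)) * inverse (\<Sum>j=1..N. g T (\<xi> j (Suc n))) \<le> selected_mean N T (indicator X) \<xi>"
      by (simp add: total_weight_def n)
  qed
  also have "\<dots> = (\<integral>\<^sup>+y. indicator X y \<partial>ker N T x)"
    unfolding n by (rule nn_integral_icsmc[OF N1, symmetric]) (use x Xm n in auto)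
  also have "\<dots> = ennreal (measure (ker N T x) X)"
    using X sP by (simp add: P.emeasure_eq_measure)
  finally show ?thesis by (simp add: ennreal_le_iff)
qed

text \<open>Symmetry is read off \<open>icsmc_form\<close>; positivity is \<open>2 U V \<le>
  U\<^sup>2 + V\<^sup>2\<close> under the integral.\<close>

lemma icsmc_positive_reversible:
  assumes st: "stable (ennreal a)" and a: "1 \<le> a" and N: "2 \<le> N" and T: "1 \<le> T"
  shows "positive_reversible_kernel (tgt T) (ker N T) (minor_const a N T)"
proof -
  obtain n where n: "T = Suc n" using T by (cases T) auto
  have N1: "1 \<le> N" using N by simp
  note s = sets_target[OF T]
  have b: "borel_measurable (tgt T) = borel_measurable (paths S T)"
    by (rule measurable_cong_sets[OF s refl])
  interpret \<pi>: prob_space "tgt T" by (rule prob_target[OF T])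
  have pa: "prob_algebra (tgt T) = prob_algebra (paths S T)"
    unfolding prob_algebra_def by (simp add: subprob_algebra_cong[OF s])
  show ?thesis
  proof
    show "ker N T \<in> tgt T \<rightarrow>\<^sub>M prob_algebra (tgt T)"
      unfolding pa measurable_cong_sets[OF s refl] by (rule icsmc_measurable[OF N1 T])
    show "0 < minor_const a N T" "minor_const a N T < 1" by (rule minor_const_bounds[OF a N T])+
    show "minor_const a N T * \<pi>.prob B \<le> measure (ker N T x) B"
      if "x \<in> space (tgt T)" "B \<in> \<pi>.events" for x B
      using icsmc_minorised[OF st a N T] that by (simp add: s space_target[OF T])
    fix u v :: "(nat \<Rightarrow> 'z) \<Rightarrow> ennreal"
    assume "u \<in> borel_measurable (tgt T)" "v \<in> borel_measurable (tgt T)"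
    then have u: "u \<in> borel_measurable (paths S (Suc n))" and v: "v \<in> borel_measurable (paths S (Suc n))"
      by (simp_all only: b n[symmetric])
    show "(\<integral>\<^sup>+x. u x * (\<integral>\<^sup>+y. v y \<partial>ker N T x) \<partial>tgt T) =
      (\<integral>\<^sup>+x. v x * (\<integral>\<^sup>+y. u y \<partial>ker N T x) \<partial>tgt T)"
      unfolding n icsmc_form[OF N1 u v] icsmc_form[OF N1 v u] by (simp add: mult.commute)
    have Wm: "total_weight N T \<in> borel_measurable (systems N T)"
      unfolding total_weight_def[abs_def] by (rule borel_measurable_sum, rule systems_last_measurable[OF T _ g_measurable[OF T]])
    have prm: "(\<lambda>\<xi>. total_weight N (Suc n) \<xi> * (selected_mean N (Suc n) p \<xi> * selected_mean N (Suc n) q \<xi>)) \<in> borel_measurable (extended_law N n)"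
      if "p \<in> borel_measurable (paths S (Suc n))" "q \<in> borel_measurable (paths S (Suc n))" for p q
      unfolding extended_law_measurable_iff[OF N1]
      by (intro borel_measurable_times_ennreal Wm[unfolded n] selected_mean_measurable that) auto
    have "2 * (\<integral>\<^sup>+\<xi>. total_weight N (Suc n) \<xi> * (selected_mean N (Suc n) u \<xi> * selected_mean N (Suc n) v \<xi>) \<partial>extended_law N n) =
      (\<integral>\<^sup>+\<xi>. 2 * (total_weight N (Suc n) \<xi> * (selected_mean N (Suc n) u \<xi> * selected_mean N (Suc n) v \<xi>)) \<partial>extended_law N n)"
      by (rule nn_integral_cmult[OF prm[OF u v], symmetric])
    also have "\<dots> \<le> (\<integral>\<^sup>+\<xi>. total_weight N (Suc n) \<xi> * (selected_mean N (Suc n) u \<xi> * selected_mean N (Suc n) u \<xi>)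
        + total_weight N (Suc n) \<xi> * (selected_mean N (Suc n) v \<xi> * selected_mean N (Suc n) v \<xi>) \<partial>extended_law N n)"
    proof (rule nn_integral_mono)
      fix \<xi>
      have "total_weight N (Suc n) \<xi> * (2 * (selected_mean N (Suc n) u \<xi> * selected_mean N (Suc n) v \<xi>)) \<le>
        total_weight N (Suc n) \<xi> * (selected_mean N (Suc n) u \<xi> * selected_mean N (Suc n) u \<xi> + selected_mean N (Suc n) v \<xi> * selected_mean N (Suc n) v \<xi>)"
        by (intro mult_left_mono ennreal_two_mult_le_squares) simp
      then show "2 * (total_weight N (Suc n) \<xi> * (selected_mean N (Suc n) u \<xi> * selected_mean N (Suc n) v \<xi>)) \<le>
        total_weight N (Suc n) \<xi> * (selected_mean N (Suc n) u \<xi> * selected_mean N (Suc n) u \<xi>)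
        + total_weight N (Suc n) \<xi> * (selected_mean N (Suc n) v \<xi> * selected_mean N (Suc n) v \<xi>)"
        by (simp only: distrib_left mult.left_commute[of 2])
    qed
    also have "\<dots> = (\<integral>\<^sup>+\<xi>. total_weight N (Suc n) \<xi> * (selected_mean N (Suc n) u \<xi> * selected_mean N (Suc n) u \<xi>) \<partial>extended_law N n)
      + (\<integral>\<^sup>+\<xi>. total_weight N (Suc n) \<xi> * (selected_mean N (Suc n) v \<xi> * selected_mean N (Suc n) v \<xi>) \<partial>extended_law N n)"
      by (rule nn_integral_add[OF prm[OF u u] prm[OF v v]])
    finally have le: "inverse (\<gamma> (Suc n)) * (inverse (of_nat N) *
        (2 * (\<integral>\<^sup>+\<xi>. total_weight N (Suc n) \<xi> * (selected_mean N (Suc n) u \<xi> * selected_mean N (Suc n) v \<xi>) \<partial>extended_law N n)))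
      \<le> inverse (\<gamma> (Suc n)) * (inverse (of_nat N) *
        ((\<integral>\<^sup>+\<xi>. total_weight N (Suc n) \<xi> * (selected_mean N (Suc n) u \<xi> * selected_mean N (Suc n) u \<xi>) \<partial>extended_law N n)
      + (\<integral>\<^sup>+\<xi>. total_weight N (Suc n) \<xi> * (selected_mean N (Suc n) v \<xi> * selected_mean N (Suc n) v \<xi>) \<partial>extended_law N n)))"
      by (intro mult_left_mono) auto
    then show "2 * (\<integral>\<^sup>+x. u x * (\<integral>\<^sup>+y. v y \<partial>ker N T x) \<partial>tgt T) \<le>
      (\<integral>\<^sup>+x. u x * (\<integral>\<^sup>+y. u y \<partial>ker N T x) \<partial>tgt T) +
      (\<integral>\<^sup>+x. v x * (\<integral>\<^sup>+y. v y \<partial>ker N T x) \<partial>tgt T)"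
      unfolding n icsmc_form[OF N1 u v] icsmc_form[OF N1 u u] icsmc_form[OF N1 v v]
      by (simp only: distrib_left mult.left_commute[of 2])
  qed
qed

lemma stable_of_A1_or_A2:
  assumes "(\<exists>\<alpha>>0. \<forall>p\<ge>1. \<forall>k\<ge>1.
          (SUP z\<in>space S. Q S M G p (p + k) (\<lambda>_. 1) z
             / eta S M1 M G p (Q S M G p (p + k) (\<lambda>_. 1))) \<le> ennreal \<alpha>)
       \<or>
       (\<exists>m\<ge>1. \<exists>\<beta>\<ge>1. \<exists>\<delta>::real.
          (\<forall>p\<ge>1. \<forall>z\<in>space S. \<forall>z'\<in>space S. \<forall>B\<in>sets S.
             measure (Mbar M m p z) B \<le> \<beta> * measure (Mbar M m p z') B)
          \<and> 1 \<le> (SUP (z, z', p)\<in>space S \<times> space S \<times> {1..}. ennreal (G p z) / ennreal (G p z'))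
          \<and> (SUP (z, z', p)\<in>space S \<times> space S \<times> {1..}. ennreal (G p z) / ennreal (G p z'))
              \<le> ennreal (root m \<delta>))"
  obtains a :: real where "1 \<le> a" "stable (ennreal a)"
  using assms
proof (elim disjE exE conjE)
  fix \<alpha> :: real
  assume \<alpha>: "0 < \<alpha>" and A1: "\<forall>p\<ge>1. \<forall>k\<ge>1. (SUP z\<in>space S. Q S M G p (p + k) (\<lambda>_. 1) z
             / eta S M1 M G p (Q S M G p (p + k) (\<lambda>_. 1))) \<le> ennreal \<alpha>"
  \<comment> \<open>The bounds on the minorisation constant need \<open>a \<ge> 1\<close>.\<close>
  have "stable (ennreal (max 1 \<alpha>))"
    by (rule stable_mono[OF stable_A1[OF A1]]) (simp add: ennreal_leI)
  then show thesis by (rule that[rotated]) simp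
next
  fix m and \<beta> \<delta> :: real
  let ?SUP = "SUP (z, z', p)\<in>space S \<times> space S \<times> {1..}. ennreal (G p z) / ennreal (G p z')"
  assume m: "1 \<le> m" and \<beta>: "1 \<le> \<beta>"
    and mix: "\<forall>p\<ge>1. \<forall>z\<in>space S. \<forall>z'\<in>space S. \<forall>B\<in>sets S.
             measure (Mbar M m p z) B \<le> \<beta> * measure (Mbar M m p z') B"
    and l: "1 \<le> ?SUP" and u: "?SUP \<le> ennreal (root m \<delta>)"
  define d where "d = root m \<delta>"
  have "1 \<le> ennreal d" using l u unfolding d_def by (rule order_trans)
  then have d: "1 \<le> d" by simp
  have osc: "G p z \<le> d * G p z'" if p: "1 \<le> p" and z: "z \<in> space S" "z' \<in> space S" for p z z'
  proof -
    have "ennreal (G p z) / ennreal (G p z') \<le> ?SUP"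
      using p z by (intro SUP_upper2[of "(z, z', p)"]) auto
    then have r: "ennreal (G p z) / ennreal (G p z') \<le> ennreal d" using u by (simp add: d_def)
    have nn: "0 \<le> G p z" "0 \<le> G p z'" using G_nonneg p z by auto
    show ?thesis
    \<comment> \<open>A potential that vanishes at \<open>z'\<close> must vanish at \<open>z\<close>, as
      otherwise the ratio would be infinite.\<close>
    proof (cases "G p z' = 0")
      case True
      then have "ennreal (G p z) = 0" using r by (auto simp: top_unique split: if_splits)
      then show ?thesis using True nn by (simp add: ennreal_eq_0_iff)
    next
      case False
      then have pos: "0 < G p z'" using nn by simp
      then have "ennreal (G p z / G p z') \<le> ennreal d" using r nn by (simp add: divide_ennreal)
      then have "G p z / G p z' \<le> d" using d by (simp add: ennreal_le_iff)
      then show ?thesis using pos by (simp add: pos_divide_le_eq)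
    qed
  qed
  have "stable (ennreal (\<beta> * d ^ (2 * m)))"
    by (rule stable_A2[OF m \<beta> d _ osc]) (use mix in auto)
  moreover have "1 * 1 \<le> \<beta> * d ^ (2 * m)" using \<beta> d by (intro mult_mono one_le_power) auto
  ultimately show thesis using that by simp
qed

end

theorem theorem3:
  fixes S :: "'z measure"
    and M1 :: "'z measure"
    and M :: "nat \<Rightarrow> 'z \<Rightarrow> 'z measure"
    and G :: "nat \<Rightarrow> 'z \<Rightarrow> real"
  defines "\<pi> \<equiv> target S M1 M G"
    and "P \<equiv> icsmc S M1 M G"
  assumes M1: "M1 \<in> space (prob_algebra S)"
    and M: "\<And>t. t \<ge> 2 \<Longrightarrow> M t \<in> S \<rightarrow>\<^sub>M prob_algebra S"
    and G_measurable: "\<And>t. t \<ge> 1 \<Longrightarrow> G t \<in> borel_measurable S"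
    and G_nonneg: "\<And>t z. t \<ge> 1 \<Longrightarrow> z \<in> space S \<Longrightarrow> G t z \<ge> 0"
    and gam: "\<And>T. T \<ge> 1 \<Longrightarrow> 0 < gam S M1 M G T \<and> gam S M1 M G T < \<infinity>"
    and ess_bounded: "\<And>T t. 1 \<le> t \<Longrightarrow> t \<le> T \<Longrightarrow>
          esssup (target_marginal S M1 M G T t) (\<lambda>z. ereal (G t z)) < \<infinity>"
    and A1_or_A2:
      "(\<exists>\<alpha>>0. \<forall>p\<ge>1. \<forall>k\<ge>1.
          (SUP z\<in>space S. Q S M G p (p + k) (\<lambda>_. 1) z
             / eta S M1 M G p (Q S M G p (p + k) (\<lambda>_. 1))) \<le> ennreal \<alpha>)
       \<or>
       (\<exists>m\<ge>1. \<exists>\<beta>\<ge>1. \<exists>\<delta>::real.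
          (\<forall>p\<ge>1. \<forall>z\<in>space S. \<forall>z'\<in>space S. \<forall>B\<in>sets S.
             measure (Mbar M m p z) B \<le> \<beta> * measure (Mbar M m p z') B)
          \<and> 1 \<le> (SUP (z, z', p)\<in>space S \<times> space S \<times> {1..}. ennreal (G p z) / ennreal (G p z'))
          \<and> (SUP (z, z', p)\<in>space S \<times> space S \<times> {1..}. ennreal (G p z) / ennreal (G p z'))
              \<le> ennreal (root m \<delta>))"
  shows "\<exists>\<epsilon> :: nat \<Rightarrow> nat \<Rightarrow> real.
      (\<forall>T\<ge>1. \<forall>N\<ge>2. \<epsilon> N T > 0)
    \<and> (\<forall>T\<ge>1. \<forall>N\<ge>2. \<forall>x\<in>space (paths S T). \<forall>B\<in>sets (paths S T).
          measure (P N T x) B \<ge> \<epsilon> N T * measure (\<pi> T) B)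
    \<and> (\<forall>T\<ge>1. (\<lambda>N. 1 - \<epsilon> N T) \<in> O(\<lambda>N. 1 / real N))
    \<and> (\<forall>T\<ge>1. \<forall>N\<ge>2. \<forall>\<nu>\<in>space (prob_algebra (paths S T)). absolutely_continuous (\<pi> T) \<nu> \<longrightarrow>
          (\<forall>k\<ge>1. L2_dist (\<pi> T) (kernel_iter \<nu> (P N T) k) (\<pi> T)
                   \<le> L2_dist (\<pi> T) \<nu> (\<pi> T) * ennreal ((1 - \<epsilon> N T) ^ k)))
    \<and> (\<forall>T\<ge>1. \<forall>N\<ge>2. \<forall>x\<in>space (paths S T). \<forall>k\<ge>1.
          tv_dist (kernel_iter (return (paths S T) x) (P N T) k) (\<pi> T) \<le> (1 - \<epsilon> N T) ^ k)
    \<and> (\<forall>T\<ge>1. \<forall>N\<ge>2. \<forall>f :: (nat \<Rightarrow> 'z) \<Rightarrow> real.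
          f \<in> borel_measurable (\<pi> T) \<longrightarrow> integrable (\<pi> T) (\<lambda>w. (f w)\<^sup>2) \<longrightarrow>
          convergent (avg_var (\<pi> T) (P N T) f)
          \<and> var (\<pi> T) f \<le> asym_var (\<pi> T) (P N T) f
          \<and> asym_var (\<pi> T) (P N T) f \<le> (2 / \<epsilon> N T - 1) * var (\<pi> T) f)
    \<and> (\<exists>C :: real. \<exists>e :: real. C > 0 \<and> e > 0
          \<and> (\<forall>T\<ge>1. \<exists>N\<ge>2. real N = C * real T \<and> \<epsilon> N T \<ge> e))"
proof -
  interpret feynman_kac S M1 M G
    by unfold_locales (use M1 M G_measurable G_nonneg gam in auto)
  obtain a where a: "1 \<le> a" and st: "stable (ennreal a)" by (rule stable_of_A1_or_A2[OF A1_or_A2])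
  note kernel = icsmc_positive_reversible[OF st a]
  have pa: "prob_algebra (\<pi> T) = prob_algebra (paths S T)" if "1 \<le> T" for T
    unfolding prob_algebra_def \<pi>_def by (simp add: subprob_algebra_cong[OF sets_target[OF that]])
  show ?thesis
  proof (rule exI[of _ "minor_const a"], intro conjI allI impI ballI)
    fix T N :: nat assume T: "1 \<le> T" and N: "2 \<le> N"
    interpret R: positive_reversible_kernel "\<pi> T" "P N T" "minor_const a N T"
      unfolding \<pi>_def P_def by (rule kernel[OF N T])
    show "0 < minor_const a N T" by (rule R.eps)
    show "minor_const a N T * measure (\<pi> T) B \<le> measure (P N T x) B"
      if "x \<in> space (paths S T)" "B \<in> sets (paths S T)" for x B
      unfolding \<pi>_def P_def by (rule icsmc_minorised[OF st a N T that])
    show "L2_dist (\<pi> T) (kernel_iter \<nu> (P N T) k) (\<pi> T) \<le> L2_dist (\<pi> T) \<nu> (\<pi> T) * ennreal ((1 - minor_const a N T) ^ k)"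
      if "\<nu> \<in> space (prob_algebra (paths S T))" "absolutely_continuous (\<pi> T) \<nu>" for \<nu> k
      by (rule R.L2_contraction) (use that pa[OF T] in auto)
    show "tv_dist (kernel_iter (return (paths S T) x) (P N T) k) (\<pi> T) \<le> (1 - minor_const a N T) ^ k"
      if "x \<in> space (paths S T)" for x k
      by (rule R.tv_contraction) (use that in \<open>simp add: pa[OF T] space_prob_algebra prob_space_return\<close>)
    fix f :: "(nat \<Rightarrow> 'z) \<Rightarrow> real"
    assume f: "f \<in> borel_measurable (\<pi> T)" "integrable (\<pi> T) (\<lambda>w. (f w)\<^sup>2)"
    show "convergent (avg_var (\<pi> T) (P N T) f)" "var (\<pi> T) f \<le> asym_var (\<pi> T) (P N T) f"
      "asym_var (\<pi> T) (P N T) f \<le> (2 / minor_const a N T - 1) * var (\<pi> T) f"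
      by (rule R.asymptotic_variance[OF f])+
  next
    fix T :: nat assume T: "1 \<le> T"
    show "(\<lambda>N. 1 - minor_const a N T) \<in> O(\<lambda>N. 1 / real N)"
    proof (rule bigoI[of _ "real T * (2 * a - 1)"])
      show "\<forall>\<^sub>F N in sequentially. norm (1 - minor_const a N T) \<le> real T * (2 * a - 1) * norm (1 / real N)"
        using eventually_ge_at_top[of 2]
      proof eventually_elim
        case (elim N)
        then show ?case using minor_const_bounds[OF a elim T] by simp
      qed
    qed
  next
    \<comment> \<open>With \<open>N = 2 T\<close> the exponent \<open>T (2 a - 1) / (N - 1)\<close> is
      at most \<open>2 a - 1\<close>, since \<open>T \<le> 2 T - 1\<close>.\<close>
    let ?e = "exp (- (2 * a - 1))"
    have "\<exists>N\<ge>2. real N = 2 * real T \<and> ?e \<le> minor_const a N T" if T: "1 \<le> T" for T :: nat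
    proof (intro exI[of _ "2 * T"] conjI)
      show N: "2 \<le> 2 * T" using T by simp
      have "real T * (2 * a - 1) \<le> (real (2 * T) - 1) * (2 * a - 1)"
        using a T by (intro mult_right_mono) auto
      then have "real T * (2 * a - 1) / (real (2 * T) - 1) \<le> 2 * a - 1"
        using T by (subst pos_divide_le_eq) (auto simp: mult.commute)
      then have "?e \<le> exp (- (real T * (2 * a - 1) / (real (2 * T) - 1)))" by simp
      also have "\<dots> \<le> minor_const a (2 * T) T" by (rule minor_const_bounds(4)[OF a N T])
      finally show "?e \<le> minor_const a (2 * T) T" .
    qed simp
    then show "\<exists>C e. 0 < C \<and> 0 < e \<and> (\<forall>T\<ge>1. \<exists>N\<ge>2. real N = C * real T \<and> e \<le> minor_const a N T)"
      by (intro exI[of _ 2] exI[of _ ?e]) auto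
  qed
qed

end
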